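(* Let $\beta>0$. If $\mathsf{P}$ is a "good" point process on $\mathbb{R}^2$ (in the sense defined in the context) which satisfies the canonical DLR equations at inverse temperature $\beta$ (as in the context), then $\mathsf{P}$ is translation-invariant: for every $u\in\mathbb{R}^2$ the push-forward of $\mathsf{P}$ by $\mathbf{X}\mapsto\sum_{x\in\mathbf{X}}\delta_{x+u}$ equals $\mathsf{P}$.
   Context: Point configurations. $\mathrm{Conf}$ is the space of locally finite point configurations in $\mathbb{R}^2$ (sums of Dirac masses), with the vague topology and its Borel $\sigma$-algebra; a point process is a probability measure on $\mathrm{Conf}$. $\mathsf{Pts}(\mathbf{X},\Lambda)$ is the number of points of $\mathbf{X}$ in $\Lambda$; $\mathbf{X}_\Lambda$ is the restriction; $\bar\Lambda=\mathbb{R}^2\setminus\Lambda$; $\mathrm{Conf}(\Lambda,n)$ is the set of configurations in $\Lambda$ with exactly $n$ points; $\mathsf{Bin}_{\Lambda,n}$ is the law of $n$ i.i.d. uniform points in $\Lambda$. $\mathfrak{D}(x,r)$ is the disk of center $x$, radius $r$, and $\mathfrak{D}(r)=\mathfrak{D}(0,r)$. $\mathrm{Fluct}[\varphi](\mathbf{X})=\int\varphi\,\mathrm{d}(\mathbf{X}-\mathrm{Leb})$. For a function $\varphi$, $|\varphi|_k$ is the sup over $\mathbb{R}^2$ of the norm of its $k$-th derivative. Energies. For $\Lambda$ bounded Borel and $\mathbf{X}'$ a finite configuration in $\Lambda$, $$\mathsf{F}_\Lambda(\mathbf{X}')=\tfrac12\iint_{\Lambda\times\Lambda,\,x\neq y}-\log|x-y|\,\mathrm{d}(\mathbf{X}'-\mathrm{Leb})(x)\,\mathrm{d}(\mathbf{X}'-\mathrm{Leb})(y)$$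 (for $\mathbf{X}\in\mathrm{Conf}$, $\mathsf{F}_\Lambda(\mathbf{X})$ means $\mathsf{F}_\Lambda(\mathbf{X}_\Lambda)$). For $\mathbf{X}'\in\mathrm{Conf}(\Lambda,\mathsf{Pts}(\mathbf{X},\Lambda))$, $$\mathsf{M}_\Lambda(\mathbf{X}',\mathbf{X})=\lim_{p\to\infty}\iint_{\Lambda\times\bar\Lambda}-\log|x-y|\,\mathrm{d}(\mathbf{X}'-\mathbf{X}_\Lambda)(x)\sum_{i=0}^p\chi_i(y)\,\mathrm{d}(\mathbf{X}_{\bar\Lambda}-\mathrm{Leb})(y)$$ (in the first argument of $\mathsf{M}_\Lambda$, a configuration is understood as restricted to $\Lambda$). Here $(\chi_i)_{i\ge0}$ is a fixed smooth non-negative partition of unity of $\mathbb{R}^2$, $\chi_0$ supported on $\mathfrak{D}(2)$, $\chi_i$ supported on $\mathfrak{D}(2^{i+1})\setminus\mathfrak{D}(2^{i-1})$ for $i\ge1$, $|\chi_i|_k\le C_\chi2^{-ik}$ for $k=0,1,2,3$ and all $i\ge 0$. Properties 1–3 below ensure that, for $\mathsf{P}$-a.e. $\mathbf{X}$, this limit exists and is finite for all such $\mathbf{X}'$. DLR equations. $\mathsf{P}$ satisfies them if for all bounded Borel $\Lambda$ and all bounded measurable $f:\mathrm{Conf}\to\mathbb{R}$, $$\mathbb{E}_{\mathsf{P}}[f]=\mathbb{E}_{\mathsf{P}}\Big[\tfrac{1}{\mathrm{K}^\beta_\Lambda(\mathbf{X})}\int f(\mathbf{X}'\cup\mathbf{X}_{\bar\Lambda})e^{-\beta(\mathsf{F}_\Lambda(\mathbf{X}')+\mathsf{M}_\Lambda(\mathbf{X}',\mathbf{X}))}\mathrm{d}\mathsf{Bin}_{\Lambda,\mathsf{Pts}(\mathbf{X},\Lambda)}(\mathbf{X}')\Big],$$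 with $\mathrm{K}^\beta_\Lambda(\mathbf{X})=\int e^{-\beta(\mathsf{F}_\Lambda(\mathbf{X}')+\mathsf{M}_\Lambda(\mathbf{X}',\mathbf{X}))}\mathrm{d}\mathsf{Bin}_{\Lambda,\mathsf{Pts}(\mathbf{X},\Lambda)}(\mathbf{X}')$. Localized translations. For every $\vec v\in\mathbb{R}^2$ with $\|\vec v\|\le1$ and every $L\ge2$, fix two area-preserving diffeomorphisms $\mathsf{T}_L^+,\mathsf{T}_L^-$ of $\mathbb{R}^2$, inverse of each other, with $\mathsf{T}_L^\pm(x)=x\pm\vec v$ for $|x|\le L$, $\mathsf{T}_L^\pm(x)=x$ for $|x|\ge2L$, and such that $\psi_L^\pm:=\mathsf{T}_L^\pm-\mathrm{Id}$ satisfies $|\psi^\pm_L|_k\le CL^{-k}$ ($k=0,1,2,3$) and $|\psi_L^++\psi_L^-|_k\le CL^{-k-1}$ ($k=0,1,2$), with a universal constant $C$ (such maps exist). Write $\mathsf{T}\cdot\mathbf{X}$ for the push-forward of $\mathbf{X}$. With $\Lambda=\mathfrak{D}(10L)$, set $$\mathsf{Diff}^1_L(\mathbf{X})=\tfrac12\big(\mathsf{F}_\Lambda(\mathsf{T}_L^+\cdot\mathbf{X})+\mathsf{F}_\Lambda(\mathsf{T}_L^-\cdot\mathbf{X})\big)-\mathsf{F}_\Lambda(\mathbf{X}),$$ $$\mathsf{Diff}^2_L(\mathbf{X}',\mathbf{X})=\tfrac12\big(\mathsf{M}_\Lambda(\mathsf{T}_L^+\cdot\mathbf{X}',\mathbf{X})+\mathsf{M}_\Lambda(\mathsf{T}_L^-\cdot\mathbf{X}',\mathbf{X})\big)-\mathsf{M}_\Lambda(\mathbf{X}',\mathbf{X}).$$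 Good processes. Fix a constant $\rho_\beta>0$ depending only on $\beta$. $\mathsf{P}$ is good if there are constants $C>0$ and $L_0\ge2$, possibly depending on $\mathsf{P}$, such that: 1. for all $x\in\mathbb{R}^2$, $\ell\ge\rho_\beta$: $\log\mathbb{E}_{\mathsf{P}}\big[\exp\big(\tfrac1C\mathsf{Pts}(\mathbf{X},\mathfrak{D}(x,\ell))^2\big)\big]\le C\ell^4$; 2. the one-point correlation function (intensity density) satisfies $\sup_{y\in\mathbb{R}^2}\rho_{1,\mathsf{P}}(y)\le C$; 3. for all $x\in\mathbb{R}^2$, $\ell\ge\rho_\beta$: (Lipschitz) $\log\mathbb{E}_{\mathsf{P}}\big[\sup_{\varphi}e^{\frac1C\mathrm{Fluct}[\varphi]^2}\big]\le C\ell^2$, the sup being over all $\ell^{-1}$-Lipschitz $\varphi:\mathbb{R}^2\to\mathbb{R}$ compactly supported on $\mathfrak{D}(x,4\ell)$; (smooth) for every $C^3$ function $\varphi$ compactly supported in $\mathfrak{D}(x,4\ell)$ with $|\varphi|_k\le C_\varphi\ell^{-k}$ for $k=1,2,3$, and all $|s|\le\frac{\ell^2}{C\,C_\varphi}$: $\big|\log\mathbb{E}_{\mathsf{P}}[e^{s\mathrm{Fluct}[\varphi]}]\big|\le C(|s|C_\varphi+s^4C_\varphi^4)$ and $\mathbb{E}_{\mathsf{P}}[|\mathrm{Fluct}[\varphi]|]\le C\,C_\varphi$; 4. for all $\vec v$ with $\|\vec v\|\le1$ and all $L\ge L_0$: $\log\mathbb{E}_{\mathsf{P}}\big[\exp(2\beta\,\mathsf{Diff}^1_L(\mathbf{X}))\big]\le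 C$ and $\log\mathbb{E}_{\mathsf{P}}\big[\exp(2\beta\,\mathsf{Diff}^2_L(\mathbf{X},\mathbf{X}))\big]\le C$. *)

theory Defs
  imports "HOL-Probability.Probability"
begin

section \<open>Point configurations\<close>

type_synonym plane = "real ^ 2"

text \<open>A configuration is represented by its multiplicity function, i.e. \<open>c\<close> stands for
  the sum of Dirac masses \<open>\<Sum>x. c x \<cdot> \<delta>\<^sub>x\<close>; multiple points are allowed.\<close>

typedef conf = "{c :: plane \<Rightarrow> nat. \<forall>r. finite {x \<in> cball 0 r. c x \<noteq> 0}}"
  morphisms mult Conf
  by (rule exI[of _ "\<lambda>_. 0"]) simp

setup_lifting type_definition_conf

text \<open>The sum of Dirac masses itself, as a Borel measure on the plane.\<close>

definition meas :: "conf \<Rightarrow> plane measure" where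
  "meas X = distr (density (count_space UNIV) (\<lambda>x. of_nat (mult X x))) borel (\<lambda>x. x)"

text \<open>The vague topology: the coarsest one for which all integrals against continuous compactly
  supported functions are continuous. The measurable structure on \<^typ>\<open>conf\<close> is the resulting
  Borel sigma-algebra \<^term>\<open>borel\<close>.\<close>

instantiation conf :: topological_space
begin

definition open_conf :: "conf set \<Rightarrow> bool" where
  "open_conf = generate_topology
     {{X. (LINT x|meas X. f x) \<in> U} | (f :: plane \<Rightarrow> real) U.
        continuous_on UNIV f \<and> compact (closure {x. f x \<noteq> 0}) \<and> open U}"

instance
proof
  show "open (UNIV :: conf set)"
    unfolding open_conf_def by (rule generate_topology.UNIV)
next
  fix S T :: "conf set"
  assume "open S" "open T"
  then show "open (S \<inter> T)"
    unfolding open_conf_def by (rule generate_topology.Int)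
next
  fix K :: "conf set set"
  assume "\<forall>S\<in>K. open S"
  then show "open (\<Union>K)"
    unfolding open_conf_def by (intro generate_topology.UN) auto
qed

end

definition point_process :: "conf measure \<Rightarrow> bool" where
  "point_process P \<longleftrightarrow> prob_space P \<and> sets P = sets borel"

text \<open>Only meaningful for bounded \<open>\<Lambda>\<close>.\<close>

definition Pts :: "conf \<Rightarrow> plane set \<Rightarrow> nat" where
  "Pts X \<Lambda> = (\<Sum>x | x \<in> \<Lambda> \<and> mult X x \<noteq> 0. mult X x)"

lift_definition restr :: "conf \<Rightarrow> plane set \<Rightarrow> conf" is
  "\<lambda>c \<Lambda> x. if x \<in> \<Lambda> then c x else 0"
  subgoal premises c for c \<Lambda>
    by (rule finite_subset[OF _ c[rule_format]]) auto
  done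

lift_definition union_conf :: "conf \<Rightarrow> conf \<Rightarrow> conf" is
  "\<lambda>c d x. c x + d x"
  subgoal premises cd for c d
    by (rule finite_subset[OF _ finite_UnI[OF cd(1)[rule_format] cd(2)[rule_format]]])
      auto
  done

text \<open>Push-forward by \<open>T\<close>. For a map that does not preserve local finiteness the value is
  unspecified; only bijections at bounded distance from the identity will be used.\<close>

definition push :: "(plane \<Rightarrow> plane) \<Rightarrow> conf \<Rightarrow> conf" where
  "push T X = Conf (\<lambda>y. \<Sum>x | T x = y \<and> mult X x \<noteq> 0. mult X x)"

lift_definition conf_of_points :: "nat \<Rightarrow> (nat \<Rightarrow> plane) \<Rightarrow> conf" is
  "\<lambda>n x y. card {i \<in> {..<n}. x i = y}"
  subgoal for n x
    by (rule finite_subset[of _ "x ` {..<n}"]) (auto simp: card_eq_0_iff)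
  done

text \<open>For \<open>n > 0\<close> this is only meaningful if \<open>\<Lambda>\<close> has positive area.\<close>

definition Bin :: "plane set \<Rightarrow> nat \<Rightarrow> conf measure" where
  "Bin \<Lambda> n = distr (Pi\<^sub>M {..<n} (\<lambda>_. uniform_measure lborel \<Lambda>)) borel (conf_of_points n)"

definition Fluct :: "(plane \<Rightarrow> real) \<Rightarrow> conf \<Rightarrow> real" where
  "Fluct \<phi> X = (LINT x|meas X. \<phi> x) - (LINT x|lborel. \<phi> x)"

section \<open>Derivatives\<close>

text \<open>In finite dimension \<open>f\<close> is of class \<open>C\<^sup>k\<^sup>+\<^sup>1\<close> iff it is differentiable and all its
  directional derivatives are of class \<open>C\<^sup>k\<close>.\<close>

primrec Ck :: "nat \<Rightarrow> (plane \<Rightarrow> 'b::real_normed_vector) \<Rightarrow> bool" where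
  "Ck 0 f \<longleftrightarrow> continuous_on UNIV f"
| "Ck (Suc k) f \<longleftrightarrow>
     f differentiable_on UNIV \<and> (\<forall>v. Ck k (\<lambda>x. frechet_derivative f (at x) v))"

text \<open>\<open>deriv_at f [v\<^sub>1, \<dots>, v\<^sub>k] x\<close> is the \<open>k\<close>-linear form \<open>D\<^sup>kf(x)\<close> evaluated at
  \<open>(v\<^sub>1, \<dots>, v\<^sub>k)\<close>.\<close>

primrec deriv_at :: "(plane \<Rightarrow> 'b::real_normed_vector) \<Rightarrow> plane list \<Rightarrow> plane \<Rightarrow> 'b" where
  "deriv_at f [] = f"
| "deriv_at f (v # vs) = (\<lambda>x. frechet_derivative (deriv_at f vs) (at x) v)"

text \<open>The supremum over the plane of the operator norm of the \<open>k\<close>-th derivative;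
  only meaningful for functions of class \<open>C\<^sup>k\<close>.\<close>

definition dnorm :: "nat \<Rightarrow> (plane \<Rightarrow> 'b::real_normed_vector) \<Rightarrow> ereal" where
  "dnorm k f =
     (SUP x. SUP vs \<in> {vs. length vs = k \<and> (\<forall>v \<in> set vs. norm v \<le> 1)}.
        ereal (norm (deriv_at f vs x)))"

section \<open>Energies\<close>

text \<open>The double integral of \<open>g\<close> against the product of the signed measures
  \<open>\<mu>\<^sub>1 - \<mu>\<^sub>2\<close> and \<open>\<nu>\<^sub>1 - \<nu>\<^sub>2\<close>.\<close>

definition signed_pair_integral ::
  "plane measure \<Rightarrow> plane measure \<Rightarrow> plane measure \<Rightarrow> plane measure \<Rightarrow> (plane \<times> plane \<Rightarrow> real) \<Rightarrow> real"
  where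
  "signed_pair_integral \<mu>1 \<mu>2 \<nu>1 \<nu>2 g =
     (LINT z|(\<mu>1 \<Otimes>\<^sub>M \<nu>1). g z) - (LINT z|(\<mu>1 \<Otimes>\<^sub>M \<nu>2). g z)
     - (LINT z|(\<mu>2 \<Otimes>\<^sub>M \<nu>1). g z) + (LINT z|(\<mu>2 \<Otimes>\<^sub>M \<nu>2). g z)"

text \<open>In \<open>energy\<close> and \<open>move\<close> the indicator functions restrict each configuration to \<open>\<Lambda>\<close> or to its
  complement, so the arguments need not be restricted beforehand.\<close>

definition energy :: "plane set \<Rightarrow> conf \<Rightarrow> real" where
  "energy \<Lambda> X =
     1/2 * signed_pair_integral (meas X) lborel (meas X) lborel
       (\<lambda>(x, y). indicator {(x, y). x \<in> \<Lambda> \<and> y \<in> \<Lambda> \<and> x \<noteq> y} (x, y) * (- ln (dist x y)))"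

definition move :: "(nat \<Rightarrow> plane \<Rightarrow> real) \<Rightarrow> plane set \<Rightarrow> conf \<Rightarrow> conf \<Rightarrow> real" where
  "move chi \<Lambda> X' X =
     lim (\<lambda>p. signed_pair_integral (meas X') (meas X) (meas X) lborel
       (\<lambda>(x, y). indicator (\<Lambda> \<times> - \<Lambda>) (x, y) * (- ln (dist x y)) * (\<Sum>i\<le>p. chi i y)))"

definition dyadic_partition :: "(nat \<Rightarrow> plane \<Rightarrow> real) \<Rightarrow> real \<Rightarrow> bool" where
  "dyadic_partition chi Cchi \<longleftrightarrow>
     (\<forall>i k. Ck k (chi i)) \<and>
     (\<forall>i x. 0 \<le> chi i x) \<and>
     (\<forall>x. (\<lambda>i. chi i x) sums 1) \<and>
     (\<forall>x. x \<notin> cball 0 2 \<longrightarrow> chi 0 x = 0) \<and>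
     (\<forall>i\<ge>1. \<forall>x. x \<notin> cball 0 (2 ^ (i + 1)) - cball 0 (2 ^ (i - 1)) \<longrightarrow> chi i x = 0) \<and>
     (\<forall>i. \<forall>k\<le>3. dnorm k (chi i) \<le> ereal (Cchi / 2 ^ (i * k)))"

section \<open>DLR equations\<close>

definition boltzmann ::
  "real \<Rightarrow> (nat \<Rightarrow> plane \<Rightarrow> real) \<Rightarrow> plane set \<Rightarrow> conf \<Rightarrow> conf \<Rightarrow> real" where
  "boltzmann \<beta> chi \<Lambda> X' X = exp (- \<beta> * (energy \<Lambda> X' + move chi \<Lambda> X' X))"

definition partition_function ::
  "real \<Rightarrow> (nat \<Rightarrow> plane \<Rightarrow> real) \<Rightarrow> plane set \<Rightarrow> conf \<Rightarrow> real" where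
  "partition_function \<beta> chi \<Lambda> X = (LINT X'|Bin \<Lambda> (Pts X \<Lambda>). boltzmann \<beta> chi \<Lambda> X' X)"

definition DLR :: "real \<Rightarrow> (nat \<Rightarrow> plane \<Rightarrow> real) \<Rightarrow> conf measure \<Rightarrow> bool" where
  "DLR \<beta> chi P \<longleftrightarrow>
     (\<forall>\<Lambda> f. bounded \<Lambda> \<and> \<Lambda> \<in> sets borel \<and> f \<in> borel_measurable borel \<and> bounded (range f) \<longrightarrow>
        (LINT X|P. f X) =
        (LINT X|P. 1 / partition_function \<beta> chi \<Lambda> X *
           (LINT X'|Bin \<Lambda> (Pts X \<Lambda>).
              f (union_conf X' (restr X (- \<Lambda>))) * boltzmann \<beta> chi \<Lambda> X' X)))"

section \<open>Localized translations\<close>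

definition localized_translation ::
  "real \<Rightarrow> plane \<Rightarrow> real \<Rightarrow> (plane \<Rightarrow> plane) \<Rightarrow> (plane \<Rightarrow> plane) \<Rightarrow> bool" where
  "localized_translation C v L Tp Tm \<longleftrightarrow>
     Ck 3 Tp \<and> Ck 3 Tm \<and>
     (\<forall>x. Tm (Tp x) = x) \<and> (\<forall>x. Tp (Tm x) = x) \<and>
     distr lborel lborel Tp = lborel \<and> distr lborel lborel Tm = lborel \<and>
     (\<forall>x. norm x \<le> L \<longrightarrow> Tp x = x + v \<and> Tm x = x - v) \<and>
     (\<forall>x. norm x \<ge> 2 * L \<longrightarrow> Tp x = x \<and> Tm x = x) \<and>
     (\<forall>k\<le>3. dnorm k (\<lambda>x. Tp x - x) \<le> ereal (C / L ^ k) \<and>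
            dnorm k (\<lambda>x. Tm x - x) \<le> ereal (C / L ^ k)) \<and>
     (\<forall>k\<le>2. dnorm k (\<lambda>x. (Tp x - x) + (Tm x - x)) \<le> ereal (C / L ^ (k + 1)))"

text \<open>A choice of localized translations for every vector \<open>v\<close> and length \<open>L\<close>, with one constant
  for the whole family.\<close>

definition localized_translations ::
  "real \<Rightarrow> (plane \<Rightarrow> real \<Rightarrow> plane \<Rightarrow> plane) \<Rightarrow> (plane \<Rightarrow> real \<Rightarrow> plane \<Rightarrow> plane) \<Rightarrow> bool" where
  "localized_translations C Tp Tm \<longleftrightarrow>
     (\<forall>v L. norm v \<le> 1 \<and> L \<ge> 2 \<longrightarrow> localized_translation C v L (Tp v L) (Tm v L))"

definition Diff1 ::
  "(plane \<Rightarrow> plane) \<Rightarrow> (plane \<Rightarrow> plane) \<Rightarrow> real \<Rightarrow> conf \<Rightarrow> real" where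
  "Diff1 Tp Tm L X = (let \<Lambda> = cball 0 (10 * L) in
     1/2 * (energy \<Lambda> (push Tp X) + energy \<Lambda> (push Tm X)) - energy \<Lambda> X)"

definition Diff2 ::
  "(nat \<Rightarrow> plane \<Rightarrow> real) \<Rightarrow> (plane \<Rightarrow> plane) \<Rightarrow> (plane \<Rightarrow> plane) \<Rightarrow> real \<Rightarrow> conf \<Rightarrow> conf \<Rightarrow> real" where
  "Diff2 chi Tp Tm L X' X = (let \<Lambda> = cball 0 (10 * L) in
     1/2 * (move chi \<Lambda> (push Tp X') X + move chi \<Lambda> (push Tm X') X) - move chi \<Lambda> X' X)"

section \<open>Good point processes\<close>

text \<open>Logarithm of the expectation of a nonnegative, possibly non-integrable variable.\<close>

definition log_ennreal :: "ennreal \<Rightarrow> ereal" where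
  "log_ennreal a =
     (if a = 0 then - \<infinity> else if a = \<infinity> then \<infinity> else ereal (ln (enn2real a)))"

definition log_expect :: "conf measure \<Rightarrow> (conf \<Rightarrow> ennreal) \<Rightarrow> ereal" where
  "log_expect P g = log_ennreal (\<integral>\<^sup>+X. g X \<partial>P)"

text \<open>\<open>\<rho>\<close> is a version of the one-point correlation function of \<open>P\<close>: the density of its
  intensity measure.\<close>

definition one_point_correlation :: "conf measure \<Rightarrow> (plane \<Rightarrow> ennreal) \<Rightarrow> bool" where
  "one_point_correlation P \<rho> \<longleftrightarrow>
     \<rho> \<in> borel_measurable borel \<and>
     (\<forall>A \<in> sets borel. (\<integral>\<^sup>+X. emeasure (meas X) A \<partial>P) = (\<integral>\<^sup>+y\<in>A. \<rho> y \<partial>lborel))"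

definition good_points :: "real \<Rightarrow> real \<Rightarrow> conf measure \<Rightarrow> bool" where
  "good_points C \<rho>\<beta> P \<longleftrightarrow>
     (\<forall>x l. l \<ge> \<rho>\<beta> \<longrightarrow>
        log_expect P (\<lambda>X. ennreal (exp (1 / C * (real (Pts X (cball x l)))\<^sup>2)))
          \<le> ereal (C * l ^ 4))"

definition good_intensity :: "real \<Rightarrow> conf measure \<Rightarrow> bool" where
  "good_intensity C P \<longleftrightarrow> (\<exists>\<rho>. one_point_correlation P \<rho> \<and> (SUP y. \<rho> y) \<le> ennreal C)"

definition good_lipschitz :: "real \<Rightarrow> real \<Rightarrow> conf measure \<Rightarrow> bool" where
  "good_lipschitz C \<rho>\<beta> P \<longleftrightarrow>
     (\<forall>x l. l \<ge> \<rho>\<beta> \<longrightarrow>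
        log_expect P (\<lambda>X.
          SUP \<phi> \<in> {\<phi>. (1 / l)-lipschitz_on UNIV \<phi> \<and> closure {y. \<phi> y \<noteq> 0} \<subseteq> cball x (4 * l)}.
            ennreal (exp (1 / C * (Fluct \<phi> X)\<^sup>2)))
          \<le> ereal (C * l\<^sup>2))"

definition good_smooth :: "real \<Rightarrow> real \<Rightarrow> conf measure \<Rightarrow> bool" where
  "good_smooth C \<rho>\<beta> P \<longleftrightarrow>
     (\<forall>x l \<phi> C\<phi>. l \<ge> \<rho>\<beta> \<and> C\<phi> > 0 \<and> Ck 3 \<phi> \<and>
        closure {y. \<phi> y \<noteq> 0} \<subseteq> cball x (4 * l) \<and>
        (\<forall>k\<in>{1..3}. dnorm k \<phi> \<le> ereal (C\<phi> / l ^ k)) \<longrightarrow>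
        (\<forall>s. \<bar>s\<bar> \<le> l\<^sup>2 / (C * C\<phi>) \<longrightarrow>
           \<bar>log_expect P (\<lambda>X. ennreal (exp (s * Fluct \<phi> X)))\<bar>
             \<le> ereal (C * (\<bar>s\<bar> * C\<phi> + s ^ 4 * C\<phi> ^ 4))) \<and>
        (\<integral>\<^sup>+X. ennreal \<bar>Fluct \<phi> X\<bar> \<partial>P) \<le> ennreal (C * C\<phi>))"

definition good_translations ::
  "real \<Rightarrow> real \<Rightarrow> real \<Rightarrow> (nat \<Rightarrow> plane \<Rightarrow> real) \<Rightarrow>
   (plane \<Rightarrow> real \<Rightarrow> plane \<Rightarrow> plane) \<Rightarrow> (plane \<Rightarrow> real \<Rightarrow> plane \<Rightarrow> plane) \<Rightarrow> conf measure \<Rightarrow> bool" where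
  "good_translations C L0 \<beta> chi Tp Tm P \<longleftrightarrow>
     (\<forall>v L. norm v \<le> 1 \<and> L \<ge> L0 \<longrightarrow>
        log_expect P (\<lambda>X. ennreal (exp (2 * \<beta> * Diff1 (Tp v L) (Tm v L) L X))) \<le> ereal C \<and>
        log_expect P (\<lambda>X. ennreal (exp (2 * \<beta> * Diff2 chi (Tp v L) (Tm v L) L X X))) \<le> ereal C)"

definition good ::
  "real \<Rightarrow> real \<Rightarrow> (nat \<Rightarrow> plane \<Rightarrow> real) \<Rightarrow>
   (plane \<Rightarrow> real \<Rightarrow> plane \<Rightarrow> plane) \<Rightarrow> (plane \<Rightarrow> real \<Rightarrow> plane \<Rightarrow> plane) \<Rightarrow> conf measure \<Rightarrow> bool" where
  "good \<beta> \<rho>\<beta> chi Tp Tm P \<longleftrightarrow>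
     (\<exists>C>0. \<exists>L0\<ge>2. good_points C \<rho>\<beta> P \<and> good_intensity C P \<and>
        good_lipschitz C \<rho>\<beta> P \<and> good_smooth C \<rho>\<beta> P \<and>
        good_translations C L0 \<beta> chi Tp Tm P)"

end

theory Submission
  imports Defs
begin

text \<open>
  The DLR equations say that \<open>P\<close> is preserved by the kernels \<open>\<Gamma>\<^sub>\<Lambda>\<close> that resample the points in
  \<open>\<Lambda>\<close>. Call an event \<open>B\<close> resampling-invariant if \<open>\<Gamma>\<^sub>\<Lambda>(B) = 1\<^sub>B\<close> almost surely for all balls \<open>\<Lambda>\<close>.

  Following Froehlich and Pfister, the localized translations \<open>T\<^sup>\<plusminus>\<close> preserve the uniform law of the
  points, so that the laws of \<open>T\<^sup>\<plusminus>X\<close> have explicit densities, whose geometric mean is controlled by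
  the second differences \<open>Diff\<^sup>1 + Diff\<^sup>2\<close>. Their exponential moments and AM-GM bound \<open>P(A \<inter> B)\<close>
  by the probabilities of the two translates of \<open>A\<close> intersected with \<open>B\<close>, first for local \<open>A\<close> and
  then, by approximation, for all \<open>A\<close>; in particular \<open>A \<inter> B\<close> is null if one of these is null.
  With \<open>B\<close> the whole space, \<open>P\<close> and its translate \<open>\<tau>P\<close> are equivalent. The kernels are translation
  covariant: the potential of a neutral charge decays, and its two leading Laurent modes against the
  \<open>p\<close>-th dyadic shell fluctuate by \<open>O(2\<^sup>-\<^sup>p)\<close>. Hence \<open>\<tau>P = hP\<close> is preserved by the kernels too, and
  \<open>B = {h < 1}\<close> is resampling-invariant, as is \<open>D = B - \<tau>\<^sup>-\<^sup>1B\<close>. Since \<open>D\<close> and \<open>\<tau>\<^sup>-\<^sup>1D\<close> are disjoint,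
  \<open>D\<close> is null, so \<open>P(B) \<le> P(\<tau>\<^sup>-\<^sup>1B) = \<integral>\<^sub>B h dP\<close>; this forces \<open>P(B) = 0\<close> and \<open>h = 1\<close>.
\<close>

text \<open>Optimised over its two parameters, the inequality reads P(A \<inter> B)^4 \<le> exp(2C)
  p q, with p and q the probabilities of the two translates of A within B. It is kept linear, with
  free \<open>lam\<close> and \<open>t\<close>, so that approximation errors simply add up and one
  vanishing factor is enough.

  The symmetric pair of maps is essential: the first-order energy cost of a localized translation
  cancels in the average, and what remains has exponential moments bounded independently of L. This
  uniformity lets L exceed the radius of any local event.

  Goodness is assumed of P alone and says nothing about extremal Gibbs components, so P is not
  decomposed; carrying the event B through the inequality takes the place of a decomposition.

  Two analytic obstacles shape the rest. The moving energy is a \<open>lim\<close> that is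
  meaningful only almost surely; it is controlled through one potential shared by all configurations
  with the same exterior. Measurability of the kernels in the exterior configuration is read off the
  DLR equations, whose right-hand sides would be the default 0 if they were not integrable.\<close>

section \<open>Measurability on the space of configurations\<close>

lemma finite_supp: "bounded S \<Longrightarrow> finite {x \<in> S. mult X x \<noteq> 0}"
proof -
  assume "bounded S"
  then obtain r where "S \<subseteq> cball 0 r" by (metis bounded_any_center[of _ 0] mem_cball subsetI)
  moreover have "finite {x \<in> cball 0 r. mult X x \<noteq> 0}" using mult[of X] by auto
  ultimately show ?thesis by (elim finite_subset[rotated]) auto
qed

lemma conf_eqI: "(\<And>x. mult X x = mult Y x) \<Longrightarrow> X = Y"
  by (metis ext mult_inject)

lemma sets_meas [simp, measurable_cong]: "sets (meas X) = sets borel"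
  by (simp add: meas_def)

lemma space_meas [simp]: "space (meas X) = UNIV"
  by (simp add: meas_def)

lemma nn_integral_meas:
  "f \<in> borel_measurable borel \<Longrightarrow>
    (\<integral>\<^sup>+x. f x \<partial>meas X) = (\<integral>\<^sup>+x. of_nat (mult X x) * f x \<partial>count_space UNIV)"
  unfolding meas_def by (simp add: nn_integral_distr nn_integral_density)

lemma nn_integral_meas_bounded:
  assumes "f \<in> borel_measurable borel" "bounded S" "\<And>x. x \<notin> S \<Longrightarrow> f x = 0"
  shows "(\<integral>\<^sup>+x. f x \<partial>meas X) = (\<Sum>x | x \<in> S \<and> mult X x \<noteq> 0. of_nat (mult X x) * f x)"
proof -
  have "(\<integral>\<^sup>+x. of_nat (mult X x) * f x \<partial>count_space UNIV)
      = (\<Sum>x | x \<in> S \<and> mult X x \<noteq> 0. of_nat (mult X x) * f x)"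
    by (rule nn_integral_count_space') (use assms finite_supp[of S X] in auto)
  then show ?thesis using nn_integral_meas[OF assms(1)] by simp
qed

lemma emeasure_meas:
  assumes "A \<in> sets borel" "bounded A"
  shows "emeasure (meas X) A = of_nat (Pts X A)"
proof -
  have "emeasure (meas X) A = (\<integral>\<^sup>+x. indicator A x \<partial>meas X)" using assms by simp
  also have "\<dots> = (\<Sum>x | x \<in> A \<and> mult X x \<noteq> 0. of_nat (mult X x) * indicator A x)"
    by (rule nn_integral_meas_bounded) (use assms in auto)
  also have "\<dots> = of_nat (Pts X A)" unfolding Pts_def of_nat_sum
    by (intro sum.cong) auto
  finally show ?thesis .
qed

lemma sigma_finite_meas [simp]: "sigma_finite_measure (meas X)"
proof
  show "\<exists>A. countable A \<and> A \<subseteq> sets (meas X) \<and> \<Union>A = space (meas X) \<and> (\<forall>a\<in>A. emeasure (meas X) a \<noteq> \<infinity>)"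
    by (intro exI[of _ "range (\<lambda>n::nat. cball 0 (real n))"])
       (auto simp: emeasure_meas intro: real_arch_simple)
qed

lemma pair_sigma_finite_meas [simp]:
  "pair_sigma_finite (meas X) (meas Y)" "pair_sigma_finite (meas X) lborel"
  "pair_sigma_finite lborel (meas X)" "pair_sigma_finite lborel (lborel :: plane measure)"
  by (auto simp: pair_sigma_finite_def sigma_finite_lborel)

lemma integrable_meas:
  fixes f :: "plane \<Rightarrow> real"
  assumes [measurable]: "f \<in> borel_measurable borel" and "bounded S" "\<And>x. x \<notin> S \<Longrightarrow> f x = 0"
  shows "integrable (meas X) f"
proof -
  have "(\<integral>\<^sup>+x. ennreal (norm (f x)) \<partial>meas X) = (\<Sum>x | x \<in> S \<and> mult X x \<noteq> 0. of_nat (mult X x) * ennreal (norm (f x)))"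
    by (rule nn_integral_meas_bounded) (use assms in auto)
  also have "\<dots> < \<infinity>" using finite_supp[OF assms(2), of X]
    by (simp add: ennreal_mult_less_top of_nat_less_top)
  finally show ?thesis by (intro integrableI_bounded) auto
qed

lemma integral_meas:
  fixes f :: "plane \<Rightarrow> real"
  assumes [measurable]: "f \<in> borel_measurable borel" and "bounded S" "\<And>x. x \<notin> S \<Longrightarrow> f x = 0"
  shows "(LINT x|meas X. f x) = (\<Sum>x | x \<in> S \<and> mult X x \<noteq> 0. real (mult X x) * f x)"
proof -
  have fin: "finite {x. x \<in> S \<and> mult X x \<noteq> 0}" using finite_supp[OF assms(2)] by simp
  have "(LINT x|meas X. f x) = (LINT x|density (count_space UNIV) (\<lambda>x. of_nat (mult X x)). f x)"
    unfolding meas_def by (subst integral_distr) auto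
  also have "\<dots> = (LINT x|count_space UNIV. real (mult X x) * f x)"
    using integral_density[of f "count_space UNIV" "\<lambda>x. real (mult X x)"]
    by (simp add: ennreal_of_nat_eq_real_of_nat)
  also have "\<dots> = (\<Sum>x | x \<in> UNIV \<and> real (mult X x) * f x \<noteq> 0. real (mult X x) * f x)"
    by (rule lebesgue_integral_count_space_finite_support)
       (rule finite_subset[OF _ fin], use assms(3) in auto)
  also have "\<dots> = (\<Sum>x | x \<in> S \<and> mult X x \<noteq> 0. real (mult X x) * f x)"
    by (rule sum.mono_neutral_left[OF fin]) (use assms(3) in auto)
  finally show ?thesis .
qed

lemma continuous_integral_conf:
  fixes f :: "plane \<Rightarrow> real"
  assumes "continuous_on UNIV f" "compact (closure {x. f x \<noteq> 0})"
  shows "continuous_on UNIV (\<lambda>X. LINT x|meas X. f x)"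
proof -
  have "open {X. (LINT x|meas X. f x) \<in> U}" if "open U" for U
    unfolding open_conf_def using assms that by (intro generate_topology.Basis) blast
  then show ?thesis by (subst continuous_on_open_vimage) (auto simp: vimage_def)
qed

lemma measurable_integral_conf:
  fixes f :: "plane \<Rightarrow> real"
  assumes "continuous_on UNIV f" "\<And>x. x \<notin> S \<Longrightarrow> f x = 0" "bounded S"
  shows "(\<lambda>X. LINT x|meas X. f x) \<in> borel_measurable borel"
proof (rule borel_measurable_continuous_onI, rule continuous_integral_conf)
  have "bounded (closure {x. f x \<noteq> 0})"
    by (rule bounded_closure, rule bounded_subset[OF assms(3)]) (use assms(2) in auto)
  then show "compact (closure {x. f x \<noteq> 0})" by (simp add: compact_eq_bounded_closed)
qed fact

text \<open>Truncated multiples of the distance to the complement are continuous, vanish off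
  \<open>A\<close> and increase to its indicator, so monotone convergence reduces the mass to
  vaguely continuous integrals.\<close>

lemma measurable_emeasure_meas_open:
  assumes "open A" "bounded A"
  shows "(\<lambda>X. emeasure (meas X) A) \<in> borel_measurable borel"
proof (cases "A = {}")
  case False
  \<comment> \<open>\<open>infdist\<close> to the empty set is 0 by convention, so the complement
    has to be nonempty for \<open>f\<close> to reach 1 on \<open>A\<close>.\<close>
  have ne: "- A \<noteq> {}" using assms(2) by (metis Compl_UNIV_eq UNIV_I compl_bot_eq double_complement not_bounded_UNIV)
  define f where "f k x = min 1 (real k * infdist x (- A))" for k x
  have cont: "continuous_on UNIV (f k)" for k
    unfolding f_def by (intro continuous_intros)
  then have [measurable]: "f k \<in> borel_measurable borel" for k by (intro borel_measurable_continuous_onI)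
  have f0: "f k x = 0" if "x \<notin> A" for k x using that by (simp add: f_def)
  have fnn: "f k x \<ge> 0" for k x by (simp add: f_def infdist_nonneg)
  have inc: "incseq (\<lambda>k x. ennreal (f k x))"
    by (auto simp: incseq_def le_fun_def f_def intro!: ennreal_leI min.mono mult_right_mono infdist_nonneg)
  have sup: "(SUP k. ennreal (f k x)) = indicator A x" for x
  proof (cases "x \<in> A")
    case True
    have "infdist x (- A) > 0"
      using in_closed_iff_infdist_zero[of "- A" x] ne assms(1) True infdist_nonneg[of x "- A"]
      by (auto simp: closed_Compl less_le)
    then obtain k where "1 < real k * infdist x (- A)"
      using reals_Archimedean3 by blast
    then have "f k x = 1" by (simp add: f_def)
    then show ?thesis using True
      by (intro antisym SUP_least SUP_upper2[of k]) (auto simp: f_def)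
  qed (simp add: f0)
  have "emeasure (meas X) A = (SUP k. ennreal (LINT x|meas X. f k x))" for X
  proof -
    have "emeasure (meas X) A = (\<integral>\<^sup>+x. indicator A x \<partial>meas X)" using assms by simp
    also have "\<dots> = (\<integral>\<^sup>+x. (SUP k. ennreal (f k x)) \<partial>meas X)" by (simp add: sup)
    also have "\<dots> = (SUP k. \<integral>\<^sup>+x. ennreal (f k x) \<partial>meas X)"
      using inc by (intro nn_integral_monotone_convergence_SUP) auto
    also have "\<dots> = (SUP k. ennreal (LINT x|meas X. f k x))"
      by (intro SUP_cong refl nn_integral_eq_integral integrable_meas[OF _ assms(2)]) (auto simp: f0 fnn)
    finally show ?thesis .
  qed
  moreover have "(\<lambda>X. SUP k. ennreal (LINT x|meas X. f k x)) \<in> borel_measurable borel"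
    using measurable_integral_conf[OF cont f0 assms(2)] by measurable
  ultimately show ?thesis by simp
qed simp

lemma measurable_emeasure_meas [measurable]:
  assumes "A \<in> sets borel"
  shows "(\<lambda>X. emeasure (meas X) A) \<in> borel_measurable borel"
proof -
  \<comment> \<open>Cutting with a disk keeps all masses finite, so that the complement step of the
    Dynkin argument may subtract them.\<close>
  have *: "(\<lambda>X. emeasure (meas X) (A \<inter> ball 0 (real n))) \<in> borel_measurable borel" for n :: nat
  proof -
    have A: "A \<in> sigma_sets UNIV {S::plane set. open S}" using assms by (simp add: borel_def)
    have "Int_stable {S::plane set. open S}" "{S::plane set. open S} \<subseteq> Pow UNIV"
      by (auto simp: Int_stable_def)
    from this A show ?thesis
    proof (induction A rule: sigma_sets_induct_disjoint)
      case (basic A)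
      then show ?case by (intro measurable_emeasure_meas_open) auto
    next
      case (compl A)
      then have [measurable]: "A \<in> sets borel" by (simp add: borel_def)
      have "emeasure (meas X) ((UNIV - A) \<inter> ball 0 (real n))
          = emeasure (meas X) (ball 0 (real n)) - emeasure (meas X) (A \<inter> ball 0 (real n))" for X
      proof -
        have "(UNIV - A) \<inter> ball 0 (real n) = ball 0 (real n) - A \<inter> ball 0 (real n)" by auto
        then show ?thesis
          by (simp add: emeasure_Diff emeasure_meas[of "A \<inter> ball 0 (real n)"] bounded_Int)
      qed
      moreover have "(\<lambda>X. emeasure (meas X) (ball 0 (real n))) \<in> borel_measurable borel"
        by (intro measurable_emeasure_meas_open) auto
      ultimately show ?case using compl by simp
    next
      case (union A)
      then have m[measurable]: "A i \<in> sets borel" for i by (auto simp: borel_def)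
      have "emeasure (meas X) (\<Union>(range A) \<inter> ball 0 (real n)) = (\<Sum>i. emeasure (meas X) (A i \<inter> ball 0 (real n)))" for X
        by (subst suminf_emeasure) (use union(1) in \<open>auto simp: disjoint_family_on_def\<close>)
      then show ?case using union by simp
    qed auto
  qed
  have "emeasure (meas X) A = (SUP n. emeasure (meas X) (A \<inter> ball 0 (real n)))" for X
  proof (subst SUP_emeasure_incseq)
    have "(\<Union>n. A \<inter> ball 0 (real n)) = A"
      by (auto simp: ) (meson reals_Archimedean2)
    then show "emeasure (meas X) A = emeasure (meas X) (\<Union>n. A \<inter> ball 0 (real n))" by simp
  qed (use assms in \<open>auto simp: incseq_def\<close>)
  then show ?thesis using * by simp
qed

lemma measurable_Pts [measurable]:
  assumes "A \<in> sets borel" "bounded A"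
  shows "(\<lambda>X. Pts X A) \<in> measurable borel (count_space UNIV)"
proof -
  have "(\<lambda>X. nat \<lfloor>enn2real (emeasure (meas X) A)\<rfloor>) \<in> measurable borel (count_space UNIV)"
    using assms by measurable
  then show ?thesis using assms by (simp add: emeasure_meas)
qed

section \<open>Counts in dyadic cells generate the Borel sigma-algebra\<close>

definition cell :: "nat \<Rightarrow> plane \<Rightarrow> int \<times> int" where
  "cell m y = (\<lfloor>2 ^ m * y $ 1\<rfloor>, \<lfloor>2 ^ m * y $ 2\<rfloor>)"

lemma dist_cell:
  assumes "cell m x = cell m y"
  shows "dist x y \<le> 2 / 2 ^ m"
proof -
  have "\<bar>2 ^ m * x $ i - 2 ^ m * y $ i\<bar> \<le> 1" for i
  proof -
    have "\<lfloor>2 ^ m * x $ i\<rfloor> = \<lfloor>2 ^ m * y $ i\<rfloor>"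
      using assms exhaust_2[of i] by (auto simp: cell_def)
    then show ?thesis by linarith
  qed
  note * = this
  have *: "\<And>i. \<bar>(x - y) $ i\<bar> \<le> 1 / 2 ^ m"
  proof -
    fix i
    have "2 ^ m * \<bar>(x - y) $ i\<bar> = \<bar>2 ^ m * x $ i - 2 ^ m * y $ i\<bar>"
      by (simp add: right_diff_distrib[symmetric] abs_mult)
    then show "\<bar>(x - y) $ i\<bar> \<le> 1 / 2 ^ m" using *[of i] by (simp add: field_simps)
  qed
  have "norm (x - y) \<le> (\<Sum>i\<in>UNIV. \<bar>(x - y) $ i\<bar>)" by (rule norm_le_l1_cart)
  also have "\<dots> \<le> 2 / 2 ^ m" using *[of 1] *[of 2] by (simp add: sum_2)
  finally show ?thesis by (simp add: dist_norm)
qed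

lemma measurable_cell_vimage [measurable]: "cell m -` {k} \<in> sets borel"
proof -
  have "(\<lambda>y. cell m y) \<in> borel \<rightarrow>\<^sub>M count_space UNIV"
    unfolding cell_def by measurable
  from measurable_sets[OF this, of "{k}"] show ?thesis by simp
qed

lemma bounded_cell_vimage: "bounded (cell m -` {k})"
proof -
  have "dist x y \<le> 2 / 2 ^ m" if "x \<in> cell m -` {k}" "y \<in> cell m -` {k}" for x y
    using that by (intro dist_cell) auto
  then show ?thesis unfolding bounded_def by blast
qed

lemma finite_cell_image: "finite (cell m ` cball 0 r)"
proof (rule finite_subset)
  show "cell m ` cball 0 r \<subseteq> {\<lfloor>- (2 ^ m * r)\<rfloor>..\<lfloor>2 ^ m * r\<rfloor>} \<times> {\<lfloor>- (2 ^ m * r)\<rfloor>..\<lfloor>2 ^ m * r\<rfloor>}"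
  proof
    fix k assume "k \<in> cell m ` cball 0 r"
    then obtain y where y: "norm y \<le> r" "k = cell m y" by auto
    have "\<bar>2 ^ m * y $ i\<bar> \<le> 2 ^ m * r" for i
      using component_le_norm_cart[of y i] y(1) by (simp add: abs_mult)
    then have "- (2 ^ m * r) \<le> 2 ^ m * y $ i \<and> 2 ^ m * y $ i \<le> 2 ^ m * r" for i
      by (simp add: abs_le_iff) (meson minus_le_iff)
    then show "k \<in> {\<lfloor>- (2 ^ m * r)\<rfloor>..\<lfloor>2 ^ m * r\<rfloor>} \<times> {\<lfloor>- (2 ^ m * r)\<rfloor>..\<lfloor>2 ^ m * r\<rfloor>}"
      by (auto simp: y cell_def intro!: floor_mono)
  qed
qed simp

definition cell_events :: "conf set set" where
  "cell_events = {{Y. Pts Y (cell m -` {k}) = n} | m k n. True}"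

lemma countable_cell_events: "countable cell_events"
proof -
  have "cell_events = range (\<lambda>(m, k, n). {Y. Pts Y (cell m -` {k}) = n})"
    by (auto simp: cell_events_def)
  also have "countable \<dots>" by (rule countable_image) simp
  finally show ?thesis .
qed

text \<open>The integral of a continuous function with compact support is determined up to a small error
  by the counts in the cells of a fine dyadic grid; so countably many count events generate the Borel
  sigma-algebra, although the subbase of the vague topology is uncountable.\<close>

lemma subbasic_cell_events:
  fixes f :: "plane \<Rightarrow> real"
  assumes f: "continuous_on UNIV f" "compact (closure {x. f x \<noteq> 0})" and U: "open U"
    and X: "(LINT x|meas X. f x) \<in> U"
  shows "\<exists>\<F>\<subseteq>cell_events. finite \<F> \<and> X \<in> \<Inter>\<F> \<and> \<Inter>\<F> \<subseteq> {Y. (LINT x|meas Y. f x) \<in> U}"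
proof -
  obtain e where e: "e > 0" "ball (LINT x|meas X. f x) e \<subseteq> U"
    using U X open_contains_ball by blast
  have [measurable]: "f \<in> borel_measurable borel" using f(1) by (rule borel_measurable_continuous_onI)
  have "bounded {x. f x \<noteq> 0}" using f(2) bounded_subset compact_imp_bounded closure_subset by metis
  then obtain r where r: "\<And>x. f x \<noteq> 0 \<Longrightarrow> norm x \<le> r" unfolding bounded_iff by auto
  define R where "R = max r 0 + 2"
  define N where "N = real (Pts X (cball 0 (R + 2)))"
  \<comment> \<open>The integrals against \<open>X\<close> and \<open>Y\<close> each deviate from
    the common cell sum by at most \<eta> N; the extra 1 keeps the two errors together strictly
    below \<open>e\<close>.\<close>
  define \<eta> where "\<eta> = e / (2 * N + 1)"
  have "N \<ge> 0" by (simp add: N_def)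
  then have \<eta>: "\<eta> > 0" using e by (simp add: \<eta>_def)
  have "uniformly_continuous_on (cball 0 (R + 2)) f"
    by (rule compact_uniformly_continuous) (auto intro: continuous_on_subset[OF f(1)])
  then obtain d where d: "d > 0" "\<And>x y. x \<in> cball 0 (R+2) \<Longrightarrow> y \<in> cball 0 (R+2) \<Longrightarrow> dist y x < d \<Longrightarrow> dist (f y) (f x) < \<eta>"
    using \<eta> unfolding uniformly_continuous_on_def by metis
  obtain m0 :: nat where "2 / d < 2 ^ m0" using real_arch_pow[of 2] by fastforce
  then obtain m :: nat where m: "m \<ge> 1" "2 / 2 ^ m < d"
  proof -
    assume *: "\<And>m::nat. 1 \<le> m \<Longrightarrow> 2 / 2 ^ m < d \<Longrightarrow> thesis" and "2 / d < 2 ^ m0"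
    moreover have "(2::real) ^ m0 \<le> 2 ^ (Suc m0)" by simp
    ultimately have "2 / d < 2 ^ (Suc m0)" by linarith
    then show thesis using d(1) by (intro *[of "Suc m0"]) (auto simp: field_simps)
  qed
  have m1: "2 / 2 ^ m \<le> (1::real)" using m(1) by (cases m) auto
  define I where "I = cell m ` cball 0 R"
  have finI: "finite I" by (simp add: I_def finite_cell_image)
  define Q where "Q k = cell m -` {k}" for k
  define c where "c k = (SOME y. y \<in> cball 0 R \<and> cell m y = k)" for k
  have c: "c k \<in> cball 0 R \<and> cell m (c k) = k" if "k \<in> I" for k
    unfolding c_def by (rule someI_ex) (use that in \<open>auto simp: I_def\<close>)
  have Qb: "Q k \<subseteq> cball 0 (R + 2)" if "k \<in> I" for k
  proof
    fix y assume "y \<in> Q k"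
    then have "dist (c k) y \<le> 1" using dist_cell[of m "c k" y] m1 c[OF that] unfolding Q_def by (metis order_trans singletonD vimageD)
    then show "y \<in> cball 0 (R + 2)" using c[OF that] dist_triangle[of 0 y "c k"] by simp
  qed
  have fc: "\<bar>f y - f (c k)\<bar> \<le> \<eta>" if "k \<in> I" "y \<in> Q k" for k y
  proof -
    have "dist y (c k) < d" using dist_cell[of m y "c k"] c[OF that(1)] that(2) m(2) unfolding Q_def by (metis order_le_less_trans singletonD vimageD)
    moreover have "y \<in> cball 0 (R + 2)" using Qb[OF that(1)] that(2) by blast
    moreover have "c k \<in> cball 0 (R + 2)" using c[OF that(1)] by simp
    ultimately have "dist (f y) (f (c k)) < \<eta>" by (intro d(2))
    then show ?thesis by (simp add: dist_real_def)
  qed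
  have int: "(LINT x|meas Y. f x) = (\<Sum>k\<in>I. \<Sum>y | y \<in> Q k \<and> mult Y y \<noteq> 0. real (mult Y y) * f y)" for Y
  proof -
    have "(LINT x|meas Y. f x) = (\<Sum>y | y \<in> (\<Union>k\<in>I. Q k) \<and> mult Y y \<noteq> 0. real (mult Y y) * f y)"
    proof (rule integral_meas)
      have "(\<Union>k\<in>I. Q k) \<subseteq> cball 0 (R + 2)" using Qb by (rule UN_least)
      then show "bounded (\<Union>k\<in>I. Q k)" by (rule bounded_subset[OF bounded_cball])
      show "f x = 0" if "x \<notin> (\<Union>k\<in>I. Q k)" for x
      proof (rule ccontr)
        assume "f x \<noteq> 0"
        then have "x \<in> cball 0 R" using r[of x] by (simp add: R_def)
        then have "cell m x \<in> I" unfolding I_def by (rule imageI)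
        with that show False by (auto simp: Q_def)
      qed
    qed simp
    also have "{y. y \<in> (\<Union>k\<in>I. Q k) \<and> mult Y y \<noteq> 0} = (\<Union>k\<in>I. {y. y \<in> Q k \<and> mult Y y \<noteq> 0})" by auto
    also have "(\<Sum>y\<in>(\<Union>k\<in>I. {y. y \<in> Q k \<and> mult Y y \<noteq> 0}). real (mult Y y) * f y)
      = (\<Sum>k\<in>I. \<Sum>y | y \<in> Q k \<and> mult Y y \<noteq> 0. real (mult Y y) * f y)"
      by (rule sum.UNION_disjoint)
        (use finI finite_supp[OF bounded_subset[OF bounded_cball Qb], of _ Y] in \<open>auto simp: Q_def\<close>)
    finally show ?thesis .
  qed
  have approx: "\<bar>(LINT x|meas Y. f x) - (\<Sum>k\<in>I. f (c k) * real (Pts Y (Q k)))\<bar> \<le> \<eta> * (\<Sum>k\<in>I. real (Pts Y (Q k)))" for Y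
  proof -
    have "\<bar>(\<Sum>y | y \<in> Q k \<and> mult Y y \<noteq> 0. real (mult Y y) * f y) - f (c k) * real (Pts Y (Q k))\<bar> \<le> \<eta> * real (Pts Y (Q k))"
      if k: "k \<in> I" for k
    proof -
      have "\<bar>(\<Sum>y | y \<in> Q k \<and> mult Y y \<noteq> 0. real (mult Y y) * f y) - f (c k) * real (Pts Y (Q k))\<bar>
        = \<bar>\<Sum>y | y \<in> Q k \<and> mult Y y \<noteq> 0. real (mult Y y) * (f y - f (c k))\<bar>"
        by (simp add: Pts_def sum_distrib_left sum_subtractf algebra_simps)
      also have "\<dots> \<le> (\<Sum>y | y \<in> Q k \<and> mult Y y \<noteq> 0. \<bar>real (mult Y y) * (f y - f (c k))\<bar>)" by (rule sum_abs)
      also have "\<dots> \<le> (\<Sum>y | y \<in> Q k \<and> mult Y y \<noteq> 0. real (mult Y y) * \<eta>)"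
        using fc[OF k] by (intro sum_mono) (auto simp: abs_mult intro!: mult_left_mono)
      also have "\<dots> = \<eta> * real (Pts Y (Q k))" by (simp add: Pts_def sum_distrib_left mult.commute)
      finally show ?thesis .
    qed
    then have "(\<Sum>k\<in>I. \<bar>(\<Sum>y | y \<in> Q k \<and> mult Y y \<noteq> 0. real (mult Y y) * f y) - f (c k) * real (Pts Y (Q k))\<bar>)
       \<le> (\<Sum>k\<in>I. \<eta> * real (Pts Y (Q k)))" by (intro sum_mono)
    then show ?thesis unfolding int sum_subtractf[symmetric] sum_distrib_left
      by (rule order_trans[OF sum_abs])
  qed
  have tot: "(\<Sum>k\<in>I. real (Pts X (Q k))) \<le> N"
  proof -
    have "(\<Sum>k\<in>I. Pts X (Q k)) = (\<Sum>y\<in>(\<Union>k\<in>I. {y. y \<in> Q k \<and> mult X y \<noteq> 0}). mult X y)"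
      unfolding Pts_def by (rule sum.UNION_disjoint[symmetric])
        (use finI finite_supp[OF bounded_subset[OF bounded_cball Qb], of _ X] in \<open>auto simp: Q_def\<close>)
    also have "\<dots> \<le> Pts X (cball 0 (R + 2))" unfolding Pts_def
    proof (rule sum_mono2)
      show "finite {x. x \<in> cball 0 (R + 2) \<and> mult X x \<noteq> 0}" by (rule finite_supp[OF bounded_cball])
      show "(\<Union>k\<in>I. {y. y \<in> Q k \<and> mult X y \<noteq> 0}) \<subseteq> {x. x \<in> cball 0 (R + 2) \<and> mult X x \<noteq> 0}"
        using UN_least[of I Q, OF Qb] by blast
    qed simp
    finally show ?thesis unfolding N_def of_nat_sum[symmetric] of_nat_le_iff .
  qed
  \<comment> \<open>Prescribing exact counts fixes both the cell sum and the total number of points,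
    so the error bound for \<open>Y\<close> is the one already known for \<open>X\<close>.\<close>
  define \<F> where "\<F> = (\<lambda>k. {Y. Pts Y (Q k) = Pts X (Q k)}) ` I"
  have "\<F> \<subseteq> cell_events" unfolding \<F>_def cell_events_def Q_def by blast
  moreover have "(LINT x|meas Y. f x) \<in> U" if "Y \<in> \<Inter>\<F>" for Y
  proof -
    have eq: "Pts Y (Q k) = Pts X (Q k)" if "k \<in> I" for k
      using that \<open>Y \<in> \<Inter>\<F>\<close> by (auto simp: \<F>_def)
    have eqs: "(\<Sum>k\<in>I. real (Pts Y (Q k))) = (\<Sum>k\<in>I. real (Pts X (Q k)))"
      "(\<Sum>k\<in>I. f (c k) * real (Pts Y (Q k))) = (\<Sum>k\<in>I. f (c k) * real (Pts X (Q k)))"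
      by (auto intro!: sum.cong simp: eq)
    have "\<eta> * (\<Sum>k\<in>I. real (Pts X (Q k))) \<le> \<eta> * N" using \<eta> tot by (intro mult_left_mono) auto
    then have "\<bar>(LINT x|meas Y. f x) - (LINT x|meas X. f x)\<bar> \<le> 2 * (\<eta> * N)"
      using approx[of X] approx[of Y] unfolding eqs by linarith
    also have "\<dots> < e" using e \<open>N \<ge> 0\<close> by (simp add: \<eta>_def field_simps)
    finally show ?thesis using e(2) by (auto simp: dist_real_def subset_iff abs_minus_commute)
  qed
  ultimately show ?thesis using finI by (intro exI[of _ \<F>]) (auto simp: \<F>_def)
qed

lemma open_conf_cell_events:
  assumes "open W" "X \<in> W"
  shows "\<exists>\<F>\<subseteq>cell_events. finite \<F> \<and> X \<in> \<Inter>\<F> \<and> \<Inter>\<F> \<subseteq> W"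
proof -
  have "generate_topology {{X. (LINT x|meas X. f x) \<in> U} | (f :: plane \<Rightarrow> real) U.
        continuous_on UNIV f \<and> compact (closure {x. f x \<noteq> 0}) \<and> open U} W"
    using assms(1) by (simp add: open_conf_def)
  then show ?thesis using assms(2)
  proof (induction arbitrary: X rule: generate_topology.induct)
    case UNIV
    then show ?case by (intro exI[of _ "{}"]) auto
  next
    case (Int a b)
    obtain F G where "F \<subseteq> cell_events" "finite F" "X \<in> \<Inter>F" "\<Inter>F \<subseteq> a"
       "G \<subseteq> cell_events" "finite G" "X \<in> \<Inter>G" "\<Inter>G \<subseteq> b" using Int.IH[of X] Int.prems by auto
    then show ?case by (intro exI[of _ "F \<union> G"]) auto
  next
    case (UN K)
    then obtain k F where "k \<in> K" "F \<subseteq> cell_events" "finite F" "X \<in> \<Inter>F" "\<Inter>F \<subseteq> k" by (metis UnionE)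
    then show ?case by (intro exI[of _ F]) auto
  next
    case (Basis s)
    then obtain f :: "plane \<Rightarrow> real" and U where *: "s = {X. (LINT x|meas X. f x) \<in> U}"
       "continuous_on UNIV f" "compact (closure {x. f x \<noteq> 0})" "open U" by blast
    show ?case unfolding *(1) by (rule subbasic_cell_events) (use * Basis in auto)
  qed
qed

lemma borel_conf_eq: "(borel :: conf measure) = sigma UNIV cell_events"
proof (rule measure_eqI)
  show "sets (borel :: conf measure) = sets (sigma UNIV cell_events)"
  proof
    have "cell_events \<subseteq> sets borel"
    proof
      fix A assume "A \<in> cell_events"
      then obtain m k n where A: "A = {Y. Pts Y (cell m -` {k}) = n}" by (auto simp: cell_events_def)
      have "(\<lambda>Y. Pts Y (cell m -` {k})) -` {n} \<inter> space borel \<in> sets borel"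
        by (rule measurable_sets[OF measurable_Pts]) (auto simp: bounded_cell_vimage)
      then show "A \<in> sets borel" by (simp add: A vimage_def)
    qed
    then show "sets (sigma UNIV cell_events) \<subseteq> sets (borel :: conf measure)"
      using sets.sigma_sets_subset[of cell_events borel] by simp
    show "sets (borel :: conf measure) \<subseteq> sets (sigma UNIV cell_events)"
      unfolding borel_def
    proof (simp, rule sigma_sets_mono, safe)
      fix W :: "conf set" assume W: "open W"
      define \<C> where "\<C> = {\<F>. \<F> \<subseteq> cell_events \<and> finite \<F> \<and> \<Inter>\<F> \<subseteq> W}"
      have cC: "countable \<C>"
        by (rule countable_subset[OF _ countable_Collect_finite_subset[OF countable_cell_events]]) (auto simp: \<C>_def)
      \<comment> \<open>Each point of \<open>W\<close> lies in a finite intersection of count events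
        inside \<open>W\<close>, and there are only countably many finite families of such events.
        Hence arbitrary unions of open sets are harmless.\<close>
      have "W = (\<Union>\<F>\<in>\<C>. \<Inter>\<F>)"
        using open_conf_cell_events[OF W] by (fastforce simp: \<C>_def)
      moreover have "\<Inter>\<F> \<in> sets (sigma UNIV cell_events)" if "\<F> \<in> \<C>" for \<F>
      proof (cases "\<F> = {}")
        case False
        have "\<F> \<subseteq> sets (sigma UNIV cell_events)" using that by (auto simp: \<C>_def)
        then show ?thesis using False that sets.finite_INT[of \<F> "\<lambda>x. x" "sigma UNIV cell_events"] by (auto simp: \<C>_def)
      qed (metis Inf_empty sets.top space_measure_of_conv)
      ultimately have "W \<in> sets (sigma UNIV cell_events)"
        using cC by (metis (no_types, lifting) sets.countable_UN'')
      then show "W \<in> sigma_sets UNIV cell_events" by simp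
    qed
  qed
qed (simp add: borel_def emeasure_sigma)

lemma measurable_confI:
  assumes "\<And>A. A \<in> sets borel \<Longrightarrow> bounded A \<Longrightarrow> (\<lambda>\<omega>. Pts (F \<omega>) A) \<in> measurable M (count_space UNIV)"
  shows "F \<in> measurable M borel"
  unfolding borel_conf_eq
proof (rule measurable_measure_of)
  fix A assume "A \<in> cell_events"
  then obtain m k n where A: "A = {Y. Pts Y (cell m -` {k}) = n}" by (auto simp: cell_events_def)
  have "(\<lambda>\<omega>. Pts (F \<omega>) (cell m -` {k})) -` {n} \<inter> space M \<in> sets M"
    by (rule measurable_sets[OF assms]) (auto simp: bounded_cell_vimage)
  then show "F -` A \<inter> space M \<in> sets M" by (simp add: A vimage_def)
qed auto

section \<open>Push-forwards and uniform points\<close>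

text \<open>The absence of points from a set is an uncountable family of conditions on
  multiplicities; expressed through the mass it becomes a measurable event, which can be transported
  through \<open>distr\<close>.\<close>

lemma emeasure_meas_eq_0_iff:
  assumes "A \<in> sets borel"
  shows "emeasure (meas X) A = 0 \<longleftrightarrow> (\<forall>x\<in>A. mult X x = 0)"
proof -
  have "emeasure (meas X) A = (\<integral>\<^sup>+x. indicator A x \<partial>meas X)" using assms by simp
  also have "\<dots> = (\<integral>\<^sup>+x. of_nat (mult X x) * indicator A x \<partial>count_space UNIV)"
    using assms by (intro nn_integral_meas) auto
  finally show ?thesis
    by (auto simp: nn_integral_0_iff_AE AE_count_space indicator_def split: if_splits)
qed

lemma mult_restr: "mult (restr X A) x = (if x \<in> A then mult X x else 0)"
  by (simp add: restr.rep_eq)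

lemma mult_union: "mult (union_conf X Y) x = mult X x + mult Y x"
  by (simp add: union_conf.rep_eq)

lemma Pts_cong: "(\<And>x. x \<in> A \<Longrightarrow> mult X x = mult Y x) \<Longrightarrow> Pts X A = Pts Y A"
  unfolding Pts_def by (intro sum.cong) auto

lemma restr_eq_iff: "restr X A = restr Y A \<longleftrightarrow> (\<forall>x\<in>A. mult X x = mult Y x)"
  by (auto simp: conf_eqI mult_restr intro!: conf_eqI) (metis mult_restr)

lemma measurable_union_conf: "(\<lambda>X. union_conf X Y) \<in> borel \<rightarrow>\<^sub>M borel"
proof (rule measurable_confI)
  fix A :: "plane set" assume A: "A \<in> sets borel" "bounded A"
  have "Pts (union_conf X Y) A = Pts X A + Pts Y A" for X
  proof -
    have fin: "finite {x \<in> A. mult X x \<noteq> 0 \<or> mult Y x \<noteq> 0}"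
      by (rule finite_subset[OF _ finite_UnI[OF finite_supp[OF A(2), of X] finite_supp[OF A(2), of Y]]]) auto
    have "Pts X A = (\<Sum>x | x \<in> A \<and> (mult X x \<noteq> 0 \<or> mult Y x \<noteq> 0). mult X x)"
      "Pts Y A = (\<Sum>x | x \<in> A \<and> (mult X x \<noteq> 0 \<or> mult Y x \<noteq> 0). mult Y x)"
      unfolding Pts_def using fin by (auto intro!: sum.mono_neutral_left)
    then show ?thesis unfolding Pts_def by (simp add: mult_union sum.distrib)
  qed
  then show "(\<lambda>X. Pts (union_conf X Y) A) \<in> borel \<rightarrow>\<^sub>M count_space UNIV"
    using measurable_Pts[OF A] by simp
qed

text \<open>Bounded displacement is what preserves local finiteness, hence what gives
  \<open>push\<close> its intended value. Carrying the inverse along makes preimages and images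
  interchangeable.\<close>

definition tame_bij :: "(plane \<Rightarrow> plane) \<Rightarrow> (plane \<Rightarrow> plane) \<Rightarrow> bool" where
  "tame_bij T T' \<longleftrightarrow> (\<forall>x. T' (T x) = x) \<and> (\<forall>x. T (T' x) = x) \<and>
     T \<in> borel_measurable borel \<and> T' \<in> borel_measurable borel \<and> (\<exists>D. \<forall>x. dist (T x) x \<le> D)"

lemma tame_bij_sym: "tame_bij T T' \<Longrightarrow> tame_bij T' T"
  unfolding tame_bij_def by (metis dist_commute)

lemma tame_bij_translation: "tame_bij (\<lambda>x. x + v) (\<lambda>x. x - v)"
  by (auto simp: tame_bij_def dist_norm)

lemma tame_bijD:
  assumes "tame_bij T T'"
  shows "T' (T x) = x" "T (T' x) = x" "T \<in> borel_measurable borel" "T' \<in> borel_measurable borel"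
    "T x = y \<longleftrightarrow> x = T' y" "T -` A = T' ` A" "T ` A = T' -` A"
  using assms unfolding tame_bij_def by (auto simp: image_iff) metis+

lemma tame_bij_bounded_vimage:
  assumes "tame_bij T T'" "bounded A"
  shows "bounded (T -` A)"
proof -
  obtain D where D: "\<And>x. dist (T x) x \<le> D" using assms(1) by (auto simp: tame_bij_def)
  obtain r where r: "\<And>x. x \<in> A \<Longrightarrow> dist 0 x \<le> r" using assms(2) bounded_any_center[of _ 0] by blast
  have "dist 0 x \<le> r + D" if "x \<in> T -` A" for x
    using D[of x] r[of "T x"] that dist_triangle[of 0 x "T x"] by auto
  then show ?thesis unfolding bounded_any_center[of _ 0] by blast
qed

lemma mult_push:
  assumes T: "tame_bij T T'"
  shows "mult (push T X) y = mult X (T' y)"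
proof -
  have eq: "(\<Sum>x | T x = y \<and> mult X x \<noteq> 0. mult X x) = mult X (T' y)" for y
  proof -
    have "{x. T x = y \<and> mult X x \<noteq> 0} = (if mult X (T' y) = 0 then {} else {T' y})"
      using tame_bijD(5)[OF T] by auto
    then show ?thesis by simp
  qed
  have "finite {y \<in> cball 0 r. mult X (T' y) \<noteq> 0}" for r
  proof (rule finite_subset)
    show "{y \<in> cball 0 r. mult X (T' y) \<noteq> 0} \<subseteq> T ` {x \<in> T -` cball 0 r. mult X x \<noteq> 0}"
    proof safe
      fix y assume "y \<in> cball 0 r" "mult X (T' y) > 0"
      then show "y \<in> T ` {x \<in> T -` cball 0 r. mult X x \<noteq> 0}"
        by (intro image_eqI[of _ _ "T' y"]) (auto simp: tame_bijD[OF T])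
    qed
    show "finite (T ` {x \<in> T -` cball 0 r. mult X x \<noteq> 0})"
      by (intro finite_imageI finite_supp tame_bij_bounded_vimage[OF T] bounded_cball)
  qed
  then show ?thesis unfolding push_def eq by (subst Conf_inverse) auto
qed

lemma Pts_push:
  assumes T: "tame_bij T T'"
  shows "Pts (push T X) A = Pts X (T -` A)"
  unfolding Pts_def mult_push[OF T]
  by (rule sum.reindex_bij_witness[of _ T T']) (auto simp: tame_bijD(1,2)[OF T])

lemma measurable_push [measurable]:
  assumes T: "tame_bij T T'"
  shows "push T \<in> borel \<rightarrow>\<^sub>M borel"
proof (rule measurable_confI)
  fix A :: "plane set" assume A: "A \<in> sets borel" "bounded A"
  have "T -` A \<in> sets borel" using measurable_sets[OF tame_bijD(3)[OF T] A(1)] by simp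
  then show "(\<lambda>X. Pts (push T X) A) \<in> borel \<rightarrow>\<^sub>M count_space UNIV"
    unfolding Pts_push[OF T] using tame_bij_bounded_vimage[OF T A(2)] by measurable
qed

lemma push_inverse:
  assumes T: "tame_bij T T'"
  shows "push T' (push T X) = X"
  by (rule conf_eqI) (simp add: mult_push[OF T] mult_push[OF tame_bij_sym[OF T]] tame_bijD[OF T])

lemma push_union:
  assumes T: "tame_bij T T'"
  shows "push T (union_conf X Y) = union_conf (push T X) (push T Y)"
  by (rule conf_eqI) (simp add: mult_push[OF T] mult_union)

lemma push_restr:
  assumes T: "tame_bij T T'"
  shows "push T (restr X A) = restr (push T X) (T ` A)"
  by (rule conf_eqI) (auto simp: mult_push[OF T] mult_restr tame_bijD[OF T])

lemma meas_push:
  assumes T: "tame_bij T T'"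
  shows "meas (push T X) = distr (meas X) borel T"
proof (rule measure_eqI)
  fix A assume "A \<in> sets (meas (push T X))"
  then have A[measurable]: "A \<in> sets borel" by simp
  note [measurable] = tame_bijD(3,4)[OF T]
  have "emeasure (meas (push T X)) A = (\<integral>\<^sup>+x. indicator A x \<partial>meas (push T X))" by simp
  also have "\<dots> = (\<integral>\<^sup>+x. of_nat (mult X (T' x)) * indicator A x \<partial>count_space UNIV)"
    by (subst nn_integral_meas) (auto simp: mult_push[OF T])
  also have "\<dots> = (\<integral>\<^sup>+x. of_nat (mult X x) * indicator A (T x) \<partial>count_space UNIV)"
    by (subst nn_integral_bij_count_space[symmetric, of T UNIV UNIV])
       (auto simp: tame_bijD[OF T] intro!: bij_betwI[of _ _ _ T'])
  also have "\<dots> = (\<integral>\<^sup>+x. indicator A (T x) \<partial>meas X)"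
    by (subst nn_integral_meas) auto
  also have "\<dots> = emeasure (distr (meas X) borel T) A"
    by (subst nn_integral_distr[symmetric, of T "meas X" borel]) auto
  finally show "emeasure (meas (push T X)) A = emeasure (distr (meas X) borel T) A" .
qed simp

section \<open>Independent uniform points and their images\<close>

lemma mult_conf_of_points: "mult (conf_of_points n x) y = card {i \<in> {..<n}. x i = y}"
  by (simp add: conf_of_points.rep_eq)

lemma Pts_conf_of_points: "Pts (conf_of_points n x) A = card {i \<in> {..<n}. x i \<in> A}"
proof -
  have "Pts (conf_of_points n x) A = (\<Sum>y | y \<in> A \<and> card {i \<in> {..<n}. x i = y} \<noteq> 0. card {i \<in> {..<n}. x i = y})"
    by (simp add: Pts_def mult_conf_of_points)
  also have "\<dots> = (\<Sum>y \<in> x ` {..<n} \<inter> A. card {i \<in> {..<n}. x i = y})"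
    by (rule sum.mono_neutral_left) auto
  also have "\<dots> = card (\<Union>y\<in>x ` {..<n} \<inter> A. {i \<in> {..<n}. x i = y})"
    by (rule card_UN_disjoint[symmetric]) auto
  also have "(\<Union>y\<in>x ` {..<n} \<inter> A. {i \<in> {..<n}. x i = y}) = {i \<in> {..<n}. x i \<in> A}" by auto
  finally show ?thesis .
qed

lemma measurable_conf_of_points:
  assumes "\<And>i. i < n \<Longrightarrow> sets (M i) = sets borel"
  shows "conf_of_points n \<in> PiM {..<n} M \<rightarrow>\<^sub>M borel"
proof (rule measurable_confI)
  fix A :: "plane set" assume A[measurable]: "A \<in> sets borel" "bounded A"
  have m: "(\<lambda>x. x i) \<in> PiM {..<n} M \<rightarrow>\<^sub>M borel" if "i < n" for i
    using measurable_component_singleton[of i "{..<n}" M] that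
    by (simp add: measurable_cong_sets[OF refl assms[OF that]])
  have "(\<lambda>x. nat \<lfloor>\<Sum>i<n. indicator A (x i) :: real\<rfloor>) \<in> PiM {..<n} M \<rightarrow>\<^sub>M count_space UNIV"
    using m by measurable
  moreover have "Pts (conf_of_points n x) A = nat \<lfloor>\<Sum>i<n. indicator A (x i) :: real\<rfloor>" for x
  proof -
    have "(\<Sum>i<n. indicator A (x i) :: real) = (\<Sum>i<n. if x i \<in> A then 1 else 0)"
      by (intro sum.cong) (auto simp: indicator_def)
    also have "\<dots> = real (card {i \<in> {..<n}. x i \<in> A})" by (simp add: sum.If_cases Int_def)
    finally show ?thesis by (simp add: Pts_conf_of_points)
  qed
  ultimately show "(\<lambda>x. Pts (conf_of_points n x) A) \<in> PiM {..<n} M \<rightarrow>\<^sub>M count_space UNIV" by simp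
qed

lemma sets_Bin [simp, measurable_cong]: "sets (Bin \<Lambda> n) = sets borel"
  by (simp add: Bin_def)

lemma space_Bin [simp]: "space (Bin \<Lambda> n) = UNIV"
  by (simp add: Bin_def)

text \<open>Positive finite area is what makes \<open>uniform_measure\<close> a probability;
  boundedness makes the number of points in \<open>\<Lambda>\<close> meaningful.\<close>

definition fat :: "plane set \<Rightarrow> bool" where
  "fat \<Lambda> \<longleftrightarrow> \<Lambda> \<in> sets borel \<and> bounded \<Lambda> \<and> emeasure lborel \<Lambda> \<noteq> 0 \<and> emeasure lborel \<Lambda> \<noteq> \<infinity>"

lemma fat_cball: "r > 0 \<Longrightarrow> fat (cball a r)"
  using less_imp_neq[OF unit_ball_vol_pos[of 2]] by (auto simp: fat_def emeasure_cball)

lemma measurable_conf_of_points_uniform [measurable]: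
  "conf_of_points n \<in> PiM {..<n} (\<lambda>_. uniform_measure lborel \<Lambda>) \<rightarrow>\<^sub>M borel"
  by (rule measurable_conf_of_points) simp

lemma AE_Bin:
  assumes "fat \<Lambda>"
  shows "AE X' in Bin \<Lambda> n. Pts X' \<Lambda> = n \<and> (\<forall>x. x \<notin> \<Lambda> \<longrightarrow> mult X' x = 0)"
proof -
  have [measurable]: "\<Lambda> \<in> sets borel" "bounded \<Lambda>" using assms by (auto simp: fat_def)
  let ?U = "uniform_measure lborel \<Lambda>"
  have "AE x in PiM {..<n} (\<lambda>_. ?U). x i \<in> \<Lambda>" if "i < n" for i
    by (rule AE_PiM_component)
       (use assms that in \<open>auto simp: fat_def intro!: prob_space_uniform_measure AE_uniform_measureI\<close>)
  then have *: "AE x in PiM {..<n} (\<lambda>_. ?U). \<forall>i\<in>{..<n}. x i \<in> \<Lambda>"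
    by (intro AE_finite_allI) auto
  have "AE X' in Bin \<Lambda> n. Pts X' \<Lambda> = n \<and> emeasure (meas X') (- \<Lambda>) = 0"
    unfolding Bin_def
  proof (subst AE_distr_iff)
    show "AE x in PiM {..<n} (\<lambda>_. ?U). Pts (conf_of_points n x) \<Lambda> = n \<and> emeasure (meas (conf_of_points n x)) (- \<Lambda>) = 0"
      using *
    proof eventually_elim
      case (elim x)
      then have "{i \<in> {..<n}. x i \<in> \<Lambda>} = {..<n}" by auto
      moreover have "\<forall>y\<in>-\<Lambda>. {i \<in> {..<n}. x i = y} = {}" using elim by auto
      ultimately show ?case by (auto simp: Pts_conf_of_points emeasure_meas_eq_0_iff mult_conf_of_points)
    qed
  qed measurable
  then show ?thesis by eventually_elim (auto simp: emeasure_meas_eq_0_iff)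
qed

text \<open>An area-preserving map carries the uniform law on \<open>\<Lambda>\<close> to the
  uniform law on its image, coordinate by coordinate, and pushing a configuration amounts to
  composing its list of points with \<open>T\<close>.\<close>

lemma Bin_push:
  assumes T: "tame_bij T T'" and leb: "distr lborel lborel T = lborel" and \<Lambda>: "fat \<Lambda>"
  shows "fat (T ` \<Lambda>)" "distr (Bin \<Lambda> n) borel (push T) = Bin (T ` \<Lambda>) n"
proof -
  note [measurable] = tame_bijD(3,4)[OF T]
  have m[measurable]: "\<Lambda> \<in> sets borel" "bounded \<Lambda>" using \<Lambda> by (auto simp: fat_def)
  have T\<Lambda>[measurable]: "T ` \<Lambda> \<in> sets borel" 
    unfolding tame_bijD(7)[OF T] using measurable_sets[OF tame_bijD(4)[OF T] m(1)] by simp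
  have vim: "emeasure lborel (T -` A) = emeasure lborel A" if "A \<in> sets borel" for A
    using emeasure_distr[of T lborel lborel A] that leb by simp
  have "T -` (T ` \<Lambda>) = \<Lambda>" by auto (metis tame_bijD(1)[OF T])
  then have em: "emeasure lborel (T ` \<Lambda>) = emeasure lborel \<Lambda>" using vim[OF T\<Lambda>] by simp
  show fat: "fat (T ` \<Lambda>)"
    using \<Lambda> em T\<Lambda> tame_bij_bounded_vimage[OF tame_bij_sym[OF T], of \<Lambda>]
    unfolding fat_def by (simp add: tame_bijD(7)[OF T])
  let ?U = "\<lambda>\<Lambda>. uniform_measure lborel \<Lambda>"
  have pU: "prob_space (?U \<Lambda>)" if "fat \<Lambda>" for \<Lambda>
    using that by (auto simp: fat_def intro!: prob_space_uniform_measure)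
  have U: "distr (?U \<Lambda>) (?U (T ` \<Lambda>)) T = ?U (T ` \<Lambda>)"
  proof (rule measure_eqI)
    fix A assume "A \<in> sets (distr (?U \<Lambda>) (?U (T ` \<Lambda>)) T)"
    then have [measurable]: "A \<in> sets borel" by simp
    have "\<Lambda> \<inter> T -` A = T -` (T ` \<Lambda> \<inter> A)" by auto (metis tame_bijD(1)[OF T])
    moreover have "T -` A \<in> sets borel" using measurable_sets[OF tame_bijD(3)[OF T], of A] by simp
    ultimately show "emeasure (distr (?U \<Lambda>) (?U (T ` \<Lambda>)) T) A = emeasure (?U (T ` \<Lambda>)) A"
      using vim[of "T ` \<Lambda> \<inter> A"] by (simp add: emeasure_distr em)
  qed simp
  have "distr (Bin \<Lambda> n) borel (push T) = distr (PiM {..<n} (\<lambda>_. ?U \<Lambda>)) borel (push T \<circ> conf_of_points n)"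
    unfolding Bin_def by (rule distr_distr) (auto intro: measurable_push[OF T])
  also have "push T \<circ> conf_of_points n = conf_of_points n \<circ> compose {..<n} T"
  proof (rule ext, rule conf_eqI)
    fix x y
    have "{i. i < n \<and> x i = T' y} = {i. i < n \<and> compose {..<n} T x i = y}"
      by (auto simp: compose_def tame_bijD[OF T])
    then show "mult ((push T \<circ> conf_of_points n) x) y = mult ((conf_of_points n \<circ> compose {..<n} T) x) y"
      by (simp add: mult_push[OF T] mult_conf_of_points)
  qed
  also have "distr (PiM {..<n} (\<lambda>_. ?U \<Lambda>)) borel (conf_of_points n \<circ> compose {..<n} T)
     = distr (distr (PiM {..<n} (\<lambda>_. ?U \<Lambda>)) (PiM {..<n} (\<lambda>_. ?U (T ` \<Lambda>))) (compose {..<n} T)) borel (conf_of_points n)"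
  proof (rule distr_distr[symmetric])
    have "compose {..<n} T = (\<lambda>x. \<lambda>i\<in>{..<n}. T (x i))" by (auto simp: compose_def)
    moreover have "(\<lambda>x. \<lambda>i\<in>{..<n}. T (x i)) \<in> PiM {..<n} (\<lambda>_. ?U \<Lambda>) \<rightarrow>\<^sub>M PiM {..<n} (\<lambda>_. ?U (T ` \<Lambda>))"
    proof (rule measurable_restrict)
      fix i assume "i \<in> {..<n}"
      then show "(\<lambda>x. T (x i)) \<in> PiM {..<n} (\<lambda>_. ?U \<Lambda>) \<rightarrow>\<^sub>M ?U (T ` \<Lambda>)"
        using measurable_compose[OF measurable_component_singleton[of i "{..<n}" "\<lambda>_. ?U \<Lambda>"], of T "?U (T ` \<Lambda>)"] by simp
    qed
    ultimately show "compose {..<n} T \<in> PiM {..<n} (\<lambda>_. ?U \<Lambda>) \<rightarrow>\<^sub>M PiM {..<n} (\<lambda>_. ?U (T ` \<Lambda>))" by simp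
  qed simp
  also have "distr (PiM {..<n} (\<lambda>_. ?U \<Lambda>)) (PiM {..<n} (\<lambda>_. ?U (T ` \<Lambda>))) (compose {..<n} T)
     = PiM {..<n} (\<lambda>_. ?U (T ` \<Lambda>))"
    using distr_PiM_finite_prob_space'[of "{..<n}" "\<lambda>_. ?U \<Lambda>" "\<lambda>_. ?U (T ` \<Lambda>)" T] U pU[OF fat] pU[OF \<Lambda>]
    by simp
  finally show "distr (Bin \<Lambda> n) borel (push T) = Bin (T ` \<Lambda>) n" unfolding Bin_def .
qed

section \<open>Energies as functions of the configuration\<close>

text \<open>\<open>meas X\<close> may be infinite. Restricting it to a disk and dividing by one plus
  the number of points there gives a subprobability kernel; multiplying back and letting the disk
  grow recovers the integral.\<close>

lemma nn_integral_meas_measurable: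
  assumes f: "(\<lambda>(\<omega>, x). f \<omega> x) \<in> borel_measurable (M \<Otimes>\<^sub>M (borel :: plane measure))"
    and F: "F \<in> M \<rightarrow>\<^sub>M borel"
  shows "(\<lambda>\<omega>. \<integral>\<^sup>+x. f \<omega> x \<partial>meas (F \<omega>)) \<in> borel_measurable M"
proof -
  define \<kappa> where "\<kappa> n X = density (meas X) (\<lambda>x. indicator (ball 0 (real n)) x / (1 + of_nat (Pts X (ball 0 (real n)))))" for n :: nat and X
  have em: "emeasure (\<kappa> n X) A = emeasure (meas X) (A \<inter> ball 0 (real n)) / (1 + of_nat (Pts X (ball 0 (real n))))"
    if "A \<in> sets borel" for n X A
  proof -
    have "emeasure (\<kappa> n X) A = (\<integral>\<^sup>+x. indicator (A \<inter> ball 0 (real n)) x / (1 + of_nat (Pts X (ball 0 (real n)))) \<partial>meas X)"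
      unfolding \<kappa>_def using that
      by (subst emeasure_density) (auto intro!: nn_integral_cong simp: indicator_def)
    also have "\<dots> = emeasure (meas X) (A \<inter> ball 0 (real n)) / (1 + of_nat (Pts X (ball 0 (real n))))"
    proof -
      have [measurable]: "A \<inter> ball 0 (real n) \<in> sets borel" using that by auto
      show ?thesis by (subst nn_integral_divide) auto
    qed
    finally show ?thesis .
  qed
  have sub: "\<kappa> n \<in> borel \<rightarrow>\<^sub>M subprob_algebra borel" for n
  proof (rule measurable_subprob_algebra)
    fix X
    show "subprob_space (\<kappa> n X)"
    proof
      have "emeasure (\<kappa> n X) UNIV = ennreal (real (Pts X (ball 0 (real n)))) / ennreal (1 + real (Pts X (ball 0 (real n))))"
        by (simp add: em emeasure_meas ennreal_of_nat_eq_real_of_nat ennreal_plus)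
      also have "\<dots> \<le> 1" by (subst divide_ennreal) (auto simp: divide_le_eq_1)
      finally show "emeasure (\<kappa> n X) (space (\<kappa> n X)) \<le> 1" by (simp add: \<kappa>_def)
    qed (simp add: \<kappa>_def)
    show "sets (\<kappa> n X) = sets borel" by (simp add: \<kappa>_def)
  next
    fix A :: "plane set" assume [measurable]: "A \<in> sets borel"
    have [measurable]: "(\<lambda>X. Pts X (ball 0 (real n))) \<in> borel \<rightarrow>\<^sub>M count_space UNIV"
      by (rule measurable_Pts) auto
    show "(\<lambda>X. emeasure (\<kappa> n X) A) \<in> borel_measurable borel"
      by (simp add: em) measurable
  qed
  note [measurable] = f F
  have "(\<lambda>\<omega>. \<integral>\<^sup>+x. f \<omega> x \<partial>\<kappa> n (F \<omega>)) \<in> borel_measurable M" for n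
    by (rule nn_integral_measurable_subprob_algebra2[OF f]) (use sub F in measurable)
  moreover have [measurable]: "(\<lambda>\<omega>. Pts (F \<omega>) (ball 0 (real n))) \<in> M \<rightarrow>\<^sub>M count_space UNIV" for n
    by (rule measurable_compose[OF F measurable_Pts]) auto
  ultimately have "(\<lambda>\<omega>. SUP n. (1 + of_nat (Pts (F \<omega>) (ball 0 (real n)))) * (\<integral>\<^sup>+x. f \<omega> x \<partial>\<kappa> n (F \<omega>))) \<in> borel_measurable M"
    by measurable
  also have "?this \<longleftrightarrow> ?thesis"
  proof (rule measurable_cong)
    fix \<omega> assume \<omega>: "\<omega> \<in> space M"
    have m[measurable]: "f \<omega> \<in> borel_measurable borel"
      using measurable_compose[OF measurable_Pair1'[OF \<omega>] f] by simp
    have "(1 + of_nat (Pts (F \<omega>) (ball 0 (real n)))) * (\<integral>\<^sup>+x. f \<omega> x \<partial>\<kappa> n (F \<omega>)) = (\<integral>\<^sup>+x. f \<omega> x * indicator (ball 0 (real n)) x \<partial>meas (F \<omega>))" for n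
    proof -
      let ?c = "1 + of_nat (Pts (F \<omega>) (ball 0 (real n))) :: ennreal"
      have "(\<integral>\<^sup>+x. f \<omega> x \<partial>\<kappa> n (F \<omega>)) = (\<integral>\<^sup>+x. f \<omega> x * indicator (ball 0 (real n)) x / ?c \<partial>meas (F \<omega>))"
      proof -
        have 1: "f \<omega> \<in> borel_measurable (meas (F \<omega>))" using m by measurable
        have [measurable]: "ball 0 (real n) \<in> sets (borel :: plane measure)" by simp
        have "(\<lambda>x. indicator (ball 0 (real n)) x / c) \<in> borel_measurable (meas (F \<omega>))" for c :: ennreal
          by measurable
        then have 2: "(\<lambda>x. indicator (ball 0 (real n)) x / ?c) \<in> borel_measurable (meas (F \<omega>))" .
        show ?thesis unfolding \<kappa>_def nn_integral_density[OF 2 1]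
          by (intro nn_integral_cong) (simp add: divide_ennreal_def ac_simps)
      qed
      also have "\<dots> = (\<integral>\<^sup>+x. f \<omega> x * indicator (ball 0 (real n)) x \<partial>meas (F \<omega>)) / ?c"
      proof (rule nn_integral_divide)
        have [measurable]: "ball 0 (real n) \<in> sets (borel :: plane measure)" by simp
        have "(\<lambda>x. g x * indicator (ball 0 (real n)) x) \<in> borel_measurable (meas (F \<omega>))"
          if [measurable]: "g \<in> borel_measurable borel" for g :: "plane \<Rightarrow> ennreal"
          by measurable
        from this[OF m] show "(\<lambda>x. f \<omega> x * indicator (ball 0 (real n)) x) \<in> borel_measurable (meas (F \<omega>))" .
      qed
      finally show ?thesis
        by (simp add: ennreal_times_divide ennreal_mult_divide_eq mult.commute[of ?c] ennreal_add_eq_top)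
    qed
    moreover have "(SUP n. \<integral>\<^sup>+x. f \<omega> x * indicator (ball 0 (real n)) x \<partial>meas (F \<omega>)) = (\<integral>\<^sup>+x. f \<omega> x \<partial>meas (F \<omega>))"
    proof -
      have "(SUP n. f \<omega> x * indicator (ball 0 (real n)) x) = f \<omega> x" for x
      proof -
        obtain n :: nat where n: "norm x < real n" using reals_Archimedean2 by blast
        show ?thesis by (intro antisym SUP_least SUP_upper2[of n]) (use n in \<open>auto simp: indicator_def\<close>)
      qed
      moreover have "(\<integral>\<^sup>+x. (SUP n. f \<omega> x * indicator (ball 0 (real n)) x) \<partial>meas (F \<omega>))
          = (SUP n. \<integral>\<^sup>+x. f \<omega> x * indicator (ball 0 (real n)) x \<partial>meas (F \<omega>))"
        by (rule nn_integral_monotone_convergence_SUP) (auto simp: incseq_def le_fun_def indicator_def)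
      ultimately show ?thesis by simp
    qed
    ultimately show "(SUP n. (1 + of_nat (Pts (F \<omega>) (ball 0 (real n)))) * (\<integral>\<^sup>+x. f \<omega> x \<partial>\<kappa> n (F \<omega>))) = (\<integral>\<^sup>+x. f \<omega> x \<partial>meas (F \<omega>))"
      by simp
  qed
  finally show ?thesis .
qed

text \<open>A family of plane measures against which nonnegative integrals depend measurably on the
  parameter; needed because the library's kernels are restricted to subprobability measures.\<close>

definition nn_kernel :: "'a measure \<Rightarrow> ('a \<Rightarrow> plane measure) \<Rightarrow> bool" where
  "nn_kernel M \<mu> \<longleftrightarrow> (\<forall>\<omega>. sigma_finite_measure (\<mu> \<omega>) \<and> sets (\<mu> \<omega>) = sets borel) \<and>
     (\<forall>f \<in> borel_measurable (M \<Otimes>\<^sub>M borel). (\<lambda>\<omega>. \<integral>\<^sup>+x. f (\<omega>, x) \<partial>\<mu> \<omega>) \<in> borel_measurable M)"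

lemma nn_kernel_meas: "F \<in> M \<rightarrow>\<^sub>M borel \<Longrightarrow> nn_kernel M (\<lambda>\<omega>. meas (F \<omega>))"
  unfolding nn_kernel_def by (auto intro!: nn_integral_meas_measurable)

lemma nn_kernel_lborel: "nn_kernel M (\<lambda>_. lborel)"
  unfolding nn_kernel_def
  by (auto intro!: sigma_finite_measure.borel_measurable_nn_integral sigma_finite_lborel
      simp: measurable_cong_sets[OF sets_pair_measure_cong[OF refl sets_lborel[symmetric]] refl] split_beta)

text \<open>After Tonelli the inner integral depends on both the parameter and the outer variable.
  This is why the kernel hypothesis on \<open>\<nu>\<close> is placed over the product
  space.\<close>

lemma integral_pair_measurable:
  fixes g :: "plane \<times> plane \<Rightarrow> real"
  assumes \<mu>: "nn_kernel M \<mu>" and \<nu>: "nn_kernel (M \<Otimes>\<^sub>M (borel :: plane measure)) (\<lambda>p. \<nu> (fst p))"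
    and g: "g \<in> borel_measurable (borel \<Otimes>\<^sub>M borel)"
  shows "(\<lambda>\<omega>. LINT z|(\<mu> \<omega> \<Otimes>\<^sub>M \<nu> \<omega>). g z) \<in> borel_measurable M"
proof -
  have sets: "sets (\<mu> \<omega> \<Otimes>\<^sub>M \<nu> \<omega>) = sets (borel \<Otimes>\<^sub>M borel)" for \<omega>
    using \<mu> \<nu> by (intro sets_pair_measure_cong) (fastforce simp: nn_kernel_def)+
  have nn: "(\<lambda>\<omega>. \<integral>\<^sup>+z. h z \<partial>(\<mu> \<omega> \<Otimes>\<^sub>M \<nu> \<omega>)) \<in> borel_measurable M"
    if h[measurable]: "h \<in> borel_measurable (borel \<Otimes>\<^sub>M borel)" for h :: "plane \<times> plane \<Rightarrow> ennreal"
  proof -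
    have 1: "(\<lambda>p. \<integral>\<^sup>+y. h (snd p, y) \<partial>\<nu> (fst p)) \<in> borel_measurable (M \<Otimes>\<^sub>M borel)"
    proof -
      have "(\<lambda>q. h (snd (fst q), snd q)) \<in> borel_measurable ((M \<Otimes>\<^sub>M borel) \<Otimes>\<^sub>M borel)"
        by (rule measurable_compose[OF _ h]) measurable
      with \<nu> show ?thesis unfolding nn_kernel_def by fastforce
    qed
    have "(\<lambda>\<omega>. \<integral>\<^sup>+x. (\<integral>\<^sup>+y. h (x, y) \<partial>\<nu> \<omega>) \<partial>\<mu> \<omega>) \<in> borel_measurable M"
      using \<mu> 1 unfolding nn_kernel_def by fastforce
    moreover have "(\<integral>\<^sup>+z. h z \<partial>(\<mu> \<omega> \<Otimes>\<^sub>M \<nu> \<omega>)) = (\<integral>\<^sup>+x. (\<integral>\<^sup>+y. h (x, y) \<partial>\<nu> \<omega>) \<partial>\<mu> \<omega>)" for \<omega>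
      by (rule sigma_finite_measure.nn_integral_fst[symmetric])
        (use \<nu> in \<open>fastforce simp: nn_kernel_def measurable_cong_sets[OF sets refl]\<close>)+
    ultimately show ?thesis by simp
  qed
  \<comment> \<open>Integrability is not assumed, so the default value 0 of a non-integrable Bochner
    integral has to appear explicitly in the function shown to be measurable.\<close>
  have "(LINT z|(\<mu> \<omega> \<Otimes>\<^sub>M \<nu> \<omega>). g z) =
    (if (\<integral>\<^sup>+z. ennreal (norm (g z)) \<partial>(\<mu> \<omega> \<Otimes>\<^sub>M \<nu> \<omega>)) < \<infinity>
     then enn2real (\<integral>\<^sup>+z. ennreal (g z) \<partial>(\<mu> \<omega> \<Otimes>\<^sub>M \<nu> \<omega>)) - enn2real (\<integral>\<^sup>+z. ennreal (- g z) \<partial>(\<mu> \<omega> \<Otimes>\<^sub>M \<nu> \<omega>)) else 0)" for \<omega>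
    using g by (auto simp: real_lebesgue_integral_def integrable_iff_bounded measurable_cong_sets[OF sets refl]
        intro!: not_integrable_integral_eq)
  moreover have "(\<lambda>\<omega>. if (\<integral>\<^sup>+z. ennreal (norm (g z)) \<partial>(\<mu> \<omega> \<Otimes>\<^sub>M \<nu> \<omega>)) < \<infinity>
     then enn2real (\<integral>\<^sup>+z. ennreal (g z) \<partial>(\<mu> \<omega> \<Otimes>\<^sub>M \<nu> \<omega>)) - enn2real (\<integral>\<^sup>+z. ennreal (- g z) \<partial>(\<mu> \<omega> \<Otimes>\<^sub>M \<nu> \<omega>)) else 0) \<in> borel_measurable M"
    using nn[of "\<lambda>z. ennreal (norm (g z))"] nn[of "\<lambda>z. ennreal (g z)"] nn[of "\<lambda>z. ennreal (- g z)"] g by measurable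
  ultimately show ?thesis by simp
qed

lemma measurable_signed_pair_integral:
  fixes g :: "plane \<times> plane \<Rightarrow> real"
  assumes [measurable]: "F \<in> M \<rightarrow>\<^sub>M borel" "G \<in> M \<rightarrow>\<^sub>M borel" "H \<in> M \<rightarrow>\<^sub>M borel"
    and g: "g \<in> borel_measurable (borel \<Otimes>\<^sub>M borel)"
  shows "(\<lambda>\<omega>. signed_pair_integral (meas (F \<omega>)) (meas (G \<omega>)) (meas (H \<omega>)) lborel g) \<in> borel_measurable M"
    "(\<lambda>\<omega>. signed_pair_integral (meas (F \<omega>)) lborel (meas (H \<omega>)) lborel g) \<in> borel_measurable M"
  unfolding signed_pair_integral_def
  by (intro borel_measurable_add borel_measurable_diff
      integral_pair_measurable[OF nn_kernel_meas _ g, where \<nu>="\<lambda>\<omega>. meas (H \<omega>)"]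
      integral_pair_measurable[OF nn_kernel_meas _ g, where \<nu>="\<lambda>_. lborel"]
      integral_pair_measurable[OF nn_kernel_lborel _ g, where \<nu>="\<lambda>\<omega>. meas (H \<omega>)"]
      integral_pair_measurable[OF nn_kernel_lborel _ g, where \<nu>="\<lambda>_. lborel"]
      nn_kernel_meas nn_kernel_lborel; measurable)+

section \<open>The energies as integrals of fixed kernels\<close>

definition energy_kernel :: "plane set \<Rightarrow> plane \<times> plane \<Rightarrow> real" where
  "energy_kernel \<Lambda> = (\<lambda>(x, y). indicator {(x, y). x \<in> \<Lambda> \<and> y \<in> \<Lambda> \<and> x \<noteq> y} (x, y) * (- ln (dist x y)))"

definition move_kernel :: "plane set \<Rightarrow> (plane \<Rightarrow> real) \<Rightarrow> plane \<times> plane \<Rightarrow> real" where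
  "move_kernel \<Lambda> \<psi> = (\<lambda>(x, y). indicator (\<Lambda> \<times> - \<Lambda>) (x, y) * (- ln (dist x y)) * \<psi> y)"

lemma energy_alt: "energy \<Lambda> X = 1/2 * signed_pair_integral (meas X) lborel (meas X) lborel (energy_kernel \<Lambda>)"
  by (simp add: energy_def energy_kernel_def)

lemma move_alt: "move chi \<Lambda> X' X =
    lim (\<lambda>p. signed_pair_integral (meas X') (meas X) (meas X) lborel (move_kernel \<Lambda> (\<lambda>y. \<Sum>i\<le>p. chi i y)))"
  by (simp add: move_def move_kernel_def)

lemma measurable_energy_kernel [measurable]:
  assumes [measurable]: "\<Lambda> \<in> sets borel"
  shows "energy_kernel \<Lambda> \<in> borel_measurable (borel \<Otimes>\<^sub>M borel)"
proof -
  have "energy_kernel \<Lambda> = (\<lambda>z. (if fst z \<in> \<Lambda> \<and> snd z \<in> \<Lambda> \<and> fst z \<noteq> snd z then 1 else 0) * (- ln (dist (fst z) (snd z))))"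
    by (auto simp: energy_kernel_def indicator_def split_beta fun_eq_iff)
  then show ?thesis by simp
qed

lemma measurable_move_kernel [measurable]:
  assumes [measurable]: "\<Lambda> \<in> sets borel" "\<psi> \<in> borel_measurable borel"
  shows "move_kernel \<Lambda> \<psi> \<in> borel_measurable (borel \<Otimes>\<^sub>M borel)"
  unfolding move_kernel_def split_beta' by measurable

lemma measurable_energy:
  assumes "F \<in> M \<rightarrow>\<^sub>M borel" "\<Lambda> \<in> sets borel"
  shows "(\<lambda>\<omega>. energy \<Lambda> (F \<omega>)) \<in> borel_measurable M"
  unfolding energy_alt using assms
  by (intro borel_measurable_times borel_measurable_const measurable_signed_pair_integral[where H=F] measurable_energy_kernel)

lemma measurable_move:
  assumes "F \<in> M \<rightarrow>\<^sub>M borel" "G \<in> M \<rightarrow>\<^sub>M borel" "\<Lambda> \<in> sets borel" and [measurable]: "\<And>i. chi i \<in> borel_measurable borel"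
  shows "(\<lambda>\<omega>. move chi \<Lambda> (F \<omega>) (G \<omega>)) \<in> borel_measurable M"
  unfolding move_alt using assms(1-3)
  by (intro borel_measurable_lim_metric measurable_signed_pair_integral(1) measurable_move_kernel; measurable)

lemma meas_restr:
  assumes [measurable]: "A \<in> sets borel"
  shows "meas (restr X A) = density (meas X) (indicator A)"
proof (rule measure_eqI)
  fix B assume "B \<in> sets (meas (restr X A))"
  then have [measurable]: "B \<in> sets borel" by simp
  have "emeasure (meas (restr X A)) B = (\<integral>\<^sup>+x. indicator B x \<partial>meas (restr X A))" by simp
  also have "\<dots> = (\<integral>\<^sup>+x. indicator A x * indicator B x \<partial>meas X)"
    by (subst (1 2) nn_integral_meas) (auto intro!: nn_integral_cong simp: mult_restr indicator_def)
  also have "\<dots> = emeasure (density (meas X) (indicator A)) B"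
    by (subst emeasure_density) auto
  finally show "emeasure (meas (restr X A)) B = emeasure (density (meas X) (indicator A)) B" .
qed simp

lemma integral_pair_restrict:
  fixes g :: "plane \<times> plane \<Rightarrow> real"
  assumes [measurable]: "A \<in> sets borel" "B \<in> sets borel" "g \<in> borel_measurable (borel \<Otimes>\<^sub>M borel)"
    and [measurable_cong]: "sets \<mu> = sets borel" "sets \<nu> = sets borel"
    and fin: "sigma_finite_measure \<mu>" "sigma_finite_measure \<nu>"
    and g: "\<And>x y. x \<notin> A \<or> y \<notin> B \<Longrightarrow> g (x, y) = 0"
  shows "(LINT z|(\<mu> \<Otimes>\<^sub>M \<nu>). g z) = (LINT z|(density \<mu> (indicator A) \<Otimes>\<^sub>M density \<nu> (indicator B)). g z)"
proof -
  have sfB: "sigma_finite_measure (density \<nu> (indicator B))"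
    by (subst sigma_finite_measure.sigma_finite_iff_density_finite[OF fin(2)]) (auto simp: indicator_def)
  have "density \<mu> (indicator A) \<Otimes>\<^sub>M density \<nu> (indicator B) = density (\<mu> \<Otimes>\<^sub>M \<nu>) (\<lambda>(x, y). indicator A x * indicator B y)"
    by (rule pair_measure_density) (use fin sfB in auto)
  also have "(\<lambda>(x, y). indicator A x * indicator B y) = (\<lambda>z. ennreal (indicator (A \<times> B) z))"
    by (auto simp: indicator_def fun_eq_iff)
  also have "(LINT z|density (\<mu> \<Otimes>\<^sub>M \<nu>) (\<lambda>z. ennreal (indicator (A \<times> B) z)). g z) = (LINT z|(\<mu> \<Otimes>\<^sub>M \<nu>). indicator (A \<times> B) z *\<^sub>R g z)"
    by (rule integral_density) auto
  also have "\<dots> = (LINT z|(\<mu> \<Otimes>\<^sub>M \<nu>). g z)"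
    by (intro Bochner_Integration.integral_cong) (use g in \<open>auto simp: indicator_def\<close>)
  finally show ?thesis by simp
qed

lemma energy_restr:
  assumes [measurable]: "\<Lambda> \<in> sets borel"
  shows "energy \<Lambda> X = energy \<Lambda> (restr X \<Lambda>)"
proof -
  let ?L = "density lborel (indicator \<Lambda>)"
  have "signed_pair_integral (meas X) lborel (meas X) lborel (energy_kernel \<Lambda>)
    = signed_pair_integral (meas (restr X \<Lambda>)) ?L (meas (restr X \<Lambda>)) ?L (energy_kernel \<Lambda>)" for X
    unfolding signed_pair_integral_def meas_restr[OF assms]
    by (intro arg_cong2[where f="(+)"] arg_cong2[where f="(-)"] integral_pair_restrict)
      (auto simp: energy_kernel_def sigma_finite_lborel)
  note * = this
  have "restr (restr X \<Lambda>) \<Lambda> = restr X \<Lambda>" by (auto intro!: conf_eqI simp: mult_restr)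
  then show ?thesis unfolding energy_alt using *[of X] *[of "restr X \<Lambda>"] by simp
qed

lemma energy_cong:
  assumes "\<Lambda> \<in> sets borel" "\<And>x. x \<in> \<Lambda> \<Longrightarrow> mult X x = mult Y x"
  shows "energy \<Lambda> X = energy \<Lambda> Y"
proof -
  have "restr X \<Lambda> = restr Y \<Lambda>" using assms(2) by (simp add: restr_eq_iff)
  then show ?thesis using energy_restr[OF assms(1)] by metis
qed

lemma lborel_translation: "distr lborel lborel (\<lambda>x. x + v) = (lborel :: plane measure)"
proof -
  have "distr lborel lborel (\<lambda>x. x + v) = distr lborel borel ((+) v)"
    by (rule distr_cong) (auto simp: add.commute)
  then show ?thesis by (simp add: lborel_distr_plus)
qed

lemma energy_translation:
  assumes [measurable]: "\<Lambda> \<in> sets borel"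
  shows "energy ((\<lambda>x. x + v) ` \<Lambda>) (push (\<lambda>x. x + v) X) = energy \<Lambda> X"
proof -
  let ?T = "\<lambda>x::plane. x + v"
  have im[measurable]: "?T ` \<Lambda> \<in> sets borel"
    unfolding tame_bijD(7)[OF tame_bij_translation]
    using measurable_sets[OF tame_bijD(4)[OF tame_bij_translation[of v]] assms] by simp
  have l: "lborel = distr lborel borel ?T"
    using lborel_translation[of v] by (metis distr_cong sets_lborel)
  have "(LINT z|(distr \<mu> borel ?T \<Otimes>\<^sub>M distr \<nu> borel ?T). energy_kernel (?T ` \<Lambda>) z) = (LINT z|(\<mu> \<Otimes>\<^sub>M \<nu>). energy_kernel \<Lambda> z)"
    if [measurable_cong]: "sets \<mu> = sets borel" "sets \<nu> = sets borel" and sf: "sigma_finite_measure (distr \<nu> borel ?T)" for \<mu> \<nu>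
  proof -
    have "distr \<mu> borel ?T \<Otimes>\<^sub>M distr \<nu> borel ?T = distr (\<mu> \<Otimes>\<^sub>M \<nu>) (borel \<Otimes>\<^sub>M borel) (\<lambda>(x, y). (?T x, ?T y))"
      by (rule pair_measure_distr[OF _ _ sf]) measurable
    then have "(LINT z|(distr \<mu> borel ?T \<Otimes>\<^sub>M distr \<nu> borel ?T). energy_kernel (?T ` \<Lambda>) z)
       = (LINT z|(\<mu> \<Otimes>\<^sub>M \<nu>). energy_kernel (?T ` \<Lambda>) (case z of (x, y) \<Rightarrow> (?T x, ?T y)))"
      by (simp add: integral_distr)
    also have "\<dots> = (LINT z|(\<mu> \<Otimes>\<^sub>M \<nu>). energy_kernel \<Lambda> z)"
      by (intro Bochner_Integration.integral_cong) (auto simp: energy_kernel_def indicator_def dist_norm)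
    finally show ?thesis .
  qed
  note * = this[of lborel, folded l] this[of "meas X", folded meas_push[OF tame_bij_translation]]
  show ?thesis unfolding energy_alt signed_pair_integral_def
    using *(1)[of lborel, folded l] *(1)[of "meas X", folded meas_push[OF tame_bij_translation]]
      *(2)[of lborel, folded l] *(2)[of "meas X", folded meas_push[OF tame_bij_translation]]
    by (simp add: sigma_finite_lborel)
qed

section \<open>The exterior potential\<close>

text \<open>A layer-cake bound: \<lfloor>-ln r\<rfloor> + 1 counts the n with r \<le> exp(-n). It
  dominates the integral of the logarithm near its singularity by a series of areas of disks of
  radius exp(-n).\<close>

lemma neg_ln_le_count:
  assumes "0 < r" "r \<le> 1"
  shows "ennreal (- ln r) \<le> (\<Sum>n. indicator {..exp (- real n)} r)"
proof -
  define N where "N = nat \<lfloor>- ln r\<rfloor>"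
  have N: "real N \<le> - ln r" "- ln r \<le> real N + 1"
    using assms by (auto simp: N_def)
  have ind: "r \<le> exp (- real n)" if "n \<le> N" for n
  proof -
    have "ln r \<le> - real n" using that N(1) by linarith
    then show ?thesis using assms(1) by (metis exp_le_cancel_iff exp_ln)
  qed
  have "ennreal (- ln r) \<le> ennreal (real (Suc N))" using N by (intro ennreal_leI) auto
  also have "\<dots> = of_nat (Suc N)" by (simp only: ennreal_of_nat_eq_real_of_nat)
  also have "\<dots> = (\<Sum>n<Suc N. 1)" by (simp del: of_nat_Suc)
  also have "\<dots> = (\<Sum>n<Suc N. indicator {..exp (- real n)} r)"
    using ind by (intro sum.cong) auto
  also have "\<dots> \<le> (\<Sum>n. indicator {..exp (- real n)} r)" by (rule sum_le_suminf) auto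
  finally show ?thesis .
qed

lemma integrable_log_unit: "integrable lborel (\<lambda>y :: plane. indicator (cball x 1) y * ln (dist x y))"
proof (rule integrableI_bounded)
  show "(\<lambda>y :: plane. indicator (cball x 1) y * ln (dist x y)) \<in> borel_measurable lborel"
  proof -
    have [measurable]: "cball x 1 \<in> sets borel" by simp
    have "(\<lambda>y :: plane. indicator (cball x 1) y * ln (dist x y)) \<in> borel_measurable borel" by measurable
    then show ?thesis by simp
  qed
  have "(\<integral>\<^sup>+y. ennreal (norm (indicator (cball x 1) y * ln (dist x y))) \<partial>lborel)
     \<le> (\<integral>\<^sup>+y. (\<Sum>n. indicator (cball x (exp (- real n))) y) \<partial>lborel)"
  proof (rule nn_integral_mono)
    fix y :: plane
    show "ennreal (norm (indicator (cball x 1) y * ln (dist x y))) \<le> (\<Sum>n. indicator (cball x (exp (- real n))) y)"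
    proof (cases "0 < dist x y \<and> dist x y \<le> 1")
      case True
      have "ennreal (norm (indicator (cball x 1) y * ln (dist x y))) = ennreal (- ln (dist x y))"
        using True by (simp add: indicator_def)
      also have "\<dots> \<le> (\<Sum>n. indicator {..exp (- real n)} (dist x y))" using True by (intro neg_ln_le_count) auto
      also have "\<dots> = (\<Sum>n. indicator (cball x (exp (- real n))) y)" by (simp add: indicator_def)
      finally show ?thesis .
    next
      case False
      then have "indicator (cball x 1) y * ln (dist x y) = 0" by (cases "x = y") (auto simp: indicator_def)
      then show ?thesis by (simp only: norm_zero ennreal_0 zero_le)
    qed
  qed
  also have "\<dots> = (\<Sum>n. emeasure lborel (cball x (exp (- real n))))"
    by (subst nn_integral_suminf) (auto simp del: mem_cball)
  also have "\<dots> = (\<Sum>n. ennreal (unit_ball_vol 2 * exp (-2) ^ n))"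
    by (simp add: emeasure_cball power2_eq_square exp_of_nat_mult[symmetric] exp_add[symmetric] mult.commute)
  also have "\<dots> < \<infinity>"
    by (subst suminf_ennreal2) (auto intro!: summable_mult summable_geometric simp: ennreal_less_top)
  finally show "(\<integral>\<^sup>+y. ennreal (norm (indicator (cball x 1) y * ln (dist x y))) \<partial>lborel) < \<infinity>" .
qed

lemma integrable_log:
  fixes g :: "plane \<Rightarrow> real"
  assumes [measurable]: "g \<in> borel_measurable borel"
    and B: "\<And>y. \<bar>g y\<bar> \<le> B" and S: "bounded S" "\<And>y. y \<notin> S \<Longrightarrow> g y = 0"
  shows "integrable lborel (\<lambda>y. - ln (dist x y) * g y)"
proof -
  obtain R0 where R0: "\<And>y. y \<in> S \<Longrightarrow> dist x y \<le> R0" using S(1) bounded_any_center[of S x] by auto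
  \<comment> \<open>At least 1, so that \<open>ln R\<close> is nonnegative and bounds the logarithm
    on the part of the support outside the unit disk.\<close>
  define R where "R = max R0 1"
  have "B \<ge> 0" using B[of 0] by linarith
  have "integrable lborel (\<lambda>y :: plane. indicator (cball x R) y *\<^sub>R ln R)"
    by (rule integrable_indicator) (auto simp: emeasure_cball R_def ennreal_less_top)
  then have int: "integrable lborel (\<lambda>y :: plane. B * (\<bar>indicator (cball x 1) y * ln (dist x y)\<bar> + indicator (cball x R) y * ln R))"
    by (intro integrable_mult_right Bochner_Integration.integrable_add integrable_abs integrable_log_unit) simp
  show ?thesis
  proof (rule Bochner_Integration.integrable_bound[OF int])
    show "AE y in lborel. norm (- ln (dist x y) * g y) \<le> norm (B * (\<bar>indicator (cball x 1) y * ln (dist x y)\<bar> + indicator (cball x R) y * ln R))"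
    proof (rule AE_I2)
      fix y :: plane
      have "\<bar>ln (dist x y)\<bar> * \<bar>g y\<bar> \<le> (\<bar>indicator (cball x 1) y * ln (dist x y)\<bar> + indicator (cball x R) y * ln R) * B"
      proof (cases "y \<in> S")
        case True
        have "\<bar>ln (dist x y)\<bar> \<le> \<bar>indicator (cball x 1) y * ln (dist x y)\<bar> + indicator (cball x R) y * ln R"
        proof (cases "dist x y \<le> 1")
          case True
          then show ?thesis by (simp add: indicator_def R_def)
        next
          case False
          have "dist x y \<le> R" "0 < dist x y" using False R0[OF True] by (auto simp: R_def)
          then have "ln (dist x y) \<le> ln R" using ln_le_cancel_iff[of "dist x y" R] by linarith
          moreover have "0 \<le> ln (dist x y)" using False by simp
          ultimately show ?thesis using R0[OF True] False by (simp add: indicator_def R_def)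
        qed
        then show ?thesis using B[of y] by (intro mult_mono) auto
      next
        case False
        then show ?thesis using S(2)[of y] \<open>B \<ge> 0\<close> by (simp add: R_def indicator_def)
      qed
      then show "norm (- ln (dist x y) * g y) \<le> norm (B * (\<bar>indicator (cball x 1) y * ln (dist x y)\<bar> + indicator (cball x R) y * ln R))"
        unfolding real_norm_def abs_mult abs_minus_cancel
        by (intro order_trans[OF _ abs_ge_self[of "B * _", unfolded abs_mult]]) (simp add: mult.commute)
    qed
  qed measurable
qed

section \<open>Cut-off potentials, and the moving energy as a finite sum of their values\<close>

definition conf_sum :: "conf \<Rightarrow> plane set \<Rightarrow> (plane \<Rightarrow> real) \<Rightarrow> real" where
  "conf_sum Z \<Lambda> G = (\<Sum>x | x \<in> \<Lambda> \<and> mult Z x \<noteq> 0. real (mult Z x) * G x)"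

text \<open>The potential created inside \<open>\<Lambda>\<close> by the exterior charges, cut off by \<open>\<psi>\<close>.\<close>

definition ext_pot :: "conf \<Rightarrow> plane set \<Rightarrow> (plane \<Rightarrow> real) \<Rightarrow> plane \<Rightarrow> real" where
  "ext_pot X \<Lambda> \<psi> x = Fluct (\<lambda>y. - ln (dist x y) * (indicator (- \<Lambda>) y * \<psi> y)) X"

text \<open>Measurability instead of continuity, since the class has to be stable under
  multiplication by the indicator of the exterior of \<open>\<Lambda>\<close>.\<close>

definition cutoff :: "(plane \<Rightarrow> real) \<Rightarrow> bool" where
  "cutoff \<psi> \<longleftrightarrow> \<psi> \<in> borel_measurable borel \<and> (\<exists>B. \<forall>y. \<bar>\<psi> y\<bar> \<le> B) \<and> (\<exists>S. bounded S \<and> (\<forall>y. y \<notin> S \<longrightarrow> \<psi> y = 0))"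

lemma cutoff_integrable:
  assumes "cutoff \<psi>"
  shows "integrable lborel (\<lambda>y. - ln (dist x y) * \<psi> y)" "integrable (meas X) (\<lambda>y. - ln (dist x y) * \<psi> y)"
    "integrable lborel \<psi>" "integrable (meas X) \<psi>"
proof -
  obtain B S where [measurable]: "\<psi> \<in> borel_measurable borel" and B: "\<And>y. \<bar>\<psi> y\<bar> \<le> B"
    and S: "bounded S" "\<And>y. y \<notin> S \<Longrightarrow> \<psi> y = 0" using assms unfolding cutoff_def by auto
  show "integrable lborel (\<lambda>y. - ln (dist x y) * \<psi> y)" using B S by (intro integrable_log) auto
  show "integrable (meas X) (\<lambda>y. - ln (dist x y) * \<psi> y)" "integrable (meas X) \<psi>"
    using S by (auto intro!: integrable_meas[where S=S])
  obtain r where r: "S \<subseteq> cball 0 r" using S(1) by (metis bounded_subset_cball bounded_any_center[of _ 0] mem_cball subsetI)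
  have int: "integrable lborel (\<lambda>y::plane. indicator (cball 0 (max r 0)) y *\<^sub>R B)"
    by (rule integrable_indicator) (auto simp: emeasure_cball ennreal_less_top)
  have "\<bar>\<psi> y\<bar> \<le> \<bar>indicator (cball 0 (max r 0)) y *\<^sub>R B\<bar>" for y
  proof (cases "y \<in> S")
    case True
    then have "norm y \<le> max r 0" using r by auto
    then show ?thesis using B[of y] by (simp add: indicator_def)
  qed (simp add: S)
  then show "integrable lborel \<psi>"
    by (intro Bochner_Integration.integrable_bound[OF int]) auto
qed

lemma cutoff_restrict:
  assumes "cutoff \<psi>" and [measurable]: "A \<in> sets borel"
  shows "cutoff (\<lambda>y. indicator A y * \<psi> y)"
proof -
  obtain B S where [measurable]: "\<psi> \<in> borel_measurable borel" and B: "\<And>y. \<bar>\<psi> y\<bar> \<le> B"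
    and S: "bounded S" "\<And>y. y \<notin> S \<Longrightarrow> \<psi> y = 0" using assms unfolding cutoff_def by auto
  have "\<bar>indicator A y * \<psi> y\<bar> \<le> B" for y using B[of y] by (auto simp: indicator_def)
  then show ?thesis unfolding cutoff_def using S by (intro conjI exI[of _ B] exI[of _ S]) auto
qed

lemma cutoff_continuous:
  fixes \<psi> :: "plane \<Rightarrow> real"
  assumes "continuous_on UNIV \<psi>" "\<And>y. y \<notin> cball a r \<Longrightarrow> \<psi> y = 0"
  shows "cutoff \<psi>"
proof -
  have "compact (\<psi> ` cball a r)" by (intro compact_continuous_image continuous_on_subset[OF assms(1)]) auto
  then obtain B where B: "\<And>y. y \<in> cball a r \<Longrightarrow> \<bar>\<psi> y\<bar> \<le> B"
    using compact_imp_bounded[OF \<open>compact (\<psi> ` cball a r)\<close>] unfolding bounded_iff by (metis image_eqI real_norm_def)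
  have "\<bar>\<psi> y\<bar> \<le> max B 0" for y using B[of y] assms(2)[of y] by (cases "y \<in> cball a r") auto
  then show ?thesis unfolding cutoff_def
    using assms by (intro conjI exI[of _ "max B 0"] exI[of _ "cball a r"]) (auto intro: borel_measurable_continuous_onI)
qed

lemma ext_pot_diff:
  assumes "cutoff \<psi>" "cutoff \<psi>'" "\<Lambda> \<in> sets borel"
  shows "ext_pot X \<Lambda> (\<lambda>y. \<psi> y - \<psi>' y) x = ext_pot X \<Lambda> \<psi> x - ext_pot X \<Lambda> \<psi>' x"
proof -
  have m: "- \<Lambda> \<in> sets borel" using assms(3) by auto
  note c = cutoff_integrable(1,2)[OF cutoff_restrict[of _ "- \<Lambda>"]]
  have eq: "- ln (dist x y) * (indicator (- \<Lambda>) y * (\<psi> y - \<psi>' y)) = - ln (dist x y) * (indicator (- \<Lambda>) y * \<psi> y) - - ln (dist x y) * (indicator (- \<Lambda>) y * \<psi>' y)" for y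
    by (simp add: algebra_simps)
  show ?thesis unfolding ext_pot_def Fluct_def eq
    by (subst (1 2) Bochner_Integration.integral_diff; (intro c assms m)?; simp?)
qed

lemma ext_pot_cong:
  assumes "cutoff \<psi>" "\<Lambda> \<in> sets borel" "\<And>y. y \<notin> \<Lambda> \<Longrightarrow> mult X y = mult X' y"
  shows "ext_pot X \<Lambda> \<psi> x = ext_pot X' \<Lambda> \<psi> x"
proof -
  have [measurable]: "- \<Lambda> \<in> sets borel" using assms(2) by auto
  obtain S where [measurable]: "\<psi> \<in> borel_measurable borel"
    and S: "bounded S" "\<And>y. y \<notin> S \<Longrightarrow> \<psi> y = 0" using assms unfolding cutoff_def by auto
  have "(LINT y|meas X. - ln (dist x y) * (indicator (- \<Lambda>) y * \<psi> y)) = (\<Sum>y | y \<in> S - \<Lambda> \<and> mult X y \<noteq> 0. real (mult X y) * (- ln (dist x y) * (indicator (- \<Lambda>) y * \<psi> y)))" for X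
    by (rule integral_meas) (use S in \<open>auto simp: bounded_diff\<close>)
  moreover have "{y. y \<in> S - \<Lambda> \<and> mult X y \<noteq> 0} = {y. y \<in> S - \<Lambda> \<and> mult X' y \<noteq> 0}" using assms(3) by auto
  moreover have "(\<Sum>y | y \<in> S - \<Lambda> \<and> mult X' y \<noteq> 0. real (mult X y) * (- ln (dist x y) * (indicator (- \<Lambda>) y * \<psi> y)))
     = (\<Sum>y | y \<in> S - \<Lambda> \<and> mult X' y \<noteq> 0. real (mult X' y) * (- ln (dist x y) * (indicator (- \<Lambda>) y * \<psi> y)))"
    using assms(3) by (intro sum.cong) auto
  ultimately show ?thesis unfolding ext_pot_def Fluct_def by simp
qed

lemma conf_sum_diff: "conf_sum Z \<Lambda> (\<lambda>x. F x - G x) = conf_sum Z \<Lambda> F - conf_sum Z \<Lambda> G"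
  by (simp add: conf_sum_def sum_subtractf right_diff_distrib)

lemma conf_sum_const: "conf_sum Z \<Lambda> (\<lambda>x. c) = real (Pts Z \<Lambda>) * c"
  by (simp add: conf_sum_def Pts_def sum_distrib_right)

lemma conf_sum_cong_conf: "(\<And>x. x \<in> \<Lambda> \<Longrightarrow> mult Z x = mult W x) \<Longrightarrow> conf_sum Z \<Lambda> F = conf_sum W \<Lambda> F"
  unfolding conf_sum_def by (intro sum.cong) auto

lemma tendsto_conf_sum:
  assumes "\<And>x. x \<in> \<Lambda> \<Longrightarrow> (\<lambda>p. F p x) \<longlonglongrightarrow> G x"
  shows "(\<lambda>p. conf_sum Z \<Lambda> (F p)) \<longlonglongrightarrow> conf_sum Z \<Lambda> G"
  unfolding conf_sum_def using assms by (intro tendsto_sum tendsto_mult tendsto_const) auto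

lemma conf_sum_push:
  assumes T: "tame_bij T T'"
  shows "conf_sum (push T Z) (T ` \<Lambda>) G = conf_sum Z \<Lambda> (\<lambda>x. G (T x))"
  unfolding conf_sum_def mult_push[OF T]
  by (rule sum.reindex_bij_witness[of _ T T']) (auto simp: tame_bijD(1,2)[OF T])

lemma integral_move_kernel:
  assumes [measurable]: "\<Lambda> \<in> sets borel" and "bounded \<Lambda>" and \<psi>: "cutoff \<psi>"
    and [measurable_cong]: "sets \<nu> = sets borel" and sf: "sigma_finite_measure \<nu>"
    and int: "\<And>x. integrable \<nu> (\<lambda>y. - ln (dist x y) * (indicator (- \<Lambda>) y * \<psi> y))"
  shows "(LINT z|(meas Z \<Otimes>\<^sub>M \<nu>). move_kernel \<Lambda> \<psi> z)
    = conf_sum Z \<Lambda> (\<lambda>x. LINT y|\<nu>. - ln (dist x y) * (indicator (- \<Lambda>) y * \<psi> y))"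
proof -
  interpret sigma_finite_measure \<nu> by fact
  interpret P: pair_sigma_finite "meas Z" \<nu> by (simp add: pair_sigma_finite_def sf)
  have [measurable]: "\<psi> \<in> borel_measurable borel" using \<psi> by (auto simp: cutoff_def)
  have k: "move_kernel \<Lambda> \<psi> (x, y) = indicator \<Lambda> x * (- ln (dist x y) * (indicator (- \<Lambda>) y * \<psi> y))" for x y
    by (auto simp: move_kernel_def indicator_def)
  have m[measurable]: "move_kernel \<Lambda> \<psi> \<in> borel_measurable (meas Z \<Otimes>\<^sub>M \<nu>)" by measurable
  have "integrable (meas Z \<Otimes>\<^sub>M \<nu>) (move_kernel \<Lambda> \<psi>)"
  proof (rule P.Fubini_integrable[OF m])
    show "integrable (meas Z) (\<lambda>x. LINT y|\<nu>. norm (move_kernel \<Lambda> \<psi> (x, y)))"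
      by (rule integrable_meas[OF _ assms(2)]) (simp_all add: k)
    show "AE x in meas Z. integrable \<nu> (\<lambda>y. move_kernel \<Lambda> \<psi> (x, y))"
      using int by (simp add: k)
  qed
  then have "(LINT z|(meas Z \<Otimes>\<^sub>M \<nu>). move_kernel \<Lambda> \<psi> z) = (LINT x|meas Z. LINT y|\<nu>. move_kernel \<Lambda> \<psi> (x, y))"
    by (rule P.integral_fst'[symmetric])
  also have "\<dots> = (\<Sum>x | x \<in> \<Lambda> \<and> mult Z x \<noteq> 0. real (mult Z x) * (LINT y|\<nu>. move_kernel \<Lambda> \<psi> (x, y)))"
    by (rule integral_meas[OF _ assms(2)]) (simp_all add: k)
  also have "\<dots> = conf_sum Z \<Lambda> (\<lambda>x. LINT y|\<nu>. - ln (dist x y) * (indicator (- \<Lambda>) y * \<psi> y))"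
    unfolding conf_sum_def by (intro sum.cong) (auto simp: k)
  finally show ?thesis .
qed

text \<open>Fubini turns the double integral into finitely many values of one potential. If
  \<open>Z\<close> and \<open>W\<close> have equally many points in \<open>\<Lambda>\<close>,
  constants added to the potential cancel, which later allows subtracting its value at the
  origin.\<close>

lemma signed_pair_integral_move_kernel:
  assumes [measurable]: "\<Lambda> \<in> sets borel" and "bounded \<Lambda>" and \<psi>: "cutoff \<psi>"
  shows "signed_pair_integral (meas Z) (meas W) (meas W) lborel (move_kernel \<Lambda> \<psi>)
    = conf_sum Z \<Lambda> (ext_pot W \<Lambda> \<psi>) - conf_sum W \<Lambda> (ext_pot W \<Lambda> \<psi>)"
proof -
  have m: "- \<Lambda> \<in> sets borel" by auto
  note i = cutoff_integrable(1,2)[OF cutoff_restrict[OF \<psi> m]]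
  have *: "(LINT z|(meas Z \<Otimes>\<^sub>M meas W). move_kernel \<Lambda> \<psi> z) = conf_sum Z \<Lambda> (\<lambda>x. LINT y|meas W. - ln (dist x y) * (indicator (- \<Lambda>) y * \<psi> y))"
    "(LINT z|(meas Z \<Otimes>\<^sub>M lborel). move_kernel \<Lambda> \<psi> z) = conf_sum Z \<Lambda> (\<lambda>x. LINT y|lborel. - ln (dist x y) * (indicator (- \<Lambda>) y * \<psi> y))" for Z
    by (rule integral_move_kernel; use assms i sigma_finite_lborel in auto)+
  show ?thesis
    unfolding signed_pair_integral_def * ext_pot_def[abs_def] Fluct_def conf_sum_diff by simp
qed

lemma move_conf_sum:
  assumes "\<Lambda> \<in> sets borel" "bounded \<Lambda>" "\<And>p. cutoff (\<lambda>y. \<Sum>i\<le>p. chi i y)"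
  shows "move chi \<Lambda> Z W = lim (\<lambda>p. conf_sum Z \<Lambda> (ext_pot W \<Lambda> (\<lambda>y. \<Sum>i\<le>p. chi i y)) - conf_sum W \<Lambda> (ext_pot W \<Lambda> (\<lambda>y. \<Sum>i\<le>p. chi i y)))"
  unfolding move_alt using signed_pair_integral_move_kernel[OF assms(1,2) assms(3)] by simp

text \<open>Kernel and Lebesgue measure are translation invariant but the cutoff is not. The
  difference between \<open>\<psi> (y + v)\<close> and \<open>\<psi> y\<close> is the only
  obstruction to covariance of the moving energy.\<close>

lemma ext_pot_translation:
  assumes [measurable]: "\<Lambda> \<in> sets borel" "\<psi> \<in> borel_measurable borel"
  shows "ext_pot (push (\<lambda>x. x + v) X) ((\<lambda>x. x + v) ` \<Lambda>) \<psi> (x + v) = ext_pot X \<Lambda> (\<lambda>y. \<psi> (y + v)) x"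
proof -
  let ?T = "\<lambda>x::plane. x + v"
  have [measurable]: "?T ` \<Lambda> \<in> sets borel"
    unfolding tame_bijD(7)[OF tame_bij_translation]
    using measurable_sets[OF tame_bijD(4)[OF tame_bij_translation[of v]] assms(1)] by simp
  have l: "lborel = distr lborel borel ?T"
    using lborel_translation[of v] by (metis distr_cong sets_lborel)
  let ?k = "\<lambda>y. - ln (dist (x + v) y) * (indicator (- (?T ` \<Lambda>)) y * \<psi> y)"
  have k: "?k (y + v) = - ln (dist x y) * (indicator (- \<Lambda>) y * \<psi> (y + v))" for y
    by (auto simp: indicator_def)
  have "(LINT y|meas (push ?T X). ?k y) = (LINT y|meas X. ?k (y + v))"
    unfolding meas_push[OF tame_bij_translation] by (rule integral_distr) auto
  moreover have "(LINT y|lborel. ?k y) = (LINT y|lborel. ?k (y + v))"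
    by (subst l, rule integral_distr) auto
  ultimately show ?thesis unfolding ext_pot_def Fluct_def k by simp
qed

text \<open>The added term \<open>ln (norm y)\<close> does not involve \<open>x\<close>, so it
  cancels in the difference, and it replaces the logarithm by -ln |1 - x/y|, which decays as y grows
  and has a Laurent expansion.\<close>

lemma ext_pot_far:
  assumes \<eta>: "cutoff \<eta>" "\<And>y. norm y \<le> R \<Longrightarrow> \<eta> y = 0" and \<Lambda>: "\<Lambda> \<subseteq> cball 0 R"
  shows "ext_pot X \<Lambda> \<eta> x - ext_pot X \<Lambda> \<eta> x0
    = Fluct (\<lambda>y. (ln (norm y) - ln (dist x y)) * \<eta> y) X - Fluct (\<lambda>y. (ln (norm y) - ln (dist x0 y)) * \<eta> y) X"
proof -
  have ind: "indicator (- \<Lambda>) y * \<eta> y = \<eta> y" for y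
    using \<eta>(2)[of y] \<Lambda> by (cases "y \<in> \<Lambda>") (auto simp: indicator_def)
  have "Fluct (\<lambda>y. (ln (norm y) - ln (dist x y)) * \<eta> y) X
     = Fluct (\<lambda>y. - ln (dist x y) * \<eta> y) X - Fluct (\<lambda>y. - ln (dist 0 y) * \<eta> y) X" for x
  proof -
    have eq: "(ln (norm y) - ln (dist x y)) * \<eta> y = - ln (dist x y) * \<eta> y - - ln (dist 0 y) * \<eta> y" for y
      by (simp add: algebra_simps)
    show ?thesis unfolding Fluct_def eq
      by (subst (1 2) Bochner_Integration.integral_diff; (intro cutoff_integrable(1,2)[OF \<eta>(1)])?; simp?)
  qed
  then show ?thesis unfolding ext_pot_def ind by simp
qed

section \<open>Quantitatively smooth functions\<close>

text \<open>\<open>smooth_upto n U f c \<rho>\<close>: on \<open>U\<close> the function \<open>f\<close> is of class \<open>C\<^sup>n\<close> and its derivatives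
  of order \<open>j \<le> n\<close> have norm at most \<open>c * \<rho> ^ j\<close>.\<close>

primrec smooth_upto :: "nat \<Rightarrow> plane set \<Rightarrow> (plane \<Rightarrow> real) \<Rightarrow> real \<Rightarrow> real \<Rightarrow> bool" where
  "smooth_upto 0 U f c \<rho> \<longleftrightarrow> continuous_on U f \<and> (\<forall>x\<in>U. \<bar>f x\<bar> \<le> c)"
| "smooth_upto (Suc n) U f c \<rho> \<longleftrightarrow> (\<forall>x\<in>U. f differentiable (at x)) \<and> (\<forall>x\<in>U. \<bar>f x\<bar> \<le> c) \<and>
     (\<forall>w. norm w \<le> 1 \<longrightarrow> smooth_upto n U (\<lambda>x. frechet_derivative f (at x) w) (c * \<rho>) \<rho>)"

lemma smooth_upto_bound: "smooth_upto n U f c \<rho> \<Longrightarrow> x \<in> U \<Longrightarrow> \<bar>f x\<bar> \<le> c"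
  by (cases n) auto

lemma smooth_upto_continuous: "smooth_upto n U f c \<rho> \<Longrightarrow> continuous_on U f"
  by (cases n) (auto intro!: continuous_at_imp_continuous_on differentiable_imp_continuous_within)

lemma smooth_upto_cong:
  assumes "open U" "smooth_upto n U f c \<rho>" "\<And>x. x \<in> U \<Longrightarrow> f x = g x"
  shows "smooth_upto n U g c \<rho>"
  using assms(2,3)
proof (induction n arbitrary: f g c)
  case 0
  then show ?case using continuous_on_cong[of U U f g] by auto
next
  case (Suc n)
  have fr: "frechet_derivative f (at x) = frechet_derivative g (at x)" if "x \<in> U" for x
    using Suc.prems that by (intro frechet_derivative_transform_within_open[OF _ assms(1)]) auto
  have "g differentiable (at x)" if "x \<in> U" for x
    using Suc.prems that assms(1) has_derivative_transform_within_open[of f _ x UNIV U g]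
    unfolding differentiable_def smooth_upto.simps by metis
  moreover have "smooth_upto n U (\<lambda>x. frechet_derivative g (at x) w) (c * \<rho>) \<rho>" if "norm w \<le> 1" for w
    by (rule Suc.IH[of "\<lambda>x. frechet_derivative f (at x) w"]) (use Suc.prems that fr in auto)
  ultimately show ?case using Suc.prems by auto
qed

lemma smooth_upto_mono:
  assumes "smooth_upto n U f c \<rho>" "c \<le> c'" "0 \<le> c" "0 \<le> \<rho>" "\<rho> \<le> \<rho>'" "V \<subseteq> U"
  shows "smooth_upto n V f c' \<rho>'"
  using assms(1,2,3)
proof (induction n arbitrary: f c c')
  case 0
  then show ?case using assms(6) by (auto intro: continuous_on_subset) (meson order_trans subsetD)
next
  case (Suc n)
  have "c * \<rho> \<le> c' * \<rho>'" using Suc.prems assms by (intro mult_mono) auto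
  moreover have "0 \<le> c * \<rho>" using Suc.prems assms by auto
  ultimately show ?case using Suc.prems Suc.IH[of _ "c * \<rho>" "c' * \<rho>'"] assms(6)
    by (auto intro: order_trans)
qed

text \<open>Used to glue the estimate away from a singularity to the trivial one on an open set
  where the function is constant or zero.\<close>

lemma smooth_upto_Un:
  assumes "open U" "open V" "smooth_upto n U f c \<rho>" "smooth_upto n V f c \<rho>"
  shows "smooth_upto n (U \<union> V) f c \<rho>"
  using assms(3,4)
  by (induction n arbitrary: f c) (use assms(1,2) in \<open>auto intro: continuous_on_open_Un\<close>)

lemma smooth_upto_zero: "0 \<le> c \<Longrightarrow> 0 \<le> \<rho> \<Longrightarrow> smooth_upto n U (\<lambda>x. 0) c \<rho>"
  by (induction n arbitrary: c) (auto simp: frechet_derivative_const)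

lemma smooth_upto_add:
  assumes "open U" "smooth_upto n U f c \<rho>" "smooth_upto n U g d \<rho>"
  shows "smooth_upto n U (\<lambda>x. f x + g x) (c + d) \<rho>"
  using assms(2,3)
proof (induction n arbitrary: f g c d)
  case 0
  then show ?case by (auto intro!: continuous_intros) (smt (verit))
next
  case (Suc n)
  have fr: "((\<lambda>x. f x + g x) has_derivative (\<lambda>h. frechet_derivative f (at x) h + frechet_derivative g (at x) h)) (at x)"
    if "x \<in> U" for x
    using Suc.prems that by (intro has_derivative_add) (auto simp: frechet_derivative_works[symmetric])
  have "smooth_upto n U (\<lambda>x. frechet_derivative (\<lambda>x. f x + g x) (at x) w) ((c + d) * \<rho>) \<rho>" if "norm w \<le> 1" for w
  proof (rule smooth_upto_cong[OF assms(1)])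
    show "smooth_upto n U (\<lambda>x. frechet_derivative f (at x) w + frechet_derivative g (at x) w) ((c + d) * \<rho>) \<rho>"
      unfolding distrib_right using Suc.prems that by (intro Suc.IH) auto
  qed (use frechet_derivative_at[OF fr, symmetric] in simp)
  moreover have "(\<lambda>x. f x + g x) differentiable (at x)" if "x \<in> U" for x
    using fr[OF that] differentiable_def by blast
  moreover have "\<bar>f x + g x\<bar> \<le> c + d" if "x \<in> U" for x
    using Suc.prems that abs_triangle_ineq[of "f x" "g x"] by fastforce
  ultimately show ?case by simp
qed

lemma smooth_upto_scale:
  assumes "open U" "smooth_upto n U f c \<rho>"
  shows "smooth_upto n U (\<lambda>x. a * f x) (\<bar>a\<bar> * c) \<rho>"
  using assms(2)
proof (induction n arbitrary: f c)
  case 0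
  then show ?case by (auto intro!: continuous_intros mult_left_mono simp: abs_mult)
next
  case (Suc n)
  have fr: "((\<lambda>x. a * f x) has_derivative (\<lambda>h. a * frechet_derivative f (at x) h)) (at x)" if "x \<in> U" for x
    using Suc.prems that by (intro has_derivative_mult_right) (auto simp: frechet_derivative_works[symmetric])
  have "smooth_upto n U (\<lambda>x. frechet_derivative (\<lambda>x. a * f x) (at x) w) (\<bar>a\<bar> * c * \<rho>) \<rho>" if "norm w \<le> 1" for w
  proof (rule smooth_upto_cong[OF assms(1)])
    show "smooth_upto n U (\<lambda>x. a * frechet_derivative f (at x) w) (\<bar>a\<bar> * c * \<rho>) \<rho>"
      unfolding mult.assoc using Suc.prems that by (intro Suc.IH) auto
  qed (use frechet_derivative_at[OF fr, symmetric] in simp)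
  moreover have "(\<lambda>x. a * f x) differentiable (at x)" if "x \<in> U" for x
    using fr[OF that] differentiable_def by blast
  moreover have "\<bar>a * f x\<bar> \<le> \<bar>a\<bar> * c" if "x \<in> U" for x
    using Suc.prems that by (auto simp: abs_mult intro!: mult_left_mono)
  ultimately show ?case by simp
qed

text \<open>Each differentiation splits a product into two, which accounts for the factor
  \<open>2 ^ n\<close>.\<close>

lemma smooth_upto_mult:
  assumes "open U" "smooth_upto n U f c \<rho>" "smooth_upto n U g d \<rho>" "0 \<le> c" "0 \<le> d" "0 \<le> \<rho>"
  shows "smooth_upto n U (\<lambda>x. f x * g x) (2 ^ n * c * d) \<rho>"
  using assms(2-5)
proof (induction n arbitrary: f g c d)
  case 0
  then show ?case by (auto intro!: continuous_intros mult_mono simp: abs_mult)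
next
  case (Suc n)
  \<comment> \<open>The product rule pairs a derivative, controlled up to order n, with an
    undifferentiated factor, whose control must therefore be lowered by one order.\<close>
  have low: "smooth_upto n U f c \<rho>" if "smooth_upto (Suc n) U f c \<rho>" for n f c
    using that
  proof (induction n arbitrary: f c)
    case 0
    then show ?case using smooth_upto_continuous[OF 0] by simp
  qed simp
  have fr: "((\<lambda>x. f x * g x) has_derivative (\<lambda>h. f x * frechet_derivative g (at x) h + frechet_derivative f (at x) h * g x)) (at x)"
    if "x \<in> U" for x
    using Suc.prems that by (intro has_derivative_mult) (auto simp: frechet_derivative_works[symmetric])
  have "smooth_upto n U (\<lambda>x. frechet_derivative (\<lambda>x. f x * g x) (at x) w) (2 ^ Suc n * c * d * \<rho>) \<rho>" if "norm w \<le> 1" for w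
  proof (rule smooth_upto_cong[OF assms(1)])
    have "smooth_upto n U (\<lambda>x. f x * frechet_derivative g (at x) w + frechet_derivative f (at x) w * g x)
       (2 ^ n * c * (d * \<rho>) + 2 ^ n * (c * \<rho>) * d) \<rho>"
      using Suc.prems that low assms(6) by (intro smooth_upto_add[OF assms(1)] Suc.IH) auto
    also have "2 ^ n * c * (d * \<rho>) + 2 ^ n * (c * \<rho>) * d = 2 ^ Suc n * c * d * \<rho>" by simp
    finally show "smooth_upto n U (\<lambda>x. f x * frechet_derivative g (at x) w + frechet_derivative f (at x) w * g x) (2 ^ Suc n * c * d * \<rho>) \<rho>" .
  qed (use frechet_derivative_at[OF fr, symmetric] in simp)
  moreover have "(\<lambda>x. f x * g x) differentiable (at x)" if "x \<in> U" for x
    using fr[OF that] differentiable_def by blast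
  moreover have "\<bar>f x * g x\<bar> \<le> 2 ^ Suc n * c * d" if "x \<in> U" for x
  proof -
    have "\<bar>f x * g x\<bar> \<le> c * d" using Suc.prems that by (auto simp: abs_mult intro!: mult_mono)
    also have "\<dots> \<le> 2 ^ Suc n * (c * d)"
      using mult_right_mono[of 1 "2 ^ Suc n" "c * d"] one_le_power[of "2 :: real" "Suc n"] Suc.prems by simp
    finally show ?thesis by (simp add: mult.assoc)
  qed
  ultimately show ?case by simp
qed

lemma smooth_upto_translation:
  assumes "smooth_upto n UNIV f c \<rho>"
  shows "smooth_upto n UNIV (\<lambda>x. f (x + v)) c \<rho>"
  using assms
proof (induction n arbitrary: f c)
  case 0
  then show ?case by (auto intro!: continuous_on_compose2[of UNIV f] continuous_intros)
next
  case (Suc n)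
  have fr: "((\<lambda>x. f (x + v)) has_derivative frechet_derivative f (at (x + v))) (at x)" for x
  proof -
    have "((\<lambda>x. x + v) has_derivative (\<lambda>h. h)) (at x)" by (auto intro!: derivative_eq_intros)
    from has_derivative_compose[OF this, of f "frechet_derivative f (at (x + v))"] show ?thesis
      using Suc.prems by (auto simp: frechet_derivative_works[symmetric])
  qed
  then have "frechet_derivative (\<lambda>x. f (x + v)) (at x) = frechet_derivative f (at (x + v))" for x
    by (metis frechet_derivative_at)
  moreover have "(\<lambda>x. f (x + v)) differentiable (at x)" for x using fr differentiable_def by blast
  moreover have "smooth_upto n UNIV (\<lambda>x. frechet_derivative f (at (x + v)) w) (c * \<rho>) \<rho>" if "norm w \<le> 1" for w
    using Suc.IH[of "\<lambda>x. frechet_derivative f (at x) w"] Suc.prems that by auto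
  ultimately show ?case using Suc.prems by auto
qed

lemma smooth_upto_imp_Ck:
  assumes "smooth_upto n UNIV f c \<rho>"
  shows "Ck n f"
  using assms
proof (induction n arbitrary: f c)
  case (Suc n)
  have "Ck n (\<lambda>x. frechet_derivative f (at x) v)" for v
  proof -
    \<comment> \<open>\<open>smooth_upto\<close> tests directions in the unit ball only; linearity
      of the derivative extends this to an arbitrary \<open>v\<close>. For \<open>v = 0\<close> the
      normalised vector is 0.\<close>
    have n: "norm (v /\<^sub>R norm v) \<le> 1" by (cases "v = 0") auto
    have "frechet_derivative f (at x) v = norm v * frechet_derivative f (at x) (v /\<^sub>R norm v)" for x
    proof -
      have "linear (frechet_derivative f (at x))" using Suc.prems by (intro linear_frechet_derivative) auto
      then show ?thesis by (cases "v = 0") (auto simp: linear_0 linear_scale)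
    qed
    moreover have "smooth_upto n UNIV (\<lambda>x. norm v * frechet_derivative f (at x) (v /\<^sub>R norm v)) (\<bar>norm v\<bar> * (c * \<rho>)) \<rho>"
      using Suc.prems n by (intro smooth_upto_scale) auto
    ultimately show ?thesis using Suc.IH by simp
  qed
  then show ?case using Suc.prems by (auto simp: differentiable_on_def)
qed simp

text \<open>\<open>deriv_at\<close> keeps the outermost derivative at the head of the list, whereas
  \<open>smooth_upto\<close> peels off the innermost one. Inductions linking them therefore work
  from the end of the list.\<close>

lemma deriv_at_snoc: "deriv_at f (vs @ [w]) = deriv_at (\<lambda>x. frechet_derivative f (at x) w) vs"
  by (induction vs) auto

lemma smooth_upto_deriv_at:
  assumes "smooth_upto n UNIV f c \<rho>" "length vs \<le> n" "\<forall>v\<in>set vs. norm v \<le> 1"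
  shows "\<bar>deriv_at f vs x\<bar> \<le> c * \<rho> ^ length vs"
  using assms
proof (induction vs arbitrary: n f c rule: rev_induct)
  case Nil
  then show ?case using smooth_upto_bound[OF Nil(1)] by simp
next
  case (snoc w vs)
  then obtain m where n: "n = Suc m" by (cases n) auto
  have "\<bar>deriv_at (\<lambda>x. frechet_derivative f (at x) w) vs x\<bar> \<le> (c * \<rho>) * \<rho> ^ length vs"
    by (rule snoc.IH[of m]) (use snoc.prems n in auto)
  then show ?case by (simp add: deriv_at_snoc mult.assoc)
qed

lemma smooth_upto_dnorm:
  assumes "smooth_upto n UNIV f c \<rho>" "k \<le> n"
  shows "dnorm k f \<le> ereal (c * \<rho> ^ k)"
  unfolding dnorm_def
  using smooth_upto_deriv_at[OF assms(1)] assms(2) by (intro SUP_least) auto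

lemma smooth_uptoI:
  assumes "Ck n f" "\<And>vs x. length vs \<le> n \<Longrightarrow> \<forall>v\<in>set vs. norm v \<le> 1 \<Longrightarrow> \<bar>deriv_at f vs x\<bar> \<le> c * \<rho> ^ length vs"
  shows "smooth_upto n UNIV f c \<rho>"
  using assms
proof (induction n arbitrary: f c)
  case 0
  then show ?case using 0(2)[of "[]"] by simp
next
  case (Suc n)
  have "smooth_upto n UNIV (\<lambda>x. frechet_derivative f (at x) w) (c * \<rho>) \<rho>" if "norm w \<le> 1" for w
  proof (rule Suc.IH)
    show "Ck n (\<lambda>x. frechet_derivative f (at x) w)" using Suc.prems(1) by simp
    show "\<bar>deriv_at (\<lambda>x. frechet_derivative f (at x) w) vs x\<bar> \<le> c * \<rho> * \<rho> ^ length vs"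
      if "length vs \<le> n" "\<forall>v\<in>set vs. norm v \<le> 1" for vs x
      using Suc.prems(2)[of "vs @ [w]" x] that \<open>norm w \<le> 1\<close> by (simp add: deriv_at_snoc mult.assoc)
  qed
  then show ?case using Suc.prems(1) Suc.prems(2)[of "[]"] by (auto simp: differentiable_on_def)
qed

lemma dnormD:
  assumes "dnorm k f \<le> ereal b" "length vs = k" "\<forall>v\<in>set vs. norm v \<le> 1"
  shows "norm (deriv_at f vs x) \<le> b"
proof -
  have "ereal (norm (deriv_at f vs x)) \<le> dnorm k f" unfolding dnorm_def
    using assms(2,3) by (intro SUP_upper2[of x] SUP_upper2[of vs]) auto
  also have "\<dots> \<le> ereal b" by fact
  finally show ?thesis by simp
qed

section \<open>Laurent modes of the logarithmic potential in complex coordinates\<close>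

definition cplx :: "plane \<Rightarrow> complex" where
  "cplx y = Complex (y $ 1) (y $ 2)"

lemma bounded_linear_cplx: "bounded_linear cplx"
  by (auto simp: cplx_def complex_eq_iff linear_conv_bounded_linear[symmetric] intro!: linearI)

lemma cmod_cplx [simp]: "cmod (cplx y) = norm y"
  by (simp add: cplx_def cmod_def norm_vec_def L2_set_def sum_2)

lemma cplx_eq_0_iff [simp]: "cplx y = 0 \<longleftrightarrow> y = 0"
  using cmod_cplx[of y] by (metis norm_eq_zero)

lemma cplx_diff: "cplx (x - y) = cplx x - cplx y"
  by (simp add: cplx_def complex_eq_iff)

lemma DERIV_divide_power:
  fixes z :: complex
  assumes "z \<noteq> 0"
  shows "((\<lambda>z. a / z ^ k) has_field_derivative (- of_nat k * a / z ^ Suc k)) (at z)"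
proof -
  have "((\<lambda>z. a / z ^ k) has_field_derivative (0 * z ^ k - a * (of_nat k * z ^ (k - Suc 0))) / (z ^ k * z ^ k)) (at z)"
    by (rule derivative_eq_intros refl | simp add: assms)+
  moreover have "(0 * z ^ k - a * (of_nat k * z ^ (k - Suc 0))) / (z ^ k * z ^ k) = - of_nat k * a / z ^ Suc k"
    using assms by (cases k) (simp_all add: field_simps del: of_nat_Suc)
  ultimately show ?thesis by simp
qed

lemma has_derivative_inverse_power:
  assumes "y \<noteq> 0"
  shows "((\<lambda>y. Re (a / cplx y ^ k)) has_derivative (\<lambda>w. Re (- of_nat k * a * cplx w / cplx y ^ Suc k))) (at y)"
proof -
  have c: "(cplx has_derivative cplx) (at y)"
    using bounded_linear_cplx by (rule bounded_linear_imp_has_derivative)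
  have "((\<lambda>z. a / z ^ k) has_field_derivative (- of_nat k * a / cplx y ^ Suc k)) (at (cplx y))"
    using assms by (intro DERIV_divide_power) simp
  then have "((\<lambda>z. a / z ^ k) has_derivative (\<lambda>h. (- of_nat k * a / cplx y ^ Suc k) * h)) (at (cplx y))"
    by (simp only: has_field_derivative_def)
  then have "((\<lambda>z. a / z ^ k) has_derivative (\<lambda>h. - of_nat k * a * h / cplx y ^ Suc k)) (at (cplx y))"
    by (simp only: times_divide_eq_left)
  from has_derivative_compose[OF c this] bounded_linear.has_derivative[OF bounded_linear_Re]
  show ?thesis by fastforce
qed

text \<open>The derivative of Re(a / z^k) in direction w is Re(-k a w / z^(k+1)), of the same form
  with a new complex coefficient. Each of the n steps costs a factor at most k + n and one power of
  1/r.\<close>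

lemma smooth_upto_inverse_power:
  assumes "r > 0"
  shows "smooth_upto n {y. norm y > r} (\<lambda>y. Re (a / cplx y ^ k)) (cmod a * real (k + n) ^ n / r ^ k) (1 / r)"
proof -
  have bd: "\<bar>Re (a / cplx x ^ k)\<bar> \<le> cmod a / r ^ k" if "norm x > r" for x a k
  proof -
    have r: "r ^ k \<le> norm x ^ k" "0 < r ^ k" using that assms by (auto intro!: power_mono)
    have "\<bar>Re (a / cplx x ^ k)\<bar> \<le> cmod (a / cplx x ^ k)" by (rule abs_Re_le_cmod)
    also have "\<dots> = cmod a / norm x ^ k" by (simp add: norm_divide norm_power)
    also have "\<dots> \<le> cmod a / r ^ k"
      using r by (intro divide_left_mono) (auto intro!: mult_pos_pos order_less_le_trans[OF r(2) r(1)])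
    finally show ?thesis .
  qed
  show ?thesis
proof (induction n arbitrary: a k)
  case 0
  have "\<bar>Re (a / cplx x ^ k)\<bar> \<le> cmod a / r ^ k" if "norm x > r" for x
  proof -
    show ?thesis using bd[OF that] .
  qed
  moreover have "continuous_on {y. norm y > r} (\<lambda>y. Re (a / cplx y ^ k))"
    using assms by (intro continuous_intros bounded_linear.continuous_on[OF bounded_linear_cplx]) auto
  ultimately show ?case by simp
next
  case (Suc n)
  have op: "open {y :: plane. norm y > r}" by (intro open_Collect_less continuous_intros)
  have hd: "((\<lambda>y. Re (a / cplx y ^ k)) has_derivative (\<lambda>w. Re (- of_nat k * a * cplx w / cplx y ^ Suc k))) (at y)"
    if "norm y > r" for y using that assms by (intro has_derivative_inverse_power) auto
  have "smooth_upto n {y. norm y > r} (\<lambda>x. frechet_derivative (\<lambda>y. Re (a / cplx y ^ k)) (at x) w)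
     (cmod a * real (k + Suc n) ^ Suc n / r ^ k * (1 / r)) (1 / r)" if w: "norm w \<le> 1" for w
  proof (rule smooth_upto_cong[OF op])
    show "smooth_upto n {y. norm y > r} (\<lambda>y. Re ((- of_nat k * a * cplx w) / cplx y ^ Suc k)) (cmod a * real (k + Suc n) ^ Suc n / r ^ k * (1 / r)) (1 / r)"
    proof (rule smooth_upto_mono[OF Suc.IH])
      have "cmod (- of_nat k * a * cplx w) * real (Suc k + n) ^ n \<le> (real (k + Suc n) * cmod a * 1) * real (k + Suc n) ^ n"
      proof (rule mult_mono)
        have "real k * cmod a * norm w \<le> real (k + Suc n) * cmod a * 1"
          using w by (intro mult_mono mult_nonneg_nonneg) auto
        then show "cmod (- of_nat k * a * cplx w) \<le> real (k + Suc n) * cmod a * 1" by (simp add: norm_mult)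
      qed auto
      then have "cmod (- of_nat k * a * cplx w) * real (Suc k + n) ^ n / r ^ Suc k \<le> (real (k + Suc n) * cmod a * 1) * real (k + Suc n) ^ n / r ^ Suc k"
        using assms by (intro divide_right_mono) auto
      then show "cmod (- of_nat k * a * cplx w) * real (Suc k + n) ^ n / r ^ Suc k \<le> cmod a * real (k + Suc n) ^ Suc n / r ^ k * (1 / r)"
        by (simp add: mult_ac)
    qed (use assms in auto)
  qed (use frechet_derivative_at[OF hd, symmetric] in simp)
  moreover have "\<bar>Re (a / cplx x ^ k)\<bar> \<le> cmod a * real (k + Suc n) ^ Suc n / r ^ k" if "norm x > r" for x
  proof -
    have "\<bar>Re (a / cplx x ^ k)\<bar> \<le> cmod a / r ^ k" using bd[OF that] .
    also have "\<dots> \<le> cmod a * real (k + Suc n) ^ Suc n / r ^ k" using assms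
      using mult_left_mono[OF one_le_power[of "real (k + Suc n)" "Suc n"], of "cmod a"]
      by (intro divide_right_mono) auto
    finally show ?thesis .
  qed
  moreover have "(\<lambda>y. Re (a / cplx y ^ k)) differentiable (at x)" if "norm x > r" for x
    using hd[OF that] differentiable_def by blast
  ultimately show ?case by simp
qed
qed

lemma ln_expansion:
  assumes "cmod w \<le> 1 / 2"
  shows "\<bar>- ln (cmod (1 - w)) - Re w - Re (w ^ 2) / 2\<bar> \<le> 8 * cmod w ^ 3"
proof -
  let ?f = "\<lambda>i::nat. if i = 0 then (\<lambda>z. Ln (1 - z)) else if i = 1 then (\<lambda>z. - (1 / (1 - z)))
     else if i = 2 then (\<lambda>z. - (1 / (1 - z) ^ 2)) else (\<lambda>z. - (2 / (1 - z) ^ 3))"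
  have ne: "z \<noteq> 1 \<and> 1 - z \<notin> \<real>\<^sub>\<le>\<^sub>0" if "z \<in> cball 0 (1/2)" for z :: complex
  proof -
    have "Re z \<le> cmod z" by (rule complex_Re_le_cmod)
    then have "Re z \<le> 1/2" using that by simp
    then show ?thesis by (auto simp: complex_nonpos_Reals_iff)
  qed
  \<comment> \<open>Second-order Taylor formula for Ln(1 - z): on the disk of radius 1/2 one has |1
    - z| \<ge> 1/2, so the third derivative 2 / (1 - z)^3 is at most 16 in modulus, and 16 / 2! =
    8.\<close>
  have "cmod (?f 0 w - (\<Sum>i\<le>2. ?f i 0 * (w - 0) ^ i / fact i)) \<le> 16 * cmod (w - 0) ^ Suc 2 / fact 2"
  proof (rule complex_Taylor[of "cball 0 (1/2)"])
    fix i :: nat and x :: complex assume x: "x \<in> cball 0 (1/2)" and i: "i \<le> 2"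
    consider "i = 0" | "i = 1" | "i = 2" using i by linarith
    then show "(?f i has_field_derivative ?f (Suc i) x) (at x within cball 0 (1/2))"
    proof cases
      case 1
      then show ?thesis using ne[OF x] by (auto intro!: derivative_eq_intros simp: inverse_eq_divide)
    next
      case 2
      then show ?thesis using ne[OF x] by (auto intro!: derivative_eq_intros simp: power2_eq_square)
    next
      case 3
      have d: "((\<lambda>z. 1 - z) has_field_derivative -1) (at x)" by (auto intro!: derivative_eq_intros)
      have u: "1 - x \<noteq> 0" using ne[OF x] by auto
      have "((\<lambda>z. - (1 / (1 - z) ^ 2)) has_field_derivative - ((- of_nat 2 * 1 / (1 - x) ^ Suc 2) * -1)) (at x)"
        by (rule DERIV_minus[OF DERIV_chain2[OF DERIV_divide_power[OF u] d]])
      then show ?thesis using 3 by (simp add: has_field_derivative_at_within numeral_3_eq_3 numeral_2_eq_2)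
    qed
  next
    fix x :: complex assume x: "x \<in> cball 0 (1/2)"
    have "1/2 \<le> cmod (1 - x)" using x norm_triangle_ineq2[of 1 x] by simp
    then have "(1/2) ^ 3 \<le> cmod (1 - x) ^ 3" by (intro power_mono) auto
    then show "cmod (?f (Suc 2) x) \<le> 16" by (simp add: norm_divide norm_power norm_mult divide_simps power3_eq_cube split: if_splits)
  qed (use assms in auto)
  then have "cmod (Ln (1 - w) + w + w ^ 2 / 2) \<le> 8 * cmod w ^ 3"
    by (simp add: atMost_Suc numeral_2_eq_2 numeral_3_eq_3 algebra_simps)
  then have "\<bar>Re (Ln (1 - w) + w + w ^ 2 / 2)\<bar> \<le> 8 * cmod w ^ 3"
    using abs_Re_le_cmod order_trans by blast
  moreover have "Re (Ln (1 - w)) = ln (cmod (1 - w))" using ne[of w] assms by (intro Re_Ln) auto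
  ultimately show ?thesis by (simp add: abs_if split: if_splits)
qed

text \<open>The expansion of -ln |1 - x/y| separates the variables: the coefficients depend on
  \<open>x\<close>, the four modes on \<open>y\<close> only. Controlling four random variables per
  shell thus controls the potential at all \<open>x\<close> at once, with a single null set.\<close>

lemma log_potential_expansion:
  assumes "2 * norm x \<le> norm y" "y \<noteq> 0"
  shows "\<bar>(ln (norm y) - ln (dist x y))
      - (Re (cplx x) * Re (1 / cplx y ^ 1) + Im (cplx x) * Re (\<i> / cplx y ^ 1)
       + Re (cplx x ^ 2) / 2 * Re (1 / cplx y ^ 2) + Im (cplx x ^ 2) / 2 * Re (\<i> / cplx y ^ 2))\<bar>
    \<le> 8 * norm x ^ 3 / norm y ^ 3"
proof -
  define w where "w = cplx x / cplx y"
  have cw: "cmod w = norm x / norm y" by (simp add: w_def norm_divide)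
  have w: "cmod w \<le> 1 / 2" unfolding cw using assms by (simp add: pos_divide_le_eq)
  have y: "cplx y \<noteq> 0" using assms by simp
  have "1 - w = (cplx y - cplx x) / cplx y" using y by (simp add: w_def field_simps)
  then have "cmod (1 - w) = dist x y / norm y"
    by (simp add: norm_divide cplx_diff[symmetric] dist_norm norm_minus_commute)
  moreover have "x \<noteq> y" using assms by auto
  ultimately have "- ln (cmod (1 - w)) = ln (norm y) - ln (dist x y)"
    using assms by (simp add: ln_div)
  moreover have ReM: "Re (z / u) = Re z * Re (1 / u) + Im z * Re (\<i> / u)" for z u :: complex
    by (simp add: Re_divide add_divide_distrib)
  have "Re w = Re (cplx x) * Re (1 / cplx y ^ 1) + Im (cplx x) * Re (\<i> / cplx y ^ 1)"
    unfolding w_def using ReM[of "cplx x" "cplx y"] by simp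
  moreover have "Re (w ^ 2) = Re (cplx x ^ 2) * Re (1 / cplx y ^ 2) + Im (cplx x ^ 2) * Re (\<i> / cplx y ^ 2)"
    unfolding w_def power_divide by (rule ReM)
  ultimately show ?thesis using ln_expansion[OF w] by (simp add: cw power_divide add_divide_distrib algebra_simps)
qed

section \<open>Fluctuations in dyadic shells\<close>

lemma smooth_upto_const: "\<bar>a\<bar> \<le> c \<Longrightarrow> 0 \<le> \<rho> \<Longrightarrow> smooth_upto n U (\<lambda>x. a) c \<rho>"
  by (cases n) (auto simp: frechet_derivative_const intro!: smooth_upto_zero)

text \<open>The regions |y| > l/8 and |y| < l/4 overlap and cover the plane; the product is smooth
  on the first and zero on the second. With k \<le> 2 and r = l/8 the mode has constant 5^3 * 8^2 =
  8000, and the product rule contributes 2^3.\<close>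

lemma smooth_upto_inverse_power_mult:
  assumes l: "l > 0" and b: "b \<ge> 0" and \<eta>: "smooth_upto 3 UNIV \<eta> b (8 / l)"
    and supp: "\<And>y. norm y < l / 4 \<Longrightarrow> \<eta> y = 0"
    and a: "cmod a \<le> 1" and k: "k \<le> 2"
  shows "smooth_upto 3 UNIV (\<lambda>y. Re (a / cplx y ^ k) * \<eta> y) (64000 * b / l ^ k) (8 / l)"
proof -
  let ?U = "{y :: plane. norm y > l / 8}" and ?V = "ball (0 :: plane) (l / 4)"
  have op: "open ?U" by (intro open_Collect_less continuous_intros)
  have "cmod a * real (k + 3) ^ 3 / (l / 8) ^ k \<le> 8000 / l ^ k"
  proof -
    have "real (k + 3) ^ 3 \<le> 5 ^ 3" using k by (intro power_mono) auto
    then have "cmod a * real (k + 3) ^ 3 \<le> 1 * 5 ^ 3" using a by (intro mult_mono) auto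
    moreover have "(8::real) ^ k \<le> 8 ^ 2" using k by (intro power_increasing) auto
    ultimately have "(cmod a * real (k + 3) ^ 3) * 8 ^ k \<le> (1 * 5 ^ 3) * 8 ^ 2" by (rule mult_mono) auto
    then have "(cmod a * real (k + 3) ^ 3) * 8 ^ k / l ^ k \<le> 8000 / l ^ k" using l by (intro divide_right_mono) auto
    then show ?thesis by (simp add: power_divide)
  qed
  moreover have "smooth_upto 3 ?U (\<lambda>y. Re (a / cplx y ^ k)) (cmod a * real (k + 3) ^ 3 / (l / 8) ^ k) (8 / l)"
    using smooth_upto_inverse_power[of "l / 8" 3 a k] l by simp
  ultimately have "smooth_upto 3 ?U (\<lambda>y. Re (a / cplx y ^ k)) (8000 / l ^ k) (8 / l)"
    using l by (intro smooth_upto_mono[of 3 ?U _ "cmod a * real (k + 3) ^ 3 / (l / 8) ^ k" "8 / l" "8000 / l ^ k"]) auto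
  moreover have "smooth_upto 3 ?U \<eta> b (8 / l)" by (rule smooth_upto_mono[OF \<eta>]) (use b l in auto)
  ultimately have "smooth_upto 3 ?U (\<lambda>y. Re (a / cplx y ^ k) * \<eta> y) (2 ^ 3 * (8000 / l ^ k) * b) (8 / l)"
    using l b by (intro smooth_upto_mult[OF op]) auto
  also have "2 ^ 3 * (8000 / l ^ k) * b = 64000 * b / l ^ k" by simp
  finally have U: "smooth_upto 3 ?U (\<lambda>y. Re (a / cplx y ^ k) * \<eta> y) (64000 * b / l ^ k) (8 / l)" .
  have V: "smooth_upto 3 ?V (\<lambda>y. Re (a / cplx y ^ k) * \<eta> y) (64000 * b / l ^ k) (8 / l)"
  proof (rule smooth_upto_cong)
    show "smooth_upto 3 ?V (\<lambda>y. 0) (64000 * b / l ^ k) (8 / l)" using l b by (intro smooth_upto_zero) auto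
  qed (use supp in auto)
  have "?U \<union> ?V = UNIV" using l by (auto simp: not_less)
  then show ?thesis using smooth_upto_Un[OF op open_ball U V] by simp
qed

lemma measurable_Fluct:
  assumes "continuous_on UNIV \<phi>" "\<And>x. x \<notin> S \<Longrightarrow> \<phi> x = 0" "bounded S"
  shows "(\<lambda>X. Fluct \<phi> X) \<in> borel_measurable borel"
  unfolding Fluct_def using measurable_integral_conf[OF assms] by measurable

lemma Fluct_expectation:
  assumes l: "l > 0" "l \<ge> \<rho>\<beta>" and b: "b > 0" and C: "C > 0"
    and \<phi>: "smooth_upto 3 UNIV \<phi> b (8 / l)" and supp: "\<And>y. norm y > 4 * l \<Longrightarrow> \<phi> y = 0"
    and good: "good_smooth C \<rho>\<beta> P"
  shows "(\<integral>\<^sup>+X. ennreal \<bar>Fluct \<phi> X\<bar> \<partial>P) \<le> ennreal (C * (512 * b))"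
proof -
  \<comment> \<open>The factor 512 = 8^3 converts bounds at scale 8/l into bounds at scale 1/l for
    orders up to 3.\<close>
  have "dnorm k \<phi> \<le> ereal (512 * b / l ^ k)" if k: "k \<in> {1..3}" for k
  proof -
    have "dnorm k \<phi> \<le> ereal (b * (8 / l) ^ k)" using smooth_upto_dnorm[OF \<phi>] k by auto
    also have "b * (8 / l) ^ k \<le> b * (8 ^ 3 / l ^ k)"
    proof -
      have "(8::real) ^ k \<le> 8 ^ 3" using k by (intro power_increasing) auto
      then have "8 ^ k / l ^ k \<le> 8 ^ 3 / l ^ k" using l by (intro divide_right_mono) auto
      then show ?thesis using b unfolding power_divide by (intro mult_left_mono) auto
    qed
    finally show ?thesis by (simp add: mult.commute)
  qed
  moreover have "closure {y. \<phi> y \<noteq> 0} \<subseteq> cball 0 (4 * l)"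
    by (rule closure_minimal) (use supp in \<open>auto simp: not_less[symmetric]\<close>)
  moreover have "Ck 3 \<phi>" using smooth_upto_imp_Ck[OF \<phi>] .
  ultimately show ?thesis using good l b unfolding good_smooth_def
    by (elim allE[of _ "0::plane"] allE[of _ l] allE[of _ \<phi>] allE[of _ "512 * b"]) auto
qed

text \<open>Geometrically decaying expectations have a finite sum, so by monotone convergence the
  random series has finite expectation and is almost surely finite.\<close>

lemma AE_summable:
  fixes f :: "nat \<Rightarrow> 'a \<Rightarrow> real"
  assumes "\<And>p. f p \<in> borel_measurable M" and "\<And>p x. 0 \<le> f p x"
    and "\<And>p. (\<integral>\<^sup>+x. ennreal (f p x) \<partial>M) \<le> ennreal (K * (1 / 2) ^ p)"
  shows "AE x in M. summable (\<lambda>p. f p x)"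
proof -
  have [measurable]: "f p \<in> borel_measurable M" for p by fact
  have "(\<integral>\<^sup>+x. (\<Sum>p. ennreal (f p x)) \<partial>M) = (\<Sum>p. \<integral>\<^sup>+x. ennreal (f p x) \<partial>M)"
    by (rule nn_integral_suminf) auto
  also have "\<dots> \<le> (\<Sum>p. ennreal (max K 0 * (1 / 2) ^ p))"
    by (intro suminf_le summableI order_trans[OF assms(3)] ennreal_leI mult_right_mono) auto
  also have "\<dots> = ennreal (\<Sum>p. max K 0 * (1 / 2) ^ p)"
    by (rule suminf_ennreal2) (auto intro!: summable_mult summable_geometric)
  finally have "(\<integral>\<^sup>+x. (\<Sum>p. ennreal (f p x)) \<partial>M) \<noteq> \<infinity>" by (auto simp: top_unique)
  then have "AE x in M. (\<Sum>p. ennreal (f p x)) \<noteq> \<infinity>" by (intro nn_integral_noteq_infinite) auto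
  then show ?thesis by eventually_elim (auto intro!: summable_suminf_not_top assms(2))
qed

lemma Fluct_bound:
  assumes [measurable]: "R \<in> borel_measurable borel" and "r \<ge> 0"
    and "\<And>y. norm y > r \<Longrightarrow> R y = 0" "\<And>y. \<bar>R y\<bar> \<le> M"
  shows "\<bar>Fluct R X\<bar> \<le> M * (real (Pts X (cball 0 r)) + unit_ball_vol 2 * r\<^sup>2)"
proof -
  have M: "M \<ge> 0" using assms(4)[of 0] by linarith
  have le: "\<bar>R y\<bar> \<le> M * indicator (cball 0 r) y" for y
    using assms(3)[of y] assms(4)[of y] M by (auto simp: indicator_def not_less[symmetric])
  have "\<bar>LINT y|N. R y\<bar> \<le> M * measure N (cball 0 r)"
    if [measurable_cong]: "sets N = sets borel" and "emeasure N (cball 0 r) \<noteq> \<infinity>" for N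
  proof -
    have int: "integrable N (\<lambda>y. M * indicator (cball 0 r) y)"
      using that by (intro integrable_mult_right integrable_real_indicator) (auto simp: top.not_eq_extremum)
    have "\<bar>LINT y|N. R y\<bar> \<le> (LINT y|N. \<bar>R y\<bar>)" using integral_norm_bound[of N R] by simp
    also have "\<dots> \<le> (LINT y|N. M * indicator (cball 0 r) y)"
    proof (rule integral_mono'[OF int])
    qed (use le M in \<open>auto simp: indicator_def\<close>)
    also have "\<dots> = M * measure N (cball 0 r)" using that sets_eq_imp_space_eq[OF that(1)] by simp
    finally show ?thesis .
  qed
  from this[of lborel] this[of "meas X"]
  have "\<bar>LINT y|lborel. R y\<bar> \<le> M * (unit_ball_vol 2 * r\<^sup>2)" "\<bar>LINT y|meas X. R y\<bar> \<le> M * real (Pts X (cball 0 r))"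
    using assms(2) by (auto simp: emeasure_meas emeasure_cball measure_def ennreal_of_nat_eq_real_of_nat)
  then show ?thesis unfolding Fluct_def distrib_left by linarith
qed

lemma Fluct_add:
  assumes "integrable (meas X) f" "integrable lborel f" "integrable (meas X) g" "integrable lborel g"
  shows "Fluct (\<lambda>y. f y + g y) X = Fluct f X + Fluct g X"
  unfolding Fluct_def using assms by simp

lemma Fluct_mult: "Fluct (\<lambda>y. c * f y) X = c * Fluct f X"
  unfolding Fluct_def by (simp add: right_diff_distrib)

lemma expected_Pts:
  assumes "good_intensity C P" "C > 0" "r \<ge> 0"
  shows "(\<integral>\<^sup>+X. ennreal (real (Pts X (cball 0 r))) \<partial>P) \<le> ennreal (C * (unit_ball_vol 2 * r\<^sup>2))"
proof -
  obtain \<rho> where \<rho>: "one_point_correlation P \<rho>" "(SUP y. \<rho> y) \<le> ennreal C"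
    using assms(1) unfolding good_intensity_def by auto
  have "(\<integral>\<^sup>+X. ennreal (real (Pts X (cball 0 r))) \<partial>P) = (\<integral>\<^sup>+X. emeasure (meas X) (cball 0 r) \<partial>P)"
    by (simp add: emeasure_meas ennreal_of_nat_eq_real_of_nat)
  also have "\<dots> = (\<integral>\<^sup>+y\<in>cball 0 r. \<rho> y \<partial>lborel)" using \<rho>(1) unfolding one_point_correlation_def by auto
  also have "\<dots> \<le> (\<integral>\<^sup>+y\<in>cball (0::plane) r. ennreal C \<partial>lborel)"
  proof -
    have "\<rho> y \<le> ennreal C" for y using SUP_upper[of y UNIV \<rho>] \<rho>(2) by (meson order_trans UNIV_I)
    then have "\<rho> y * indicator (cball 0 r) y \<le> ennreal C * indicator (cball 0 r) y" for y
      by (simp add: indicator_def)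
    then show ?thesis by (intro nn_integral_mono) auto
  qed
  also have "\<dots> = ennreal C * emeasure lborel (cball (0::plane) r)" by (simp add: nn_integral_cmult_indicator)
  also have "\<dots> = ennreal (C * (unit_ball_vol 2 * r\<^sup>2))"
    using assms by (simp add: emeasure_cball ennreal_mult')
  finally show ?thesis .
qed

text \<open>The sizes of the four leading Laurent modes of the potential of the charges in the \<open>p\<close>-th shell,
  plus a bound for the remainder.\<close>

definition shell_error :: "real \<Rightarrow> (nat \<Rightarrow> plane \<Rightarrow> real) \<Rightarrow> nat \<Rightarrow> conf \<Rightarrow> real" where
  "shell_error b \<eta> p X =
     \<bar>Fluct (\<lambda>y. Re (1 / cplx y ^ 1) * \<eta> p y) X\<bar> + \<bar>Fluct (\<lambda>y. Re (\<i> / cplx y ^ 1) * \<eta> p y) X\<bar>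
     + \<bar>Fluct (\<lambda>y. Re (1 / cplx y ^ 2) * \<eta> p y) X\<bar> + \<bar>Fluct (\<lambda>y. Re (\<i> / cplx y ^ 2) * \<eta> p y) X\<bar>
     + 512 * b * (1 / 8) ^ p * (real (Pts X (cball 0 (4 * 2 ^ p))) + unit_ball_vol 2 * (4 * 2 ^ p)\<^sup>2)"

text \<open>One interface for two families: the functions \<open>chi p\<close>, which give
  convergence of the potential, and the differences between a partial sum and its translate, which
  give covariance. The constants 1/4, 4 and 8 leave room for both.\<close>

definition shell_cutoffs :: "real \<Rightarrow> nat \<Rightarrow> (nat \<Rightarrow> plane \<Rightarrow> real) \<Rightarrow> bool" where
  "shell_cutoffs b p0 \<eta> \<longleftrightarrow> (\<forall>p\<ge>p0. smooth_upto 3 UNIV (\<eta> p) b (8 / 2 ^ p) \<and>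
     (\<forall>y. norm y < 2 ^ p / 4 \<or> norm y > 4 * 2 ^ p \<longrightarrow> \<eta> p y = 0))"

lemma shell_cutoffsD:
  assumes "shell_cutoffs b p0 \<eta>" "p \<ge> p0" "b > 0" "cmod a \<le> 1" "k \<le> 2"
  shows "smooth_upto 3 UNIV (\<lambda>y. Re (a / cplx y ^ k) * \<eta> p y) (64000 * b / (2 ^ p) ^ k) (8 / 2 ^ p)"
    "cutoff (\<lambda>y. Re (a / cplx y ^ k) * \<eta> p y)" "cutoff (\<eta> p)"
    "(\<lambda>X. Fluct (\<lambda>y. Re (a / cplx y ^ k) * \<eta> p y) X) \<in> borel_measurable borel"
proof -
  have \<eta>: "smooth_upto 3 UNIV (\<eta> p) b (8 / 2 ^ p)" "\<And>y. norm y < 2 ^ p / 4 \<Longrightarrow> \<eta> p y = 0"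
    "\<And>y. norm y > 4 * 2 ^ p \<Longrightarrow> \<eta> p y = 0"
    using assms(1,2) unfolding shell_cutoffs_def by auto
  show s: "smooth_upto 3 UNIV (\<lambda>y. Re (a / cplx y ^ k) * \<eta> p y) (64000 * b / (2 ^ p) ^ k) (8 / 2 ^ p)"
    using assms(3-5) \<eta> by (intro smooth_upto_inverse_power_mult) auto
  have 0: "\<eta> p y = 0" if "y \<notin> cball 0 (4 * 2 ^ p)" for y using \<eta>(3) that by auto
  show "cutoff (\<eta> p)" using 0 by (intro cutoff_continuous[OF smooth_upto_continuous[OF \<eta>(1)]])
  show "cutoff (\<lambda>y. Re (a / cplx y ^ k) * \<eta> p y)"
    using 0 by (intro cutoff_continuous[OF smooth_upto_continuous[OF s], of 0 "4 * 2 ^ p"]) auto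
  show "(\<lambda>X. Fluct (\<lambda>y. Re (a / cplx y ^ k) * \<eta> p y) X) \<in> borel_measurable borel"
    using 0 by (intro measurable_Fluct[OF smooth_upto_continuous[OF s], of "cball 0 (4 * 2 ^ p)"]) auto
qed

lemma abs_combination_le:
  fixes K :: real
  assumes "\<bar>r\<bar> \<le> K * q" "\<bar>a1\<bar> \<le> K" "\<bar>a2\<bar> \<le> K" "\<bar>a3\<bar> \<le> K" "\<bar>a4\<bar> \<le> K"
  shows "\<bar>r + (a1 * f1 + a2 * f2 + a3 * f3 + a4 * f4)\<bar> \<le> K * (\<bar>f1\<bar> + \<bar>f2\<bar> + \<bar>f3\<bar> + \<bar>f4\<bar> + q)"
proof -
  have t: "\<bar>u * v\<bar> \<le> K * \<bar>v\<bar>" if "\<bar>u\<bar> \<le> K" for u v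
    unfolding abs_mult by (rule mult_right_mono[OF that abs_ge_zero])
  have "\<bar>r + (a1 * f1 + a2 * f2 + a3 * f3 + a4 * f4)\<bar> \<le> K * q + (K * \<bar>f1\<bar> + K * \<bar>f2\<bar> + K * \<bar>f3\<bar> + K * \<bar>f4\<bar>)"
    by (intro order_trans[OF abs_triangle_ineq] add_mono t assms)
  then show ?thesis by (simp add: algebra_simps)
qed

text \<open>The hypothesis on \<open>x\<close> guarantees 2 |x| \<le> |y| throughout the shell, so
  the Laurent expansion applies. Its coefficients and its remainder are all dominated by (1 +
  |x|)^3.\<close>

lemma Fluct_log_bound:
  assumes \<eta>: "shell_cutoffs b p0 \<eta>" "p \<ge> p0" "b > 0" and x: "8 * norm x \<le> 2 ^ p"
  shows "\<bar>Fluct (\<lambda>y. (ln (norm y) - ln (dist x y)) * \<eta> p y) X\<bar> \<le> (1 + norm x) ^ 3 * shell_error b \<eta> p X"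
proof -
  note c = shell_cutoffsD[OF \<eta>]
  let ?\<phi> = "\<lambda>a k y. Re (a / cplx y ^ k) * \<eta> p y"
  let ?G = "\<lambda>y. (ln (norm y) - ln (dist x y)) * \<eta> p y"
  define A where "A = Re (cplx x)"
  define B where "B = Im (cplx x)"
  define D where "D = Re (cplx x ^ 2) / 2"
  define E where "E = Im (cplx x ^ 2) / 2"
  define R where "R y = ?G y - (A * ?\<phi> 1 1 y + B * ?\<phi> \<i> 1 y + D * ?\<phi> 1 2 y + E * ?\<phi> \<i> 2 y)" for y
  have \<eta>0: "\<eta> p y = 0" if "norm y < 2 ^ p / 4 \<or> norm y > 4 * 2 ^ p" for y
    using \<eta> that unfolding shell_cutoffs_def by auto
  have \<eta>b: "\<bar>\<eta> p y\<bar> \<le> b" for y using \<eta> smooth_upto_bound[of 3 UNIV "\<eta> p"] unfolding shell_cutoffs_def by auto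
  have [measurable]: "\<eta> p \<in> borel_measurable borel" using c(3)[of 0 0] by (simp add: cutoff_def)
  have [measurable]: "?\<phi> a k \<in> borel_measurable borel" if "cmod a \<le> 1" "k \<le> 2" for a k using c(2)[OF that] by (simp add: cutoff_def)
  have iG: "integrable N ?G" if "N = lborel \<or> N = meas X" for N
  proof -
    have "?G = (\<lambda>y. - ln (dist x y) * \<eta> p y - - ln (dist 0 y) * \<eta> p y)" by (auto simp: algebra_simps)
    then show ?thesis using that cutoff_integrable(1,2)[OF c(3)[of 0 0]]
      by (auto intro!: Bochner_Integration.integrable_diff simp del: dist_0_norm)
  qed
  have i\<phi>: "integrable N (?\<phi> a k)" if "N = lborel \<or> N = meas X" "cmod a \<le> 1" "k \<le> 2" for N a k
    using that cutoff_integrable(3,4)[OF c(2)[OF that(2,3)]] by auto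
  have iS: "integrable N (\<lambda>y. A * ?\<phi> 1 1 y + B * ?\<phi> \<i> 1 y + D * ?\<phi> 1 2 y + E * ?\<phi> \<i> 2 y)" if "N = lborel \<or> N = meas X" for N
    using that by (intro Bochner_Integration.integrable_add integrable_mult_right i\<phi>) auto
  have iR: "integrable N R" if "N = lborel \<or> N = meas X" for N
    unfolding R_def using that by (intro Bochner_Integration.integrable_diff iG iS)
  have "Fluct ?G X = Fluct (\<lambda>y. R y + (A * ?\<phi> 1 1 y + B * ?\<phi> \<i> 1 y + D * ?\<phi> 1 2 y + E * ?\<phi> \<i> 2 y)) X"
    by (simp add: R_def)
  also have "\<dots> = Fluct R X + (A * Fluct (?\<phi> 1 1) X + B * Fluct (?\<phi> \<i> 1) X + D * Fluct (?\<phi> 1 2) X + E * Fluct (?\<phi> \<i> 2) X)"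
  proof -
    have "Fluct (\<lambda>y. A * ?\<phi> 1 1 y + B * ?\<phi> \<i> 1 y + D * ?\<phi> 1 2 y + E * ?\<phi> \<i> 2 y) X
      = Fluct (\<lambda>y. A * ?\<phi> 1 1 y) X + Fluct (\<lambda>y. B * ?\<phi> \<i> 1 y) X + Fluct (\<lambda>y. D * ?\<phi> 1 2 y) X + Fluct (\<lambda>y. E * ?\<phi> \<i> 2 y) X"
      by (subst Fluct_add | (intro Bochner_Integration.integrable_add integrable_mult_right i\<phi>; simp))+ (rule refl)
    then show ?thesis unfolding Fluct_mult by (subst Fluct_add) (use iR iS in auto)
  qed
  finally have eq: "Fluct ?G X = Fluct R X + (A * Fluct (?\<phi> 1 1) X + B * Fluct (?\<phi> \<i> 1) X + D * Fluct (?\<phi> 1 2) X + E * Fluct (?\<phi> \<i> 2) X)" .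
  \<comment> \<open>On the shell |y| \<ge> 2^p / 4, and the cubic remainder 8 |x|^3 / |y|^3 becomes
    8 * 4^3 * |x|^3 / 8^p.\<close>
  have Rb: "\<bar>R y\<bar> \<le> norm x ^ 3 * (512 * b * (1 / 8) ^ p)" for y
  proof (cases "norm y < 2 ^ p / 4")
    case True
    then show ?thesis using \<eta>0[of y] \<open>b > 0\<close> by (simp add: R_def)
  next
    case False
    have y: "norm y \<ge> 2 ^ p / 4" "y \<noteq> 0" using False by auto
    have "R y = ((ln (norm y) - ln (dist x y)) - (A * Re (1 / cplx y ^ 1) + B * Re (\<i> / cplx y ^ 1) + D * Re (1 / cplx y ^ 2) + E * Re (\<i> / cplx y ^ 2))) * \<eta> p y"
      by (simp add: R_def algebra_simps)
    also have "\<bar>\<dots>\<bar> \<le> (8 * norm x ^ 3 / norm y ^ 3) * b"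
      unfolding abs_mult A_def B_def D_def E_def
      using log_potential_expansion[of x y] x y \<eta>b[of y] by (intro mult_mono) auto
    also have "\<dots> \<le> (8 * norm x ^ 3 / (2 ^ p / 4) ^ 3) * b"
      using y \<open>b > 0\<close> by (intro mult_right_mono divide_left_mono power_mono mult_pos_pos zero_less_power) auto
    also have "\<dots> = norm x ^ 3 * (512 * b * (1 / 8) ^ p)"
    proof -
      have "(2 ^ p) ^ 3 = (8::real) ^ p" by (simp add: power_mult[symmetric] mult.commute[of p] power_mult)
      then show ?thesis by (simp add: power_divide)
    qed
    finally show ?thesis .
  qed
  have "\<bar>Fluct R X\<bar> \<le> (norm x ^ 3 * (512 * b * (1 / 8) ^ p)) * (real (Pts X (cball 0 (4 * 2 ^ p))) + unit_ball_vol 2 * (4 * 2 ^ p)\<^sup>2)"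
  proof (rule Fluct_bound)
    show "R \<in> borel_measurable borel" using borel_measurable_integrable[OF iR[of lborel]] by simp
  qed (use Rb \<eta>0 in \<open>auto simp: R_def\<close>)
  also have "\<dots> \<le> (1 + norm x) ^ 3 * (512 * b * (1 / 8) ^ p * (real (Pts X (cball 0 (4 * 2 ^ p))) + unit_ball_vol 2 * (4 * 2 ^ p)\<^sup>2))"
    unfolding mult.assoc using \<open>b > 0\<close> by (intro mult_right_mono power_mono) auto
  finally have R: "\<bar>Fluct R X\<bar> \<le> (1 + norm x) ^ 3 * (512 * b * (1 / 8) ^ p * (real (Pts X (cball 0 (4 * 2 ^ p))) + unit_ball_vol 2 * (4 * 2 ^ p)\<^sup>2))" .
  have n1: "norm x \<le> (1 + norm x) ^ 3"
    using self_le_power[of "1 + norm x" 3] by simp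
  have n2: "norm x ^ 2 \<le> (1 + norm x) ^ 3"
    by (rule order_trans[OF power_mono[of "norm x" "1 + norm x" 2] power_increasing[of 2 3 "1 + norm x"]]) auto
  have s2: "cmod (cplx x ^ 2) = norm x ^ 2" by (simp add: norm_power)
  have co: "\<bar>A\<bar> \<le> (1 + norm x) ^ 3" "\<bar>B\<bar> \<le> (1 + norm x) ^ 3" "\<bar>D\<bar> \<le> (1 + norm x) ^ 3" "\<bar>E\<bar> \<le> (1 + norm x) ^ 3"
  proof -
    show "\<bar>A\<bar> \<le> (1 + norm x) ^ 3" "\<bar>B\<bar> \<le> (1 + norm x) ^ 3"
      unfolding A_def B_def using abs_Re_le_cmod[of "cplx x"] abs_Im_le_cmod[of "cplx x"] n1
      unfolding cmod_cplx by linarith+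
    show "\<bar>D\<bar> \<le> (1 + norm x) ^ 3" "\<bar>E\<bar> \<le> (1 + norm x) ^ 3"
      unfolding D_def E_def using abs_Re_le_cmod[of "cplx x ^ 2"] abs_Im_le_cmod[of "cplx x ^ 2"] n2
      unfolding s2 by linarith+
  qed
  show ?thesis unfolding eq shell_error_def by (rule abs_combination_le[OF R co])
qed

text \<open>A mode of order k, cut off to the shell, is a smooth test function of size 2^(-pk), so
  its expected fluctuation is O(2^(-p)). The remainder is O(8^(-p)) per point and per unit area,
  against O(4^p) points and area.\<close>

lemma AE_shell_error_summable:
  assumes sets: "sets P = sets borel" and good: "good_smooth C \<rho>\<beta> P" "good_intensity C P" and C: "C > 0" and b: "b > 0"
    and \<eta>: "shell_cutoffs b p0 \<eta>" and p0: "2 ^ p0 \<ge> \<rho>\<beta>"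
  shows "AE X in P. summable (\<lambda>p. shell_error b \<eta> p X)"
proof -
  note [measurable_cong] = sets
  let ?\<phi> = "\<lambda>a k p y. Re (a / cplx y ^ k) * \<eta> p y"
  have F: "AE X in P. summable (\<lambda>p. if p \<ge> p0 then \<bar>Fluct (?\<phi> a k p) X\<bar> else 0)"
    if a: "cmod a \<le> 1" and k: "k \<le> 2" "k \<ge> 1" for a k
  proof (rule AE_summable[where K="C * (512 * (64000 * b))"])
    fix p
    show "(\<lambda>X. if p \<ge> p0 then \<bar>Fluct (?\<phi> a k p) X\<bar> else 0) \<in> borel_measurable P"
      using shell_cutoffsD(4)[OF \<eta> _ b a k(1), of p] sets
      by (cases "p \<ge> p0") (auto simp: measurable_cong_sets[OF sets refl])
    show "(\<integral>\<^sup>+X. ennreal (if p \<ge> p0 then \<bar>Fluct (?\<phi> a k p) X\<bar> else 0) \<partial>P) \<le> ennreal (C * (512 * (64000 * b)) * (1 / 2) ^ p)"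
    proof (cases "p \<ge> p0")
      case True
      have "(2::real) ^ p0 \<le> 2 ^ p" using True by (intro power_increasing) auto
      then have l: "\<rho>\<beta> \<le> 2 ^ p" using p0 by linarith
      have "(\<integral>\<^sup>+X. ennreal \<bar>Fluct (?\<phi> a k p) X\<bar> \<partial>P) \<le> ennreal (C * (512 * (64000 * b / (2 ^ p) ^ k)))"
      proof (rule Fluct_expectation[OF _ l _ C shell_cutoffsD(1)[OF \<eta> True b a k(1)] _ good(1)])
        show "?\<phi> a k p y = 0" if "norm y > 4 * 2 ^ p" for y
          using \<eta> True that unfolding shell_cutoffs_def by simp
      qed (use b in auto)
      also have "\<dots> \<le> ennreal (C * (512 * (64000 * b)) * (1 / 2) ^ p)"
      proof (rule ennreal_leI)
        have "(2::real) ^ p \<le> (2 ^ p) ^ k" using k by (intro self_le_power) auto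
        then have "1 / (2 ^ p) ^ k \<le> 1 / (2::real) ^ p" by (intro divide_left_mono) auto
        then have "C * (512 * (64000 * b)) * (1 / (2 ^ p) ^ k) \<le> C * (512 * (64000 * b)) * (1 / 2 ^ p)"
          using C b by (intro mult_left_mono) auto
        then show "C * (512 * (64000 * b / (2 ^ p) ^ k)) \<le> C * (512 * (64000 * b)) * (1 / 2) ^ p"
          by (simp add: power_divide)
      qed
      finally show ?thesis using True by simp
    qed simp
  qed simp
  have four: "(4 * 2 ^ p)\<^sup>2 * (1 / 8 :: real) ^ p = 16 * (1 / 2) ^ p" for p :: nat
  proof -
    have "(4 * 2 ^ p)\<^sup>2 * (1 / 8 :: real) ^ p = 16 * (4 ^ p * (1 / 8) ^ p)"
      by (simp add: power_mult_distrib power_mult[symmetric] mult.commute[of p] power_mult)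
    also have "\<dots> = 16 * (1 / 2) ^ p" unfolding power_mult_distrib[symmetric] by simp
    finally show ?thesis .
  qed
  have N: "AE X in P. summable (\<lambda>p. 512 * b * (1 / 8) ^ p * real (Pts X (cball 0 (4 * 2 ^ p))))"
  proof (rule AE_summable[where K="512 * b * C * unit_ball_vol 2 * 16"])
    fix p
    have "(\<lambda>X. Pts X (cball 0 (4 * 2 ^ p))) \<in> P \<rightarrow>\<^sub>M count_space UNIV"
      using measurable_Pts[of "cball 0 (4 * 2 ^ p)"] by (simp add: measurable_cong_sets[OF sets refl])
    note [measurable] = this
    show "(\<lambda>X. 512 * b * (1 / 8) ^ p * real (Pts X (cball 0 (4 * 2 ^ p)))) \<in> borel_measurable P" by measurable
    have "(\<integral>\<^sup>+X. ennreal (512 * b * (1 / 8) ^ p * real (Pts X (cball 0 (4 * 2 ^ p)))) \<partial>P)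
      = ennreal (512 * b * (1 / 8) ^ p) * (\<integral>\<^sup>+X. ennreal (real (Pts X (cball 0 (4 * 2 ^ p)))) \<partial>P)"
      using b by (subst nn_integral_cmult[symmetric]) (auto simp: ennreal_mult')
    also have "\<dots> \<le> ennreal (512 * b * (1 / 8) ^ p) * ennreal (C * (unit_ball_vol 2 * (4 * 2 ^ p)\<^sup>2))"
      by (intro mult_left_mono expected_Pts[OF good(2) C]) auto
    also have "\<dots> = ennreal (512 * b * C * unit_ball_vol 2 * ((4 * 2 ^ p)\<^sup>2 * (1 / 8) ^ p))"
      using b C by (subst ennreal_mult[symmetric]) (auto simp: mult_ac)
    finally show "(\<integral>\<^sup>+X. ennreal (512 * b * (1 / 8) ^ p * real (Pts X (cball 0 (4 * 2 ^ p)))) \<partial>P) \<le> ennreal (512 * b * C * unit_ball_vol 2 * 16 * (1 / 2) ^ p)"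
      unfolding four by (simp add: mult_ac)
  qed (use b in auto)
  have V: "summable (\<lambda>p. 512 * b * (1 / 8) ^ p * (unit_ball_vol 2 * (4 * 2 ^ p)\<^sup>2))"
  proof -
    have "512 * b * (1 / 8) ^ p * (unit_ball_vol 2 * (4 * 2 ^ p)\<^sup>2) = 512 * b * unit_ball_vol 2 * 16 * (1 / 2) ^ p" for p
      using four[of p] by (simp add: mult_ac)
    then show ?thesis by (simp only:) (intro summable_mult summable_geometric, simp)
  qed
  have "AE X in P. summable (\<lambda>p. if p \<ge> p0 then \<bar>Fluct (?\<phi> 1 1 p) X\<bar> else 0)
      \<and> summable (\<lambda>p. if p \<ge> p0 then \<bar>Fluct (?\<phi> \<i> 1 p) X\<bar> else 0)
      \<and> summable (\<lambda>p. if p \<ge> p0 then \<bar>Fluct (?\<phi> 1 2 p) X\<bar> else 0)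
      \<and> summable (\<lambda>p. if p \<ge> p0 then \<bar>Fluct (?\<phi> \<i> 2 p) X\<bar> else 0)"
    using F[of 1 1] F[of \<i> 1] F[of 1 2] F[of \<i> 2] by auto
  with N show ?thesis
  proof eventually_elim
    case (elim X)
    \<comment> \<open>The first \<open>p0\<close> shells lie below the scale of the moment bounds;
      finitely many terms do not affect summability.\<close>
    have drop: "summable f" if "summable (\<lambda>p. if p \<ge> p0 then f p else 0)" for f :: "nat \<Rightarrow> real"
      by (rule iffD1[OF summable_cong that]) (rule eventually_mono[OF eventually_ge_at_top[of p0]], simp)
    have e: "summable (\<lambda>p. 512 * b * (1 / 8) ^ p * real (Pts X (cball 0 (4 * 2 ^ p))))"
      and d: "summable (\<lambda>p. \<bar>Fluct (?\<phi> 1 1 p) X\<bar>)" "summable (\<lambda>p. \<bar>Fluct (?\<phi> \<i> 1 p) X\<bar>)"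
        "summable (\<lambda>p. \<bar>Fluct (?\<phi> 1 2 p) X\<bar>)" "summable (\<lambda>p. \<bar>Fluct (?\<phi> \<i> 2 p) X\<bar>)"
    proof -
      note el = elim(2)
      show "summable (\<lambda>p. 512 * b * (1 / 8) ^ p * real (Pts X (cball 0 (4 * 2 ^ p))))" by (rule elim(1))
      show "summable (\<lambda>p. \<bar>Fluct (?\<phi> 1 1 p) X\<bar>)" by (rule drop[OF conjunct1[OF el]])
      show "summable (\<lambda>p. \<bar>Fluct (?\<phi> \<i> 1 p) X\<bar>)" by (rule drop[OF conjunct1[OF conjunct2[OF el]]])
      show "summable (\<lambda>p. \<bar>Fluct (?\<phi> 1 2 p) X\<bar>)" by (rule drop[OF conjunct1[OF conjunct2[OF conjunct2[OF el]]]])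
      show "summable (\<lambda>p. \<bar>Fluct (?\<phi> \<i> 2 p) X\<bar>)" by (rule drop[OF conjunct2[OF conjunct2[OF conjunct2[OF el]]]])
    qed
    show ?case unfolding shell_error_def distrib_left
      by (intro summable_add d e V)
  qed
qed

section \<open>Convergence and translation covariance of the moving energy\<close>

definition dyadic_sum :: "(nat \<Rightarrow> plane \<Rightarrow> real) \<Rightarrow> nat \<Rightarrow> plane \<Rightarrow> real" where
  "dyadic_sum chi p y = (\<Sum>i\<le>p. chi i y)"

context
  fixes chi :: "nat \<Rightarrow> plane \<Rightarrow> real" and Cchi :: real
  assumes dy: "dyadic_partition chi Cchi"
begin

section \<open>Supports and smoothness scales of the dyadic partition\<close>

lemma chi_zero:
  "norm y > 2 ^ (i + 1) \<Longrightarrow> chi i y = 0"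
  "i \<ge> 1 \<Longrightarrow> norm y \<le> 2 ^ (i - 1) \<Longrightarrow> chi i y = 0"
proof -
  assume y: "norm y > 2 ^ (i + 1)"
  show "chi i y = 0"
  proof (cases "i = 0")
    case True
    then show ?thesis using dy y unfolding dyadic_partition_def by auto
  next
    case False
    have "y \<notin> cball 0 (2 ^ (i + 1)) - cball 0 (2 ^ (i - 1))" using y by simp
    then show ?thesis using dy False unfolding dyadic_partition_def by (metis One_nat_def Suc_leI neq0_conv)
  qed
next
  assume i: "i \<ge> 1" and y: "norm y \<le> 2 ^ (i - 1)"
  have "y \<notin> cball 0 (2 ^ (i + 1)) - cball 0 (2 ^ (i - 1))" using y by simp
  then show "chi i y = 0" using dy i unfolding dyadic_partition_def by blast
qed

lemma smooth_chi: "smooth_upto 3 UNIV (chi i) Cchi (1 / 2 ^ i)"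
proof (rule smooth_uptoI)
  show "Ck 3 (chi i)" using dy unfolding dyadic_partition_def by blast
  fix vs :: "plane list" and x assume vs: "length vs \<le> 3" "\<forall>v\<in>set vs. norm v \<le> 1"
  have "dnorm (length vs) (chi i) \<le> ereal (Cchi / 2 ^ (i * length vs))"
    using dy vs(1) unfolding dyadic_partition_def by blast
  from dnormD[OF this refl vs(2)]
  show "\<bar>deriv_at (chi i) vs x\<bar> \<le> Cchi * (1 / 2 ^ i) ^ length vs"
    by (simp add: power_divide power_mult[symmetric])
qed

lemma Cchi_nonneg: "Cchi \<ge> 0"
  using smooth_upto_bound[OF smooth_chi[of 0], of 0] by force

lemma continuous_chi: "continuous_on UNIV (chi i)"
  using smooth_upto_continuous[OF smooth_chi] .

lemma measurable_chi [measurable]: "chi i \<in> borel_measurable borel"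
  using continuous_chi by (rule borel_measurable_continuous_onI)

lemma dyadic_sum_zero: "norm y > 2 ^ (p + 1) \<Longrightarrow> dyadic_sum chi p y = 0"
proof -
  assume y: "norm y > 2 ^ (p + 1)"
  have "chi i y = 0" if "i \<le> p" for i
  proof (rule chi_zero(1))
    have "(2::real) ^ (i + 1) \<le> 2 ^ (p + 1)" using that by (intro power_increasing) auto
    then show "norm y > 2 ^ (i + 1)" using y by linarith
  qed
  then show ?thesis unfolding dyadic_sum_def by simp
qed

lemma dyadic_sum_one: "norm y \<le> 2 ^ p \<Longrightarrow> dyadic_sum chi p y = 1"
proof -
  assume y: "norm y \<le> 2 ^ p"
  have "chi i y = 0" if "i \<notin> {..p}" for i
  proof (rule chi_zero(2))
    have "(2::real) ^ p \<le> 2 ^ (i - 1)" using that by (intro power_increasing) auto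
    then show "norm y \<le> 2 ^ (i - 1)" using y by linarith
  qed (use that in auto)
  then have "(\<lambda>i. chi i y) sums (\<Sum>i\<le>p. chi i y)" by (intro sums_finite) auto
  moreover have "(\<lambda>i. chi i y) sums 1" using dy unfolding dyadic_partition_def by blast
  ultimately show ?thesis unfolding dyadic_sum_def using sums_unique2 by blast
qed

lemma continuous_dyadic_sum: "continuous_on UNIV (dyadic_sum chi p)"
  unfolding dyadic_sum_def by (intro continuous_intros continuous_chi)

lemma cutoff_dyadic_sum: "cutoff (dyadic_sum chi p)"
  by (rule cutoff_continuous[OF continuous_dyadic_sum, of 0 "2 ^ (p + 1)"]) (auto intro!: dyadic_sum_zero)

lemma cutoff_dyadic_sum_translation: "cutoff (\<lambda>y. dyadic_sum chi p (y + v))"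
proof (rule cutoff_continuous[of _ "- v" "2 ^ (p + 1)"])
  show "continuous_on UNIV (\<lambda>y. dyadic_sum chi p (y + v))"
    by (intro continuous_on_compose2[OF continuous_dyadic_sum] continuous_intros) auto
  show "dyadic_sum chi p (y + v) = 0" if "y \<notin> cball (- v) (2 ^ (p + 1))" for y
    using that by (intro dyadic_sum_zero) (auto simp: dist_norm norm_minus_commute add.commute norm_minus_cancel[of "y + v", symmetric])
qed

lemma shell_cutoffs_chi: "shell_cutoffs (Cchi + 1) 1 chi"
  unfolding shell_cutoffs_def
proof (intro allI impI conjI)
  fix p :: nat assume p: "1 \<le> p"
  show "smooth_upto 3 UNIV (chi p) (Cchi + 1) (8 / 2 ^ p)"
    by (rule smooth_upto_mono[OF smooth_chi]) (auto simp: Cchi_nonneg divide_right_mono)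
  fix y :: plane assume y: "norm y < 2 ^ p / 4 \<or> 4 * 2 ^ p < norm y"
  have "(2::real) ^ p = 2 * 2 ^ (p - 1)" using p by (cases p) auto
  then have "2 ^ (p - 1) \<ge> (2::real) ^ p / 4" by simp
  then consider "norm y \<le> 2 ^ (p - 1)" | "norm y > 2 ^ (p + 1)"
    using y zero_less_power[of "2::real" p] by force
  then show "chi p y = 0" using chi_zero p by cases auto
qed

text \<open>Early members of the partition vary fast, but a partial sum is identically 1 on the disk
  of radius 2^p, and beyond radius 2^(p-1) only its last two members survive. So its derivatives
  live at scale 2^p.\<close>

lemma smooth_dyadic_sum:
  assumes "p \<ge> 2"
  shows "smooth_upto 3 UNIV (dyadic_sum chi p) (2 * Cchi + 1) (8 / 2 ^ p)"
proof -
  let ?U = "ball (0::plane) (2 ^ p)" and ?V = "{y :: plane. norm y > 2 ^ (p - 1)}"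
  have op: "open ?V" by (intro open_Collect_less continuous_intros)
  obtain q where p: "p = Suc (Suc q)" using assms by (metis add_2_eq_Suc le_Suc_ex)
  have U: "smooth_upto 3 ?U (dyadic_sum chi p) (2 * Cchi + 1) (8 / 2 ^ p)"
  proof (rule smooth_upto_cong)
    show "smooth_upto 3 ?U (\<lambda>y. 1) (2 * Cchi + 1) (8 / 2 ^ p)"
      using Cchi_nonneg by (intro smooth_upto_const) auto
  qed (use dyadic_sum_one[symmetric] in auto)
  have V: "smooth_upto 3 ?V (dyadic_sum chi p) (2 * Cchi + 1) (8 / 2 ^ p)"
  proof (rule smooth_upto_cong[OF op])
    have "smooth_upto 3 ?V (\<lambda>y. chi (Suc q) y + chi p y) (Cchi + Cchi) (8 / 2 ^ p)"
      using Cchi_nonneg by (intro smooth_upto_add[OF op] smooth_upto_mono[OF smooth_chi]) (auto simp: p divide_simps)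
    then show "smooth_upto 3 ?V (\<lambda>y. chi (Suc q) y + chi p y) (2 * Cchi + 1) (8 / 2 ^ p)"
      by (rule smooth_upto_mono) (auto simp: Cchi_nonneg)
    fix y :: plane assume y: "y \<in> ?V"
    have "chi i y = 0" if "i \<le> q" for i
    proof (rule chi_zero(1))
      have "(2::real) ^ (i + 1) \<le> 2 ^ (p - 1)" using that p by (intro power_increasing) auto
      then show "norm y > 2 ^ (i + 1)" using y by simp
    qed
    then have "(\<Sum>i\<le>q. chi i y) = 0" by simp
    then show "chi (Suc q) y + chi p y = dyadic_sum chi p y" by (simp add: dyadic_sum_def p)
  qed
  have "norm y < 2 ^ p \<or> norm y > 2 ^ (p - 1)" for y :: plane
  proof -
    have "(2::real) ^ (p - 1) < 2 ^ p" by (simp add: p)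
    then show ?thesis by linarith
  qed
  then have "y \<in> ?U \<union> ?V" for y by (simp only: Un_iff mem_ball mem_Collect_eq dist_0_norm)
  then have "?U \<union> ?V = UNIV" by blast
  then show ?thesis using smooth_upto_Un[OF open_ball op U V] by simp
qed

text \<open>For p \<ge> 2 a shift by at most 1 is small against 2^p: both partial sums are 1 deep
  inside and 0 far outside. Only the location and smoothness of the difference are recorded; decay
  comes from the modes of the potential.\<close>

lemma shell_cutoffs_translation:
  assumes "norm v \<le> 1"
  shows "shell_cutoffs (4 * Cchi + 2) 2 (\<lambda>p y. dyadic_sum chi p y - dyadic_sum chi p (y + v))"
  unfolding shell_cutoffs_def
proof (intro allI impI conjI)
  fix p :: nat assume p: "2 \<le> p"
  have "smooth_upto 3 UNIV (\<lambda>y. dyadic_sum chi p y + (-1) * dyadic_sum chi p (y + v)) ((2 * Cchi + 1) + \<bar>-1\<bar> * (2 * Cchi + 1)) (8 / 2 ^ p)"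
    by (intro smooth_upto_add smooth_upto_scale smooth_upto_translation smooth_dyadic_sum p open_UNIV)
  then show "smooth_upto 3 UNIV (\<lambda>y. dyadic_sum chi p y - dyadic_sum chi p (y + v)) (4 * Cchi + 2) (8 / 2 ^ p)"
    by simp
  have 4: "(4::real) \<le> 2 ^ p" using power_increasing[of 2 p "2::real"] p by simp
  fix y :: plane assume y: "norm y < 2 ^ p / 4 \<or> 4 * 2 ^ p < norm y"
  then show "dyadic_sum chi p y - dyadic_sum chi p (y + v) = 0"
  proof
    assume "norm y < 2 ^ p / 4"
    then have "norm y \<le> 2 ^ p" "norm (y + v) \<le> 2 ^ p"
      using norm_triangle_ineq[of y v] assms 4 by linarith+
    then show ?thesis by (simp add: dyadic_sum_one)
  next
    assume y: "4 * 2 ^ p < norm y"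
    have "norm y \<le> norm (y + v) + norm v" using norm_triangle_ineq4[of "y + v" v] by simp
    then have "norm y > 2 ^ (p + 1)" "norm (y + v) > 2 ^ (p + 1)" using y 4 assms by (simp_all)
    then show ?thesis by (simp add: dyadic_sum_zero)
  qed
qed

text \<open>Only differences of potential are bounded, since the constant mode need not converge.
  The condition 8 R \<le> 2^p keeps the shell away from \<open>\<Lambda>\<close>.\<close>

lemma ext_pot_shell_bound:
  assumes \<eta>: "shell_cutoffs b p0 \<eta>" "p \<ge> p0" "b > 0" and R: "8 * R \<le> 2 ^ p" "\<Lambda> \<subseteq> cball 0 R" "R \<ge> 0" and x: "norm x \<le> R"
  shows "\<bar>ext_pot X \<Lambda> (\<eta> p) x - ext_pot X \<Lambda> (\<eta> p) 0\<bar> \<le> 2 * (1 + R) ^ 3 * \<bar>shell_error b \<eta> p X\<bar>"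
proof -
  have "\<eta> p y = 0" if "norm y \<le> R" for y
  proof -
    have "norm y < 2 ^ p / 4" using that R zero_less_power[of "2::real" p] by linarith
    then show ?thesis using \<eta> unfolding shell_cutoffs_def by auto
  qed
  then have eq: "ext_pot X \<Lambda> (\<eta> p) x - ext_pot X \<Lambda> (\<eta> p) 0
    = Fluct (\<lambda>y. (ln (norm y) - ln (dist x y)) * \<eta> p y) X - Fluct (\<lambda>y. (ln (norm y) - ln (dist 0 y)) * \<eta> p y) X"
    by (intro ext_pot_far[OF shell_cutoffsD(3)[OF \<eta>, of 0 0] _ R(2)]) auto
  have b: "\<bar>Fluct (\<lambda>y. (ln (norm y) - ln (dist z y)) * \<eta> p y) X\<bar> \<le> (1 + R) ^ 3 * \<bar>shell_error b \<eta> p X\<bar>" if "norm z \<le> R" for z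
  proof -
    have "\<bar>Fluct (\<lambda>y. (ln (norm y) - ln (dist z y)) * \<eta> p y) X\<bar> \<le> (1 + norm z) ^ 3 * shell_error b \<eta> p X"
      by (rule Fluct_log_bound[OF \<eta>]) (use that R in linarith)
    also have "\<dots> \<le> (1 + R) ^ 3 * \<bar>shell_error b \<eta> p X\<bar>"
    proof (rule order_trans)
      show "(1 + norm z) ^ 3 * shell_error b \<eta> p X \<le> (1 + norm z) ^ 3 * \<bar>shell_error b \<eta> p X\<bar>"
        by (intro mult_left_mono) auto
      show "(1 + norm z) ^ 3 * \<bar>shell_error b \<eta> p X\<bar> \<le> (1 + R) ^ 3 * \<bar>shell_error b \<eta> p X\<bar>"
        using that by (intro mult_right_mono power_mono) auto
    qed
    finally show ?thesis .
  qed
  show ?thesis unfolding eq using b[OF x] b[of 0] R(3) by simp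
qed

text \<open>Consecutive partial sums differ by one shell, so the increments are dominated by the
  summable \<open>shell_error\<close>. This bound does not involve \<open>x\<close>, hence one null
  set serves every \<open>x\<close> in \<open>\<Lambda>\<close>.\<close>

lemma AE_ext_pot_convergent:
  assumes sets: "sets P = sets borel" and good: "good_smooth C \<rho>\<beta> P" "good_intensity C P" and C: "C > 0"
    and \<Lambda>: "\<Lambda> \<in> sets borel" "bounded \<Lambda>"
  shows "AE X in P. \<exists>G. \<forall>x\<in>\<Lambda>. (\<lambda>p. ext_pot X \<Lambda> (dyadic_sum chi p) x - ext_pot X \<Lambda> (dyadic_sum chi p) 0) \<longlonglongrightarrow> G x"
proof -
  obtain p1 :: nat where p1: "\<rho>\<beta> < 2 ^ p1" using real_arch_pow[of 2 \<rho>\<beta>] by auto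
  define p0 where "p0 = max 1 p1"
  have "(2::real) ^ p1 \<le> 2 ^ p0" by (intro power_increasing) (auto simp: p0_def)
  then have p0: "2 ^ p0 \<ge> \<rho>\<beta>" using p1 by linarith
  have sc: "shell_cutoffs (Cchi + 1) p0 chi" using shell_cutoffs_chi unfolding shell_cutoffs_def p0_def by auto
  have b: "Cchi + 1 > 0" using Cchi_nonneg by simp
  obtain R0 where R0: "\<And>x. x \<in> \<Lambda> \<Longrightarrow> dist 0 x \<le> R0" using \<Lambda>(2) bounded_any_center[of \<Lambda> 0] by auto
  define R where "R = max R0 0"
  have R: "\<Lambda> \<subseteq> cball 0 R" "R \<ge> 0" using R0 by (fastforce simp: R_def)+
  obtain p2 :: nat where p2: "8 * R < 2 ^ p2" using real_arch_pow[of 2 "8 * R"] by auto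
  show ?thesis using AE_shell_error_summable[OF sets good C b sc p0]
  proof eventually_elim
    case (elim X)
    let ?H = "\<lambda>p x. ext_pot X \<Lambda> (dyadic_sum chi p) x - ext_pot X \<Lambda> (dyadic_sum chi p) 0"
    have "convergent (\<lambda>p. ?H p x)" if x: "x \<in> \<Lambda>" for x
    proof -
      have bnd: "\<bar>?H (Suc p) x - ?H p x\<bar> \<le> 2 * (1 + R) ^ 3 * \<bar>shell_error (Cchi + 1) chi (Suc p) X\<bar>" if p: "p \<ge> max p0 p2" for p
      proof -
        have "(2::real) ^ p2 \<le> 2 ^ Suc p" using p by (intro power_increasing) auto
        then have "8 * R \<le> 2 ^ Suc p" using p2 by linarith
        moreover have "p0 \<le> Suc p" using p by simp
        ultimately have "\<bar>ext_pot X \<Lambda> (chi (Suc p)) x - ext_pot X \<Lambda> (chi (Suc p)) 0\<bar> \<le> 2 * (1 + R) ^ 3 * \<bar>shell_error (Cchi + 1) chi (Suc p) X\<bar>"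
          using R x by (intro ext_pot_shell_bound[OF sc _ b]) auto
        moreover have "(\<lambda>y. dyadic_sum chi (Suc p) y - dyadic_sum chi p y) = chi (Suc p)" by (auto simp: dyadic_sum_def)
        ultimately show ?thesis
          using ext_pot_diff[OF cutoff_dyadic_sum cutoff_dyadic_sum \<Lambda>(1), of X "Suc p" p x]
            ext_pot_diff[OF cutoff_dyadic_sum cutoff_dyadic_sum \<Lambda>(1), of X "Suc p" p 0] by simp
      qed
      have "summable (\<lambda>p. 2 * (1 + R) ^ 3 * \<bar>shell_error (Cchi + 1) chi (Suc p) X\<bar>)"
      proof -
        have "shell_error (Cchi + 1) chi p X \<ge> 0" for p using b by (auto simp: shell_error_def)
        then show ?thesis using elim summable_Suc_iff[of "\<lambda>p. shell_error (Cchi + 1) chi p X"]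
          by (intro summable_mult) simp
      qed
      note S = this
      have "summable (\<lambda>p. ?H (Suc p) x - ?H p x)"
      proof (rule summable_comparison_test'[OF S])
        fix n assume "max p0 p2 \<le> n"
        then show "norm (?H (Suc n) x - ?H n x) \<le> 2 * (1 + R) ^ 3 * \<bar>shell_error (Cchi + 1) chi (Suc n) X\<bar>"
          unfolding real_norm_def by (rule bnd)
      qed
      then have "convergent (\<lambda>n. \<Sum>p<n. ?H (Suc p) x - ?H p x)" by (simp add: summable_iff_convergent)
      then have "convergent (\<lambda>n. ?H n x - ?H 0 x)" using sum_lessThan_telescope[of "\<lambda>p. ?H p x"] by simp
      then show ?thesis by (simp only: convergent_diff_const_right_iff)
    qed
    then show ?case by (intro exI[of _ "\<lambda>x. lim (\<lambda>p. ?H p x)"]) (auto simp: convergent_LIMSEQ_iff)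
  qed
qed

text \<open>Each discrepancy occupies a single shell and is dominated by the corresponding term of a
  summable series, so it tends to 0.\<close>

lemma AE_ext_pot_translation:
  assumes sets: "sets P = sets borel" and good: "good_smooth C \<rho>\<beta> P" "good_intensity C P" and C: "C > 0"
    and \<Lambda>: "\<Lambda> \<in> sets borel" "bounded \<Lambda>" and v: "norm v \<le> 1"
  shows "AE X in P. \<forall>x\<in>\<Lambda>. (\<lambda>p. ext_pot X \<Lambda> (\<lambda>y. dyadic_sum chi p y - dyadic_sum chi p (y + v)) x
       - ext_pot X \<Lambda> (\<lambda>y. dyadic_sum chi p y - dyadic_sum chi p (y + v)) 0) \<longlonglongrightarrow> 0"
proof -
  obtain p1 :: nat where p1: "\<rho>\<beta> < 2 ^ p1" using real_arch_pow[of 2 \<rho>\<beta>] by auto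
  define p0 where "p0 = max 2 p1"
  have "(2::real) ^ p1 \<le> 2 ^ p0" by (intro power_increasing) (auto simp: p0_def)
  then have p0: "2 ^ p0 \<ge> \<rho>\<beta>" using p1 by linarith
  let ?\<eta> = "\<lambda>p y. dyadic_sum chi p y - dyadic_sum chi p (y + v)"
  define b where "b = 4 * Cchi + 2"
  have sc: "shell_cutoffs b p0 ?\<eta>" using shell_cutoffs_translation[OF v] unfolding shell_cutoffs_def p0_def b_def by auto
  have b: "b > 0" using Cchi_nonneg by (simp add: b_def)
  obtain R0 where R0: "\<And>x. x \<in> \<Lambda> \<Longrightarrow> dist 0 x \<le> R0" using \<Lambda>(2) bounded_any_center[of \<Lambda> 0] by auto
  define R where "R = max R0 0"
  have R: "\<Lambda> \<subseteq> cball 0 R" "R \<ge> 0" using R0 by (fastforce simp: R_def)+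
  obtain p2 :: nat where p2: "8 * R < 2 ^ p2" using real_arch_pow[of 2 "8 * R"] by auto
  show ?thesis using AE_shell_error_summable[OF sets good C b sc p0]
  proof eventually_elim
    case (elim X)
    then have 0: "(\<lambda>p. 2 * (1 + R) ^ 3 * \<bar>shell_error b ?\<eta> p X\<bar>) \<longlonglongrightarrow> 0"
      using summable_LIMSEQ_zero by (intro tendsto_mult_right_zero tendsto_rabs_zero)
    show ?case
    proof
      fix x assume x: "x \<in> \<Lambda>"
      show "(\<lambda>p. ext_pot X \<Lambda> (?\<eta> p) x - ext_pot X \<Lambda> (?\<eta> p) 0) \<longlonglongrightarrow> 0"
      proof (rule Lim_null_comparison[OF _ 0], rule eventually_mono[OF eventually_ge_at_top[of "max p0 p2"]])
        fix p assume p: "max p0 p2 \<le> p"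
        have "(2::real) ^ p2 \<le> 2 ^ p" using p by (intro power_increasing) auto
        then have "8 * R \<le> 2 ^ p" using p2 by linarith
        then show "norm (ext_pot X \<Lambda> (?\<eta> p) x - ext_pot X \<Lambda> (?\<eta> p) 0) \<le> 2 * (1 + R) ^ 3 * \<bar>shell_error b ?\<eta> p X\<bar>"
          unfolding real_norm_def
          using R x p by (intro ext_pot_shell_bound[OF sc _ b]) auto
      qed
    qed
  qed
qed

text \<open>Equal numbers of points make the subtracted value at the origin cancel. The limit
  \<open>G\<close> depends on the exterior alone, so it remains valid when the interior of
  \<open>X\<close> is replaced by that of \<open>W\<close>.\<close>

lemma move_limit:
  assumes \<Lambda>: "\<Lambda> \<in> sets borel" "bounded \<Lambda>"
    and G: "\<And>x. x \<in> \<Lambda> \<Longrightarrow> (\<lambda>p. ext_pot X \<Lambda> (dyadic_sum chi p) x - ext_pot X \<Lambda> (dyadic_sum chi p) 0) \<longlonglongrightarrow> G x"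
    and W: "\<And>y. y \<notin> \<Lambda> \<Longrightarrow> mult W y = mult X y" and n: "Pts Z \<Lambda> = Pts W \<Lambda>"
  shows "(\<lambda>p. conf_sum Z \<Lambda> (ext_pot W \<Lambda> (dyadic_sum chi p)) - conf_sum W \<Lambda> (ext_pot W \<Lambda> (dyadic_sum chi p)))
      \<longlonglongrightarrow> conf_sum Z \<Lambda> G - conf_sum W \<Lambda> G"
    "move chi \<Lambda> Z W = conf_sum Z \<Lambda> G - conf_sum W \<Lambda> G"
proof -
  have eq: "ext_pot W \<Lambda> (dyadic_sum chi p) = ext_pot X \<Lambda> (dyadic_sum chi p)" for p
    by (intro ext ext_pot_cong cutoff_dyadic_sum \<Lambda> W)
  let ?H = "\<lambda>p x. ext_pot X \<Lambda> (dyadic_sum chi p) x - ext_pot X \<Lambda> (dyadic_sum chi p) 0"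
  have "(\<lambda>p. conf_sum Z \<Lambda> (?H p) - conf_sum W \<Lambda> (?H p)) \<longlonglongrightarrow> conf_sum Z \<Lambda> G - conf_sum W \<Lambda> G"
    by (intro tendsto_diff tendsto_conf_sum G)
  then show *: "(\<lambda>p. conf_sum Z \<Lambda> (ext_pot W \<Lambda> (dyadic_sum chi p)) - conf_sum W \<Lambda> (ext_pot W \<Lambda> (dyadic_sum chi p)))
      \<longlonglongrightarrow> conf_sum Z \<Lambda> G - conf_sum W \<Lambda> G"
    unfolding conf_sum_diff conf_sum_const n eq by simp
  have "move chi \<Lambda> Z W = lim (\<lambda>p. conf_sum Z \<Lambda> (ext_pot W \<Lambda> (dyadic_sum chi p)) - conf_sum W \<Lambda> (ext_pot W \<Lambda> (dyadic_sum chi p)))"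
    using move_conf_sum[OF \<Lambda>, of chi Z W] cutoff_dyadic_sum unfolding dyadic_sum_def[abs_def] by simp
  then show "move chi \<Lambda> Z W = conf_sum Z \<Lambda> G - conf_sum W \<Lambda> G" using limI[OF *] by simp
qed

text \<open>The order of quantifiers matters: a single \<open>G\<close> for all \<open>Z\<close> and
  \<open>W\<close> makes \<open>move\<close> a difference of sums, so changing the reference
  configuration changes it by a constant only.\<close>

lemma AE_move_formula:
  assumes "sets P = sets borel" "good_smooth C \<rho>\<beta> P" "good_intensity C P" "C > 0"
    and \<Lambda>: "\<Lambda> \<in> sets borel" "bounded \<Lambda>"
  shows "AE X in P. \<exists>G. \<forall>Z W. (\<forall>y. y \<notin> \<Lambda> \<longrightarrow> mult W y = mult X y) \<longrightarrow> Pts Z \<Lambda> = Pts W \<Lambda> \<longrightarrow>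
     move chi \<Lambda> Z W = conf_sum Z \<Lambda> G - conf_sum W \<Lambda> G"
  using AE_ext_pot_convergent[OF assms] by eventually_elim (use move_limit(2)[OF \<Lambda>] in blast)

text \<open>Pulling the translated problem back translates the cutoffs. The two sequences of cut-off
  energies then differ by potential differences that vanish in the limit, because \<open>Z\<close>
  and \<open>X\<close> have equally many points in \<open>\<Lambda>\<close>.\<close>

lemma AE_move_translation:
  assumes "sets P = sets borel" "good_smooth C \<rho>\<beta> P" "good_intensity C P" "C > 0"
    and \<Lambda>: "\<Lambda> \<in> sets borel" "bounded \<Lambda>" and v: "norm v \<le> 1"
  shows "AE X in P. \<forall>Z. Pts Z \<Lambda> = Pts X \<Lambda> \<longrightarrow>
     move chi ((\<lambda>x. x + v) ` \<Lambda>) (push (\<lambda>x. x + v) Z) (push (\<lambda>x. x + v) X) = move chi \<Lambda> Z X"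
  using AE_ext_pot_convergent[OF assms(1-6)] AE_ext_pot_translation[OF assms]
proof eventually_elim
  case (elim X)
  obtain G where G: "\<And>x. x \<in> \<Lambda> \<Longrightarrow> (\<lambda>p. ext_pot X \<Lambda> (dyadic_sum chi p) x - ext_pot X \<Lambda> (dyadic_sum chi p) 0) \<longlonglongrightarrow> G x"
    using elim(1) by auto
  let ?T = "\<lambda>x::plane. x + v"
  let ?\<eta> = "\<lambda>p y. dyadic_sum chi p y - dyadic_sum chi p (y + v)"
  have T\<Lambda>: "?T ` \<Lambda> \<in> sets borel" "bounded (?T ` \<Lambda>)"
    unfolding tame_bijD(7)[OF tame_bij_translation]
    using measurable_sets[OF tame_bijD(4)[OF tame_bij_translation[of v]] \<Lambda>(1)]
      tame_bij_bounded_vimage[OF tame_bij_sym[OF tame_bij_translation] \<Lambda>(2)] by simp_all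
  show ?case
  proof (intro allI impI)
    fix Z assume n: "Pts Z \<Lambda> = Pts X \<Lambda>"
    have [measurable]: "dyadic_sum chi p \<in> borel_measurable borel" for p
      using continuous_dyadic_sum by (rule borel_measurable_continuous_onI)
    let ?a = "\<lambda>p. conf_sum Z \<Lambda> (ext_pot X \<Lambda> (dyadic_sum chi p)) - conf_sum X \<Lambda> (ext_pot X \<Lambda> (dyadic_sum chi p))"
    let ?b = "\<lambda>p. conf_sum (push ?T Z) (?T ` \<Lambda>) (ext_pot (push ?T X) (?T ` \<Lambda>) (dyadic_sum chi p)) - conf_sum (push ?T X) (?T ` \<Lambda>) (ext_pot (push ?T X) (?T ` \<Lambda>) (dyadic_sum chi p))"
    let ?D = "\<lambda>p x. ext_pot X \<Lambda> (?\<eta> p) x - ext_pot X \<Lambda> (?\<eta> p) 0"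
    have a: "?a \<longlonglongrightarrow> conf_sum Z \<Lambda> G - conf_sum X \<Lambda> G" "move chi \<Lambda> Z X = conf_sum Z \<Lambda> G - conf_sum X \<Lambda> G"
      by (rule move_limit[OF \<Lambda> G, of X Z]; use n in simp)+
    have d: "(\<lambda>p. conf_sum Z \<Lambda> (?D p) - conf_sum X \<Lambda> (?D p)) \<longlonglongrightarrow> conf_sum Z \<Lambda> (\<lambda>_. 0) - conf_sum X \<Lambda> (\<lambda>_. 0)"
      by (intro tendsto_diff tendsto_conf_sum) (use elim(2) in auto)
    have "?b p = ?a p - (conf_sum Z \<Lambda> (?D p) - conf_sum X \<Lambda> (?D p))" for p
    proof -
      have "ext_pot X \<Lambda> (?\<eta> p) x = ext_pot X \<Lambda> (dyadic_sum chi p) x - ext_pot X \<Lambda> (\<lambda>y. dyadic_sum chi p (y + v)) x" for x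
        by (rule ext_pot_diff[OF cutoff_dyadic_sum cutoff_dyadic_sum_translation \<Lambda>(1)])
      moreover have "?b p = conf_sum Z \<Lambda> (ext_pot X \<Lambda> (\<lambda>y. dyadic_sum chi p (y + v))) - conf_sum X \<Lambda> (ext_pot X \<Lambda> (\<lambda>y. dyadic_sum chi p (y + v)))"
        unfolding conf_sum_push[OF tame_bij_translation] using \<Lambda> by (simp add: ext_pot_translation)
      ultimately show ?thesis by (simp add: conf_sum_diff conf_sum_const n)
    qed
    then have "?b \<longlonglongrightarrow> conf_sum Z \<Lambda> G - conf_sum X \<Lambda> G"
      using tendsto_diff[OF a(1) d] by (simp add: conf_sum_const)
    moreover have "move chi (?T ` \<Lambda>) (push ?T Z) (push ?T X) = lim ?b"
      using move_conf_sum[OF T\<Lambda>, of chi] cutoff_dyadic_sum unfolding dyadic_sum_def[abs_def] by simp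
    ultimately show "move chi (?T ` \<Lambda>) (push ?T Z) (push ?T X) = move chi \<Lambda> Z X"
      using a(2) limI[OF \<open>?b \<longlonglongrightarrow> conf_sum Z \<Lambda> G - conf_sum X \<Lambda> G\<close>] by (simp only:)
  qed
qed

end

section \<open>Resampling kernels\<close>

text \<open>The null measure for a zero partition function mirrors the convention 1 / 0 = 0 in the
  DLR equations. The value 0 also stands for a non-integrable Boltzmann weight.\<close>

definition gibbs_kernel :: "real \<Rightarrow> (nat \<Rightarrow> plane \<Rightarrow> real) \<Rightarrow> plane set \<Rightarrow> conf \<Rightarrow> conf measure" where
  "gibbs_kernel \<beta> chi \<Lambda> X =
     (if partition_function \<beta> chi \<Lambda> X = 0 then null_measure borel
      else distr (density (Bin \<Lambda> (Pts X \<Lambda>)) (\<lambda>X'. ennreal (boltzmann \<beta> chi \<Lambda> X' X / partition_function \<beta> chi \<Lambda> X)))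
        borel (\<lambda>X'. union_conf X' (restr X (- \<Lambda>))))"

lemma sets_gibbs_kernel [simp, measurable_cong]: "sets (gibbs_kernel \<beta> chi \<Lambda> X) = sets borel"
  by (simp add: gibbs_kernel_def)

lemma space_gibbs_kernel [simp]: "space (gibbs_kernel \<beta> chi \<Lambda> X) = UNIV"
  by (simp add: gibbs_kernel_def)

text \<open>\<open>B\<close> is preserved, up to null sets, by resampling inside balls: this replaces tail-measurability.\<close>

definition resampling_invariant ::
  "real \<Rightarrow> (nat \<Rightarrow> plane \<Rightarrow> real) \<Rightarrow> conf measure \<Rightarrow> conf set \<Rightarrow> bool" where
  "resampling_invariant \<beta> chi P B \<longleftrightarrow> B \<in> sets borel \<and>
     (\<forall>a r. r > 0 \<longrightarrow> (AE X in P. emeasure (gibbs_kernel \<beta> chi (cball a r) X) B = indicator B X))"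

lemma boltzmann_pos: "boltzmann \<beta> chi \<Lambda> X' X > 0"
  by (simp add: boltzmann_def)

lemma push_union_restr:
  assumes T: "tame_bij T T'"
  shows "push T (union_conf Z (restr X (- \<Lambda>))) = union_conf (push T Z) (restr (push T X) (- (T ` \<Lambda>)))"
proof -
  have "T ` (- \<Lambda>) = - (T ` \<Lambda>)" unfolding tame_bijD(7)[OF T] by auto
  then show ?thesis by (simp add: push_union[OF T] push_restr[OF T])
qed

context
  fixes \<beta> Cchi :: real and chi :: "nat \<Rightarrow> plane \<Rightarrow> real"
  assumes dy: "dyadic_partition chi Cchi"
begin

lemma measurable_boltzmann [measurable]:
  assumes "\<Lambda> \<in> sets borel"
  shows "(\<lambda>X'. boltzmann \<beta> chi \<Lambda> X' X) \<in> borel_measurable borel"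
  unfolding boltzmann_def
  using measurable_energy[of "\<lambda>X. X" borel \<Lambda>] measurable_move[of "\<lambda>X. X" borel "\<lambda>_. X" \<Lambda> chi] assms measurable_chi[OF dy]
  by measurable

lemma partition_function_nonneg: "partition_function \<beta> chi \<Lambda> X \<ge> 0"
  unfolding partition_function_def
  by (rule Bochner_Integration.integral_nonneg) (simp add: boltzmann_pos less_imp_le)

lemma integrable_boltzmann:
  assumes "partition_function \<beta> chi \<Lambda> X \<noteq> 0"
  shows "integrable (Bin \<Lambda> (Pts X \<Lambda>)) (\<lambda>X'. boltzmann \<beta> chi \<Lambda> X' X)"
  using assms not_integrable_integral_eq unfolding partition_function_def by blast

lemma nn_integral_gibbs_kernel:
  assumes [measurable]: "\<Lambda> \<in> sets borel" "f \<in> borel_measurable borel" and K: "partition_function \<beta> chi \<Lambda> X \<noteq> 0"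
  shows "(\<integral>\<^sup>+Y. f Y \<partial>gibbs_kernel \<beta> chi \<Lambda> X)
    = (\<integral>\<^sup>+X'. ennreal (boltzmann \<beta> chi \<Lambda> X' X / partition_function \<beta> chi \<Lambda> X) * f (union_conf X' (restr X (- \<Lambda>))) \<partial>Bin \<Lambda> (Pts X \<Lambda>))"
proof -
  note [measurable] = measurable_union_conf[of "restr X (- \<Lambda>)"]
  show ?thesis unfolding gibbs_kernel_def using K
    by (simp add: nn_integral_distr nn_integral_density)
qed

lemma prob_gibbs_kernel:
  assumes \<Lambda>: "\<Lambda> \<in> sets borel" and K: "partition_function \<beta> chi \<Lambda> X \<noteq> 0"
  shows "prob_space (gibbs_kernel \<beta> chi \<Lambda> X)"
proof
  let ?K = "partition_function \<beta> chi \<Lambda> X"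
  have K0: "?K > 0" using K partition_function_nonneg[of \<Lambda> X] by linarith
  have "emeasure (gibbs_kernel \<beta> chi \<Lambda> X) UNIV = (\<integral>\<^sup>+Y. 1 \<partial>gibbs_kernel \<beta> chi \<Lambda> X)" by simp
  also have "\<dots> = (\<integral>\<^sup>+X'. ennreal (boltzmann \<beta> chi \<Lambda> X' X / ?K) \<partial>Bin \<Lambda> (Pts X \<Lambda>))"
    by (subst nn_integral_gibbs_kernel[OF \<Lambda> _ K]) auto
  also have "\<dots> = ennreal (LINT X'|Bin \<Lambda> (Pts X \<Lambda>). boltzmann \<beta> chi \<Lambda> X' X / ?K)"
    using integrable_boltzmann[OF K] K0 by (intro nn_integral_eq_integral) (auto simp: boltzmann_pos less_imp_le)
  also have "\<dots> = 1" using K0 by (simp add: partition_function_def)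
  finally show "emeasure (gibbs_kernel \<beta> chi \<Lambda> X) (space (gibbs_kernel \<beta> chi \<Lambda> X)) = 1" by simp
qed

lemma subprob_gibbs_kernel:
  assumes \<Lambda>: "\<Lambda> \<in> sets borel"
  shows "subprob_space (gibbs_kernel \<beta> chi \<Lambda> X)"
proof (cases "partition_function \<beta> chi \<Lambda> X = 0")
  case True
  then show ?thesis by (intro subprob_spaceI) (auto simp: gibbs_kernel_def)
qed (use prob_gibbs_kernel[OF \<Lambda>] prob_space_imp_subprob_space in blast)

lemma measure_gibbs_kernel:
  assumes [measurable]: "\<Lambda> \<in> sets borel" "A \<in> sets borel"
  shows "measure (gibbs_kernel \<beta> chi \<Lambda> X) A = 1 / partition_function \<beta> chi \<Lambda> X *
     (LINT X'|Bin \<Lambda> (Pts X \<Lambda>). indicator A (union_conf X' (restr X (- \<Lambda>))) * boltzmann \<beta> chi \<Lambda> X' X)"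
proof (cases "partition_function \<beta> chi \<Lambda> X = 0")
  case True
  then show ?thesis by (simp add: gibbs_kernel_def measure_def)
next
  case K: False
  let ?K = "partition_function \<beta> chi \<Lambda> X"
  have K0: "?K > 0" using K partition_function_nonneg[of \<Lambda> X] by linarith
  note [measurable] = measurable_union_conf[of "restr X (- \<Lambda>)"]
  let ?u = "\<lambda>X'. union_conf X' (restr X (- \<Lambda>))"
  have int: "integrable (Bin \<Lambda> (Pts X \<Lambda>)) (\<lambda>X'. indicator A (?u X') * boltzmann \<beta> chi \<Lambda> X' X)"
    by (rule Bochner_Integration.integrable_bound[OF integrable_boltzmann[OF K]])
       (auto simp: indicator_def)
  have "emeasure (gibbs_kernel \<beta> chi \<Lambda> X) A = (\<integral>\<^sup>+Y. indicator A Y \<partial>gibbs_kernel \<beta> chi \<Lambda> X)" by simp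
  also have "\<dots> = (\<integral>\<^sup>+X'. ennreal (1 / ?K * (indicator A (?u X') * boltzmann \<beta> chi \<Lambda> X' X)) \<partial>Bin \<Lambda> (Pts X \<Lambda>))"
    by (subst nn_integral_gibbs_kernel[OF _ _ K]) (auto intro!: nn_integral_cong simp: indicator_def)
  also have "\<dots> = ennreal (LINT X'|Bin \<Lambda> (Pts X \<Lambda>). 1 / ?K * (indicator A (?u X') * boltzmann \<beta> chi \<Lambda> X' X))"
    using K0 by (intro nn_integral_eq_integral integrable_mult_right int) (auto simp: boltzmann_pos less_imp_le)
  finally show ?thesis using K0
    by (simp add: measure_def Bochner_Integration.integral_nonneg boltzmann_pos less_imp_le)
qed

context
  fixes P :: "conf measure"
  assumes sets_P: "sets P = sets borel" and prob_P: "prob_space P" and dlr: "DLR \<beta> chi P"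
begin

text \<open>Joint measurability of the kernels is not established directly. A Bochner integral with
  nonzero value has an integrable integrand, so suitable test functions in the DLR equations yield
  integrability.\<close>

lemma dlr_indicator:
  assumes \<Lambda>: "fat \<Lambda>" and A: "A \<in> sets borel"
  shows "integrable P (\<lambda>X. measure (gibbs_kernel \<beta> chi \<Lambda> X) A)"
    "(LINT X|P. measure (gibbs_kernel \<beta> chi \<Lambda> X) A) = measure P A"
proof -
  interpret P: prob_space P by (rule prob_P)
  have m[measurable]: "\<Lambda> \<in> sets borel" "bounded \<Lambda>" using \<Lambda> by (auto simp: fat_def)
  note [measurable] = A
  have space_P: "space P = UNIV" using sets_eq_imp_space_eq[OF sets_P] by simp
  have AP: "A \<in> sets P" using A sets_P by simp
  let ?g = "\<lambda>A X. measure (gibbs_kernel \<beta> chi \<Lambda> X) A"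
  let ?u = "\<lambda>X X'. union_conf X' (restr X (- \<Lambda>))"
  let ?G = "\<lambda>f X. 1 / partition_function \<beta> chi \<Lambda> X * (LINT X'|Bin \<Lambda> (Pts X \<Lambda>). f (?u X X') * boltzmann \<beta> chi \<Lambda> X' X)"
  have D: "(LINT X|P. f X) = (LINT X|P. ?G f X)" if "f \<in> borel_measurable borel" "bounded (range f)" for f
    using dlr that m unfolding DLR_def by blast
  have bd: "bounded (range (\<lambda>X. indicator A X + c :: real))" for A :: "conf set" and c
    unfolding bounded_iff by (intro exI[of _ "1 + \<bar>c\<bar>"]) (auto simp: indicator_def)
  have 1: "(LINT X|P. ?g A X) = measure P A" if "A \<in> sets borel" for A
  proof -
    have "(LINT X|P. indicator A X) = (LINT X|P. ?g A X)"
      using D[of "indicator A"] bd[of A 0] that measure_gibbs_kernel[OF m(1) that] by simp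
    then show ?thesis using that sets_P space_P by simp
  qed
  show "(LINT X|P. ?g A X) = measure P A" by (rule 1[OF A])
  \<comment> \<open>The constant test function 1 gives the integral the value 1, which excludes the
    default 0.\<close>
  have iU: "integrable P (?g UNIV)"
    using 1[of UNIV] P.prob_space not_integrable_integral_eq[of P "?g UNIV"] space_P by fastforce
  \<comment> \<open>For \<open>A\<close> alone the integral may be 0, which says nothing about
    integrability. Adding 1 to the indicator makes it at least 1; the total mass is subtracted
    afterwards.\<close>
  have sum: "?G (\<lambda>X. indicator A X + 1) X = ?g A X + ?g UNIV X" for X
  proof (cases "partition_function \<beta> chi \<Lambda> X = 0")
    case False
    note [measurable] = measurable_union_conf[of "restr X (- \<Lambda>)"]
    have UNIV_borel: "UNIV \<in> sets (borel :: conf measure)" by simp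
    have int: "integrable (Bin \<Lambda> (Pts X \<Lambda>)) (\<lambda>X'. indicator A (?u X X') * boltzmann \<beta> chi \<Lambda> X' X)"
      by (rule Bochner_Integration.integrable_bound[OF integrable_boltzmann[OF False]])
         (auto simp: indicator_def)
    show ?thesis unfolding measure_gibbs_kernel[OF m(1) A] measure_gibbs_kernel[OF m(1) UNIV_borel]
      using int integrable_boltzmann[OF False] by (simp add: distrib_right distrib_left add_divide_distrib)
  qed (simp add: measure_gibbs_kernel)
  have "(LINT X|P. ?g A X + ?g UNIV X) = (LINT X|P. indicator A X + 1)"
  proof -
    have "(\<lambda>X. indicator A X + 1 :: real) \<in> borel_measurable borel" by measurable
    from D[OF this bd] show ?thesis by (simp only: sum)
  qed
  also have "\<dots> = measure P A + 1"
  proof -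
    have "integrable P (indicator A :: conf \<Rightarrow> real)"
      using AP by (intro integrable_real_indicator) (auto simp: P.emeasure_eq_measure)
    then show ?thesis using AP P.prob_space space_P by (subst Bochner_Integration.integral_add) auto
  qed
  finally have "(LINT X|P. ?g A X + ?g UNIV X) \<noteq> 0" using measure_nonneg[of P A] by linarith
  then have "integrable P (\<lambda>X. ?g A X + ?g UNIV X)" using not_integrable_integral_eq by blast
  from Bochner_Integration.integrable_diff[OF this iU] show "integrable P (?g A)" by simp
qed

text \<open>The dependence on the exterior is measurable because integrable functions are; the
  required integrability was extracted from the DLR equations.\<close>

lemma measurable_gibbs_kernel:
  assumes \<Lambda>: "fat \<Lambda>"
  shows "gibbs_kernel \<beta> chi \<Lambda> \<in> P \<rightarrow>\<^sub>M subprob_algebra borel"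
proof (rule measurable_subprob_algebra)
  have m: "\<Lambda> \<in> sets borel" using \<Lambda> by (auto simp: fat_def)
  show "subprob_space (gibbs_kernel \<beta> chi \<Lambda> X)" for X by (rule subprob_gibbs_kernel[OF m])
  fix A :: "conf set" assume A: "A \<in> sets borel"
  have "emeasure (gibbs_kernel \<beta> chi \<Lambda> X) A = ennreal (measure (gibbs_kernel \<beta> chi \<Lambda> X) A)" for X
    using finite_measure.emeasure_eq_measure[OF subprob_space.axioms(1)[OF subprob_gibbs_kernel[OF m]]] .
  then show "(\<lambda>X. emeasure (gibbs_kernel \<beta> chi \<Lambda> X) A) \<in> borel_measurable P"
    using borel_measurable_integrable[OF dlr_indicator(1)[OF \<Lambda> A]] by simp
qed simp

text \<open>The kernels have mass at most 1 and their masses average to 1, so almost every mass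
  equals 1, which excludes the null measure.\<close>

lemma AE_partition_function:
  assumes \<Lambda>: "fat \<Lambda>"
  shows "AE X in P. partition_function \<beta> chi \<Lambda> X \<noteq> 0"
proof -
  interpret P: prob_space P by (rule prob_P)
  have m: "\<Lambda> \<in> sets borel" using \<Lambda> by (auto simp: fat_def)
  have space_P: "space P = UNIV" using sets_eq_imp_space_eq[OF sets_P] by simp
  let ?g = "\<lambda>X. measure (gibbs_kernel \<beta> chi \<Lambda> X) UNIV"
  have le: "?g X \<le> 1" for X
    using subprob_space.subprob_measure_le_1[OF subprob_gibbs_kernel[OF m]] .
  have i: "integrable P ?g" "(LINT X|P. ?g X) = 1"
    using dlr_indicator[OF \<Lambda>, of UNIV] P.prob_space space_P by auto
  then have "integrable P (\<lambda>X. 1 - ?g X)" "(LINT X|P. 1 - ?g X) = 0"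
    using P.prob_space space_P by auto
  then have "AE X in P. 1 - ?g X = 0"
    using integral_nonneg_eq_0_iff_AE[of P "\<lambda>X. 1 - ?g X"] le by auto
  then show ?thesis by eventually_elim (auto simp: gibbs_kernel_def measure_def)
qed

lemma AE_prob_gibbs_kernel:
  assumes \<Lambda>: "fat \<Lambda>"
  shows "AE X in P. prob_space (gibbs_kernel \<beta> chi \<Lambda> X)"
  using AE_partition_function[OF \<Lambda>]
  by eventually_elim (use \<Lambda> in \<open>auto intro: prob_gibbs_kernel simp: fat_def\<close>)

lemma dlr_nn_integral:
  assumes \<Lambda>: "fat \<Lambda>" and f: "f \<in> borel_measurable borel"
  shows "(\<integral>\<^sup>+X. (\<integral>\<^sup>+Y. f Y \<partial>gibbs_kernel \<beta> chi \<Lambda> X) \<partial>P) = (\<integral>\<^sup>+X. f X \<partial>P)"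
proof -
  interpret P: prob_space P by (rule prob_P)
  have m: "\<Lambda> \<in> sets borel" using \<Lambda> by (auto simp: fat_def)
  note k = measurable_gibbs_kernel[OF \<Lambda>]
  have space_P: "space P = UNIV" using sets_eq_imp_space_eq[OF sets_P] by simp
  have "P \<bind> gibbs_kernel \<beta> chi \<Lambda> = P"
  proof (rule measure_eqI)
    show s: "sets (P \<bind> gibbs_kernel \<beta> chi \<Lambda>) = sets P"
      using sets_bind[of P "gibbs_kernel \<beta> chi \<Lambda>" borel] sets_P space_P by simp
    fix A assume "A \<in> sets (P \<bind> gibbs_kernel \<beta> chi \<Lambda>)"
    then have A: "A \<in> sets borel" using s sets_P by simp
    have "emeasure (P \<bind> gibbs_kernel \<beta> chi \<Lambda>) A = (\<integral>\<^sup>+X. emeasure (gibbs_kernel \<beta> chi \<Lambda> X) A \<partial>P)"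
      by (rule emeasure_bind[OF _ k A]) (simp add: space_P)
    also have "\<dots> = (\<integral>\<^sup>+X. ennreal (measure (gibbs_kernel \<beta> chi \<Lambda> X) A) \<partial>P)"
      by (intro nn_integral_cong finite_measure.emeasure_eq_measure subprob_space.axioms(1) subprob_gibbs_kernel m)
    also have "\<dots> = ennreal (LINT X|P. measure (gibbs_kernel \<beta> chi \<Lambda> X) A)"
      by (rule nn_integral_eq_integral[OF dlr_indicator(1)[OF \<Lambda> A]]) simp
    also have "\<dots> = emeasure P A" by (simp add: dlr_indicator(2)[OF \<Lambda> A] P.emeasure_eq_measure)
    finally show "emeasure (P \<bind> gibbs_kernel \<beta> chi \<Lambda>) A = emeasure P A" .
  qed
  then show ?thesis using nn_integral_bind[OF f k] by simp
qed

text \<open>For almost every \<open>X\<close> the kernel is carried by \<open>B\<close> or by its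
  complement according to where \<open>X\<close> lies, so the indicator can be pulled out for all
  \<open>f\<close> simultaneously.\<close>

lemma invariant_nn_integral:
  assumes B: "resampling_invariant \<beta> chi P B" and r: "r > 0"
  shows "AE X in P. \<forall>f\<in>borel_measurable borel. (\<integral>\<^sup>+Y. f Y * indicator B Y \<partial>gibbs_kernel \<beta> chi (cball a r) X)
      = indicator B X * (\<integral>\<^sup>+Y. f Y \<partial>gibbs_kernel \<beta> chi (cball a r) X)"
proof -
  have Bm[measurable]: "B \<in> sets borel" using B by (simp add: resampling_invariant_def)
  have "AE X in P. emeasure (gibbs_kernel \<beta> chi (cball a r) X) B = indicator B X"
    using B r by (simp add: resampling_invariant_def)
  then show ?thesis using AE_prob_gibbs_kernel[OF fat_cball[OF r, of a]]
  proof eventually_elim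
    case (elim X)
    interpret K: prob_space "gibbs_kernel \<beta> chi (cball a r) X" by fact
    show ?case
    proof
      fix f :: "conf \<Rightarrow> ennreal" assume [measurable]: "f \<in> borel_measurable borel"
      show "(\<integral>\<^sup>+Y. f Y * indicator B Y \<partial>gibbs_kernel \<beta> chi (cball a r) X)
        = indicator B X * (\<integral>\<^sup>+Y. f Y \<partial>gibbs_kernel \<beta> chi (cball a r) X)"
      proof (cases "X \<in> B")
        case True
        then have "K.prob B = 1" using elim(1) by (simp add: measure_def)
        then have "AE Y in gibbs_kernel \<beta> chi (cball a r) X. Y \<in> B" using Bm by (subst (asm) K.prob_eq_1) auto
        then have "(\<integral>\<^sup>+Y. f Y * indicator B Y \<partial>gibbs_kernel \<beta> chi (cball a r) X) = (\<integral>\<^sup>+Y. f Y \<partial>gibbs_kernel \<beta> chi (cball a r) X)"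
          by (intro nn_integral_cong_AE) (auto elim!: eventually_mono)
        then show ?thesis using True by simp
      next
        case False
        then have "AE Y in gibbs_kernel \<beta> chi (cball a r) X. Y \<notin> B"
          using elim(1) Bm by (intro AE_not_in) (auto simp: null_sets_def)
        then have "(\<integral>\<^sup>+Y. f Y * indicator B Y \<partial>gibbs_kernel \<beta> chi (cball a r) X) = (\<integral>\<^sup>+Y. 0 \<partial>gibbs_kernel \<beta> chi (cball a r) X)"
          by (intro nn_integral_cong_AE) (auto elim!: eventually_mono)
        then show ?thesis using False by simp
      qed
    qed
  qed
qed

text \<open>Resampling still preserves expectations after restriction to \<open>B\<close>: this is
  how \<open>B\<close> passes through the translation inequality unchanged.\<close>

lemma dlr_invariant:
  assumes B: "resampling_invariant \<beta> chi P B" and r: "r > 0" and f: "f \<in> borel_measurable borel"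
  shows "(\<integral>\<^sup>+X. indicator B X * (\<integral>\<^sup>+Y. f Y \<partial>gibbs_kernel \<beta> chi (cball a r) X) \<partial>P) = (\<integral>\<^sup>+X. f X * indicator B X \<partial>P)"
proof -
  have Bm[measurable]: "B \<in> sets borel" using B by (simp add: resampling_invariant_def)
  have "(\<integral>\<^sup>+X. f X * indicator B X \<partial>P) = (\<integral>\<^sup>+X. (\<integral>\<^sup>+Y. f Y * indicator B Y \<partial>gibbs_kernel \<beta> chi (cball a r) X) \<partial>P)"
    using f by (subst dlr_nn_integral[OF fat_cball[OF r]]) auto
  also have "\<dots> = (\<integral>\<^sup>+X. indicator B X * (\<integral>\<^sup>+Y. f Y \<partial>gibbs_kernel \<beta> chi (cball a r) X) \<partial>P)"
    using invariant_nn_integral[OF B r, of a] f by (intro nn_integral_cong_AE) (auto elim!: eventually_mono)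
  finally show ?thesis by simp
qed

context
  fixes C \<rho>\<beta> :: real
  assumes good: "good_smooth C \<rho>\<beta> P" "good_intensity C P" and C: "C > 0"
begin

lemma AE_gibbs_kernel_translation:
  assumes \<Lambda>: "fat \<Lambda>" and v: "norm v \<le> 1"
  shows "AE X in P. gibbs_kernel \<beta> chi ((\<lambda>x. x + v) ` \<Lambda>) (push (\<lambda>x. x + v) X)
     = distr (gibbs_kernel \<beta> chi \<Lambda> X) borel (push (\<lambda>x. x + v))"
proof -
  have m[measurable]: "\<Lambda> \<in> sets borel" "bounded \<Lambda>" using \<Lambda> by (auto simp: fat_def)
  let ?T = "\<lambda>x::plane. x + v" and ?\<Gamma> = "gibbs_kernel \<beta> chi"
  note T = tame_bij_translation[of v]
  note [measurable] = measurable_push[OF T]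
  have T\<Lambda>: "fat (?T ` \<Lambda>)" using Bin_push(1)[OF T lborel_translation \<Lambda>] .
  have [measurable]: "?T ` \<Lambda> \<in> sets borel" using T\<Lambda> by (simp add: fat_def)
  show ?thesis using AE_move_translation[OF dy sets_P good C m v]
  proof eventually_elim
    case (elim X)
    let ?n = "Pts X \<Lambda>"
    have n: "Pts (push ?T X) (?T ` \<Lambda>) = ?n"
    proof -
      have "?T -` (?T ` \<Lambda>) = \<Lambda>" by auto
      then show ?thesis unfolding Pts_push[OF T] by simp
    qed
    have B: "Bin (?T ` \<Lambda>) ?n = distr (Bin \<Lambda> ?n) borel (push ?T)" using Bin_push(2)[OF T lborel_translation \<Lambda>] by simp
    \<comment> \<open>Covariance of the moving energy requires \<open>Z\<close> to have as many
      points in \<open>\<Lambda>\<close> as \<open>X\<close>, which holds for almost every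
      sample.\<close>
    have b: "AE Z in Bin \<Lambda> ?n. boltzmann \<beta> chi (?T ` \<Lambda>) (push ?T Z) (push ?T X) = boltzmann \<beta> chi \<Lambda> Z X"
      using AE_Bin[OF \<Lambda>, of ?n]
      by eventually_elim (use elim in \<open>auto simp: boltzmann_def energy_translation\<close>)
    have K: "partition_function \<beta> chi (?T ` \<Lambda>) (push ?T X) = partition_function \<beta> chi \<Lambda> X"
    proof -
      have "partition_function \<beta> chi (?T ` \<Lambda>) (push ?T X) = (LINT Z|Bin \<Lambda> ?n. boltzmann \<beta> chi (?T ` \<Lambda>) (push ?T Z) (push ?T X))"
        unfolding partition_function_def n B by (rule integral_distr) auto
      also have "\<dots> = partition_function \<beta> chi \<Lambda> X" unfolding partition_function_def
        using b by (intro integral_cong_AE) measurable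
      finally show ?thesis .
    qed
    show ?case
    proof (cases "partition_function \<beta> chi \<Lambda> X = 0")
      case True
      have "distr (null_measure borel) borel (push ?T) = (null_measure borel :: conf measure)"
      proof (rule measure_eqI)
        fix A assume "A \<in> sets (distr (null_measure borel) borel (push ?T))"
        then show "emeasure (distr (null_measure borel) borel (push ?T)) A = emeasure (null_measure borel :: conf measure) A"
          using measurable_push[OF T] by (subst emeasure_distr) auto
      qed simp
      then show ?thesis using K True by (simp add: gibbs_kernel_def)
    next
      case False
      show ?thesis
      proof (rule measure_eqI)
        fix A assume "A \<in> sets (?\<Gamma> (?T ` \<Lambda>) (push ?T X))"
        then have [measurable]: "A \<in> sets borel" by simp
        let ?K = "partition_function \<beta> chi \<Lambda> X"
        let ?u = "\<lambda>Z. union_conf Z (restr (push ?T X) (- (?T ` \<Lambda>)))"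
        note [measurable] = measurable_union_conf[of "restr (push ?T X) (- (?T ` \<Lambda>))"] measurable_union_conf[of "restr X (- \<Lambda>)"]
        have "emeasure (?\<Gamma> (?T ` \<Lambda>) (push ?T X)) A = (\<integral>\<^sup>+Y. indicator A Y \<partial>?\<Gamma> (?T ` \<Lambda>) (push ?T X))"
          by simp
        also have "\<dots> = (\<integral>\<^sup>+Z. ennreal (boltzmann \<beta> chi (?T ` \<Lambda>) Z (push ?T X) / ?K) * indicator A (?u Z) \<partial>Bin (?T ` \<Lambda>) ?n)"
          using False K by (subst nn_integral_gibbs_kernel) (auto simp: n)
        also have "\<dots> = (\<integral>\<^sup>+Z. ennreal (boltzmann \<beta> chi (?T ` \<Lambda>) (push ?T Z) (push ?T X) / ?K) * indicator A (?u (push ?T Z)) \<partial>Bin \<Lambda> ?n)"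
          unfolding B by (rule nn_integral_distr) auto
        also have "\<dots> = (\<integral>\<^sup>+Z. ennreal (boltzmann \<beta> chi \<Lambda> Z X / ?K) * indicator (push ?T -` A) (union_conf Z (restr X (- \<Lambda>))) \<partial>Bin \<Lambda> ?n)"
          using b by (intro nn_integral_cong_AE) (auto elim!: eventually_mono simp: push_union_restr[OF T] indicator_def)
        also have "\<dots> = (\<integral>\<^sup>+Y. indicator (push ?T -` A) Y \<partial>?\<Gamma> \<Lambda> X)"
          using False measurable_sets[OF measurable_push[OF T], of A] by (subst nn_integral_gibbs_kernel) auto
        also have "\<dots> = emeasure (?\<Gamma> \<Lambda> X) (push ?T -` A)"
          using measurable_sets[OF measurable_push[OF T], of A] by simp
        also have "\<dots> = emeasure (distr (?\<Gamma> \<Lambda> X) borel (push ?T)) A"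
          by (subst emeasure_distr) auto
        finally show "emeasure (?\<Gamma> (?T ` \<Lambda>) (push ?T X)) A = emeasure (distr (?\<Gamma> \<Lambda> X) borel (push ?T)) A" .
      qed simp
    qed
  qed
qed

text \<open>The averaged Boltzmann weights of the two shifted configurations dominate, by AM-GM,
  the geometric mean of those weights, which is the original weight up to the second differences.\<close>

lemma AE_kernel_second_difference:
  assumes T: "tame_bij T T'" and leb: "distr lborel lborel T = lborel" "distr lborel lborel T' = lborel"
    and L: "L > 0" and id: "\<And>x. norm x \<ge> 2 * L \<Longrightarrow> T x = x" and lam: "lam > 0"
    and A: "A \<in> sets borel"
  shows "AE X in P. (\<integral>\<^sup>+Y. ennreal (exp (- \<beta> * (Diff1 T T' L Y + Diff2 chi T T' L Y Y))) * indicator A Y \<partial>gibbs_kernel \<beta> chi (cball 0 (10 * L)) X)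
    \<le> ennreal (lam / 2) * emeasure (gibbs_kernel \<beta> chi (cball 0 (10 * L)) X) (push T' -` A)
     + ennreal (1 / (2 * lam)) * emeasure (gibbs_kernel \<beta> chi (cball 0 (10 * L)) X) (push T -` A)"
proof -
  note [measurable] = A
  let ?\<Lambda> = "cball (0::plane) (10 * L)"
  let ?\<Gamma> = "gibbs_kernel \<beta> chi ?\<Lambda>"
  have \<Lambda>: "fat ?\<Lambda>" using L by (intro fat_cball) auto
  have m[measurable]: "?\<Lambda> \<in> sets borel" "bounded ?\<Lambda>" by auto
  note T' = tame_bij_sym[OF T]
  have id': "T' x = x" if "norm x \<ge> 2 * L" for x using id[OF that] tame_bijD(1)[OF T] by metis
  \<comment> \<open>A bijection that fixes everything beyond radius 2L also maps the disk of radius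
    2L to itself, hence preserves \<open>?\<Lambda>\<close>.\<close>
  have in\<Lambda>: "T x \<in> ?\<Lambda> \<longleftrightarrow> x \<in> ?\<Lambda>" if "\<And>x. norm x \<ge> 2 * L \<Longrightarrow> T x = x" "\<And>x. norm x \<ge> 2 * L \<Longrightarrow> T' x = x" "tame_bij T T'" for T T' and x
  proof (cases "norm x \<ge> 2 * L")
    case False
    have "norm (T x) < 2 * L"
    proof (rule ccontr)
      assume "\<not> norm (T x) < 2 * L"
      then have "T' (T x) = T x" using that(2) by simp
      then show False using False \<open>\<not> norm (T x) < 2 * L\<close> tame_bijD(1)[OF that(3)] by simp
    qed
    then show ?thesis using False L by simp
  qed (simp add: that)
  have inT: "T x \<in> ?\<Lambda> \<longleftrightarrow> x \<in> ?\<Lambda>" and inT': "T' x \<in> ?\<Lambda> \<longleftrightarrow> x \<in> ?\<Lambda>" for x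
    using in\<Lambda>[of T T', OF id id' T] in\<Lambda>[of T' T, OF id' id T'] by auto
  have out: "T x = x" "T' x = x" if "x \<notin> ?\<Lambda>" for x
    using that L by (auto intro!: id id')
  have vim: "T -` ?\<Lambda> = ?\<Lambda>" "T' -` ?\<Lambda> = ?\<Lambda>"
    by (rule set_eqI; simp only: vimage_eq inT inT')+
  have im: "T ` ?\<Lambda> = ?\<Lambda>" "T' ` ?\<Lambda> = ?\<Lambda>"
    using vim tame_bijD(7)[OF T] tame_bijD(7)[OF T'] by (simp_all only:)
  have rest: "restr (push T X) (- ?\<Lambda>) = restr X (- ?\<Lambda>)" "restr (push T' X) (- ?\<Lambda>) = restr X (- ?\<Lambda>)" for X
    unfolding restr_eq_iff using out by (simp_all add: mult_push[OF T] mult_push[OF T'])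
  have pts: "Pts (push T X) ?\<Lambda> = Pts X ?\<Lambda>" "Pts (push T' X) ?\<Lambda> = Pts X ?\<Lambda>" for X
    by (simp_all only: Pts_push[OF T] Pts_push[OF T'] vim)
  show ?thesis
    using AE_move_formula[OF dy sets_P good C m] AE_partition_function[OF \<Lambda>]
  proof eventually_elim
    case (elim X)
    let ?n = "Pts X ?\<Lambda>" and ?K = "partition_function \<beta> chi ?\<Lambda> X"
    have K0: "?K > 0" using elim(2) partition_function_nonneg[of ?\<Lambda> X] by linarith
    obtain G where G: "\<And>Z W. (\<And>y. y \<notin> ?\<Lambda> \<Longrightarrow> mult W y = mult X y) \<Longrightarrow> Pts Z ?\<Lambda> = Pts W ?\<Lambda> \<Longrightarrow>
        move chi ?\<Lambda> Z W = conf_sum Z ?\<Lambda> G - conf_sum W ?\<Lambda> G" using elim(1) by blast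
    let ?u = "\<lambda>Z. union_conf Z (restr X (- ?\<Lambda>))"
    let ?D = "\<lambda>Y. Diff1 T T' L Y + Diff2 chi T T' L Y Y"
    let ?b = "\<lambda>Z. boltzmann \<beta> chi ?\<Lambda> Z X"
    have key: "exp (- \<beta> * ?D (?u Z)) * ?b Z \<le> lam / 2 * ?b (push T Z) + 1 / (2 * lam) * ?b (push T' Z)"
      if n: "Pts Z ?\<Lambda> = ?n" and Z: "\<And>x. x \<notin> ?\<Lambda> \<Longrightarrow> mult Z x = 0" for Z
    proof -
      define Y where "Y = ?u Z"
      have Yout: "mult Y y = mult X y" if "y \<notin> ?\<Lambda>" for y using that Z by (simp add: Y_def mult_union mult_restr)
      have Yin: "mult Y y = mult Z y" if "y \<in> ?\<Lambda>" for y using that by (simp add: Y_def mult_union mult_restr)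
      have TY: "mult (push T Y) y = mult (push T Z) y" "mult (push T' Y) y = mult (push T' Z) y" if "y \<in> ?\<Lambda>" for y
        using that Yin inT inT' by (auto simp: mult_push[OF T] mult_push[OF T'])
      have e: "energy ?\<Lambda> (push T Y) = energy ?\<Lambda> (push T Z)" "energy ?\<Lambda> (push T' Y) = energy ?\<Lambda> (push T' Z)" "energy ?\<Lambda> Y = energy ?\<Lambda> Z"
        by (rule energy_cong[OF m(1)]; simp only: TY Yin)+
      have c: "conf_sum (push T Y) ?\<Lambda> G = conf_sum (push T Z) ?\<Lambda> G" "conf_sum (push T' Y) ?\<Lambda> G = conf_sum (push T' Z) ?\<Lambda> G" "conf_sum Y ?\<Lambda> G = conf_sum Z ?\<Lambda> G"
        by (rule conf_sum_cong_conf; simp only: TY Yin)+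
      have mX: "move chi ?\<Lambda> Z' X = conf_sum Z' ?\<Lambda> G - conf_sum X ?\<Lambda> G" if "Pts Z' ?\<Lambda> = ?n" for Z'
        by (rule G) (use that in auto)
      have mY: "move chi ?\<Lambda> Z' Y = conf_sum Z' ?\<Lambda> G - conf_sum Y ?\<Lambda> G" if "Pts Z' ?\<Lambda> = Pts Y ?\<Lambda>" for Z'
        by (rule G) (use that Yout in auto)
      define a where "a = - \<beta> * (energy ?\<Lambda> (push T Z) + move chi ?\<Lambda> (push T Z) X)"
      define a' where "a' = - \<beta> * (energy ?\<Lambda> (push T' Z) + move chi ?\<Lambda> (push T' Z) X)"
      \<comment> \<open>\<open>Diff2\<close> refers to \<open>Y\<close>, the weights refer to
        \<open>X\<close>. Both are expressed through the same \<open>G\<close>, so the reference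
        terms match and half the sum of the two shifted exponents remains.\<close>
      have "- \<beta> * ?D Y + - \<beta> * (energy ?\<Lambda> Z + move chi ?\<Lambda> Z X) = a / 2 + a' / 2"
      proof -
        have mv: "move chi ?\<Lambda> Z X = conf_sum Z ?\<Lambda> G - conf_sum X ?\<Lambda> G"
          "move chi ?\<Lambda> (push T Z) X = conf_sum (push T Z) ?\<Lambda> G - conf_sum X ?\<Lambda> G"
          "move chi ?\<Lambda> (push T' Z) X = conf_sum (push T' Z) ?\<Lambda> G - conf_sum X ?\<Lambda> G"
          by (rule mX; simp only: pts n)+
        have mv': "move chi ?\<Lambda> Y Y = 0"
          "move chi ?\<Lambda> (push T Y) Y = conf_sum (push T Y) ?\<Lambda> G - conf_sum Y ?\<Lambda> G"
          "move chi ?\<Lambda> (push T' Y) Y = conf_sum (push T' Y) ?\<Lambda> G - conf_sum Y ?\<Lambda> G"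
          using mY[of Y] mY[of "push T Y"] mY[of "push T' Y"] pts by simp_all
        show ?thesis unfolding Diff1_def Diff2_def Let_def e a_def a'_def mv mv' c
          by (simp add: field_simps)
      qed
      then have "exp (- \<beta> * ?D Y) * ?b Z = exp (a / 2) * exp (a' / 2)"
        unfolding boltzmann_def exp_add[symmetric] by simp
      also have "\<dots> \<le> lam / 2 * exp a + 1 / (2 * lam) * exp a'"
      proof -
        define s where "s = exp (a / 2)"
        define t where "t = exp (a' / 2)"
        have st: "exp a = s ^ 2" "exp a' = t ^ 2" by (simp_all add: s_def t_def power2_eq_square exp_add[symmetric])
        \<comment> \<open>Weighted AM-GM. The free \<open>lam\<close> later moves the weight away
          from the translate whose probability is not known to vanish.\<close>
        have "0 \<le> (lam * s - t) ^ 2 / (2 * lam)" using lam by simp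
        also have "\<dots> = lam / 2 * s ^ 2 + 1 / (2 * lam) * t ^ 2 - s * t"
          using lam by (simp add: field_simps power2_eq_square)
        finally show ?thesis unfolding st s_def[symmetric] t_def[symmetric] by simp
      qed
      finally show ?thesis unfolding Y_def a_def a'_def boltzmann_def .
    qed
    note [measurable] = measurable_union_conf[of "restr X (- ?\<Lambda>)"] measurable_push[OF T] measurable_push[OF T']
    have [measurable]: "(\<lambda>Y. exp (- \<beta> * ?D Y)) \<in> borel_measurable borel"
      unfolding Diff1_def Diff2_def Let_def
      using measurable_energy[of "push T" borel ?\<Lambda>] measurable_energy[of "push T'" borel ?\<Lambda>] measurable_energy[of "\<lambda>X. X" borel ?\<Lambda>]
        measurable_move[of "push T" borel "\<lambda>X. X" ?\<Lambda> chi] measurable_move[of "push T'" borel "\<lambda>X. X" ?\<Lambda> chi]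
        measurable_move[of "\<lambda>X. X" borel "\<lambda>X. X" ?\<Lambda> chi] measurable_chi[OF dy] measurable_push[OF T] measurable_push[OF T'] m
      by measurable
    have mD: "(\<lambda>Y. ennreal (exp (- \<beta> * ?D Y)) * indicator A Y) \<in> borel_measurable borel" by measurable
    \<comment> \<open>\<open>push S'\<close> preserves the law of the uniform points and undoes
      \<open>push S\<close>. Substituting it restores the original weight and moves the map onto the
      event.\<close>
    have swap: "(\<integral>\<^sup>+Z. ennreal (?b (push S Z) / ?K) * indicator A (?u Z) \<partial>Bin ?\<Lambda> ?n) = emeasure (?\<Gamma> X) (push S' -` A)"
      if S: "tame_bij S S'" "distr lborel lborel S' = lborel" "S' ` ?\<Lambda> = ?\<Lambda>" "restr (push S' X) (- ?\<Lambda>) = restr X (- ?\<Lambda>)" for S S'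
    proof -
      note [measurable] = measurable_push[OF S(1)] measurable_push[OF tame_bij_sym[OF S(1)]]
      have B: "distr (Bin ?\<Lambda> ?n) borel (push S') = Bin ?\<Lambda> ?n"
        using Bin_push(2)[OF tame_bij_sym[OF S(1)] S(2) \<Lambda>] S(3) by simp
      have "(\<integral>\<^sup>+Z. ennreal (?b (push S Z) / ?K) * indicator A (?u Z) \<partial>Bin ?\<Lambda> ?n)
        = (\<integral>\<^sup>+Z. ennreal (?b (push S Z) / ?K) * indicator A (?u Z) \<partial>distr (Bin ?\<Lambda> ?n) borel (push S'))"
        by (simp only: B)
      also have "\<dots> = (\<integral>\<^sup>+Z. ennreal (?b (push S (push S' Z)) / ?K) * indicator A (?u (push S' Z)) \<partial>Bin ?\<Lambda> ?n)"
        by (rule nn_integral_distr) auto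
      also have "\<dots> = (\<integral>\<^sup>+Z. ennreal (?b Z / ?K) * indicator (push S' -` A) (?u Z) \<partial>Bin ?\<Lambda> ?n)"
        using push_union_restr[OF tame_bij_sym[OF S(1)], of _ X ?\<Lambda>] S(3,4)
        by (intro nn_integral_cong) (simp add: push_inverse[OF tame_bij_sym[OF S(1)]] indicator_def)
      also have "\<dots> = (\<integral>\<^sup>+Y. indicator (push S' -` A) Y \<partial>?\<Gamma> X)"
        using elim(2) measurable_sets[OF measurable_push[OF tame_bij_sym[OF S(1)]], of A] by (subst nn_integral_gibbs_kernel) auto
      also have "\<dots> = emeasure (?\<Gamma> X) (push S' -` A)"
        using measurable_sets[OF measurable_push[OF tame_bij_sym[OF S(1)]], of A] by simp
      finally show ?thesis .
    qed
    have "(\<integral>\<^sup>+Y. ennreal (exp (- \<beta> * ?D Y)) * indicator A Y \<partial>?\<Gamma> X)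
      = (\<integral>\<^sup>+Z. ennreal (?b Z / ?K) * (ennreal (exp (- \<beta> * ?D (?u Z))) * indicator A (?u Z)) \<partial>Bin ?\<Lambda> ?n)"
      by (rule nn_integral_gibbs_kernel[OF m(1) mD elim(2)])
    also have "\<dots> \<le> (\<integral>\<^sup>+Z. ennreal (lam / 2) * (ennreal (?b (push T Z) / ?K) * indicator A (?u Z))
        + ennreal (1 / (2 * lam)) * (ennreal (?b (push T' Z) / ?K) * indicator A (?u Z)) \<partial>Bin ?\<Lambda> ?n)"
    proof (rule nn_integral_mono_AE)
      show "AE Z in Bin ?\<Lambda> ?n. ennreal (?b Z / ?K) * (ennreal (exp (- \<beta> * ?D (?u Z))) * indicator A (?u Z))
        \<le> ennreal (lam / 2) * (ennreal (?b (push T Z) / ?K) * indicator A (?u Z))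
        + ennreal (1 / (2 * lam)) * (ennreal (?b (push T' Z) / ?K) * indicator A (?u Z))"
        using AE_Bin[OF \<Lambda>, of ?n]
      proof eventually_elim
        case (elim Z)
        show ?case
        proof (cases "?u Z \<in> A")
          case True
          have "?b Z / ?K * exp (- \<beta> * ?D (?u Z)) \<le> lam / 2 * (?b (push T Z) / ?K) + 1 / (2 * lam) * (?b (push T' Z) / ?K)"
            using divide_right_mono[OF key[of Z], of ?K] elim K0 by (simp add: add_divide_distrib mult.commute)
          then show ?thesis using True K0 lam
            by (simp add: ennreal_mult[symmetric] ennreal_plus[symmetric] boltzmann_pos less_imp_le ennreal_leI del: ennreal_plus)
        qed simp
      qed
    qed
    also have "\<dots> = ennreal (lam / 2) * (\<integral>\<^sup>+Z. ennreal (?b (push T Z) / ?K) * indicator A (?u Z) \<partial>Bin ?\<Lambda> ?n)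
        + ennreal (1 / (2 * lam)) * (\<integral>\<^sup>+Z. ennreal (?b (push T' Z) / ?K) * indicator A (?u Z) \<partial>Bin ?\<Lambda> ?n)"
      by (subst nn_integral_add) (auto simp: nn_integral_cmult)
    also have "\<dots> = ennreal (lam / 2) * emeasure (?\<Gamma> X) (push T' -` A)
      + ennreal (1 / (2 * lam)) * emeasure (?\<Gamma> X) (push T -` A)"
      using swap[OF T leb(2) im(2) rest(2)] swap[OF T' leb(1) im(1) rest(1)] by simp
    finally show ?case .
  qed
qed

end

end

end

section \<open>The translation inequality\<close>

lemma log_expect_le:
  assumes "log_expect P g \<le> ereal C"
  shows "(\<integral>\<^sup>+X. g X \<partial>P) \<le> ennreal (exp C)"
proof -
  define a where "a = (\<integral>\<^sup>+X. g X \<partial>P)"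
  have le: "log_ennreal a \<le> ereal C" using assms by (simp add: log_expect_def a_def)
  have "a \<le> ennreal (exp C)"
  proof (cases "a = 0")
    case False
    then have fin: "a \<noteq> \<infinity>" and "ln (enn2real a) \<le> C" using le by (auto simp: log_ennreal_def split: if_splits)
    moreover have "enn2real a > 0" using False fin by (simp add: enn2real_positive_iff less_top zero_less_iff_neq_zero)
    ultimately have "enn2real a \<le> exp C" by (metis exp_le_cancel_iff exp_ln)
    then have "ennreal (enn2real a) \<le> ennreal (exp C)" by (rule ennreal_leI)
    then show ?thesis using fin by (simp add: ennreal_enn2real_if split: if_splits)
  qed simp
  then show ?thesis by (simp add: a_def)
qed

text \<open>On such an event a localized translation with large L cannot be told apart from the true
  translation.\<close>

definition local_events :: "conf set set" where
  "local_events = {A \<in> sets borel. \<exists>r. \<forall>X Y. (\<forall>x\<in>cball 0 r. mult X x = mult Y x) \<longrightarrow> (X \<in> A \<longleftrightarrow> Y \<in> A)}"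

lemma cell_events_local: "cell_events \<subseteq> local_events"
proof
  fix A assume "A \<in> cell_events"
  then obtain m k n where A: "A = {Y. Pts Y (cell m -` {k}) = n}" by (auto simp: cell_events_def)
  obtain r where r: "\<And>x. x \<in> cell m -` {k} \<Longrightarrow> dist 0 x \<le> r"
    using bounded_cell_vimage[of m k] unfolding bounded_any_center[of _ 0] by blast
  have "X \<in> A \<longleftrightarrow> Y \<in> A" if "\<forall>x\<in>cball 0 r. mult X x = mult Y x" for X Y
    using Pts_cong[of "cell m -` {k}" X Y] that r by (simp add: A)
  moreover have "A \<in> sets borel"
    unfolding borel_conf_eq using \<open>A \<in> cell_events\<close> by simp
  ultimately show "A \<in> local_events" unfolding local_events_def by blast
qed

lemma local_events_Compl: "A \<in> local_events \<Longrightarrow> UNIV - A \<in> local_events"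
  unfolding local_events_def by (auto simp: Compl_eq_Diff_UNIV[symmetric])

lemma local_events_Un:
  assumes "A \<in> local_events" "A' \<in> local_events"
  shows "A \<union> A' \<in> local_events"
proof -
  obtain r r' where r: "\<And>X Y. (\<forall>x\<in>cball 0 r. mult X x = mult Y x) \<Longrightarrow> (X \<in> A \<longleftrightarrow> Y \<in> A)"
    "\<And>X Y. (\<forall>x\<in>cball 0 r'. mult X x = mult Y x) \<Longrightarrow> (X \<in> A' \<longleftrightarrow> Y \<in> A')"
    using assms unfolding local_events_def by blast
  have "X \<in> A \<union> A' \<longleftrightarrow> Y \<in> A \<union> A'" if "\<forall>x\<in>cball 0 (max r r'). mult X x = mult Y x" for X Y
    using r(1)[of X Y] r(2)[of X Y] that by auto
  then show ?thesis using assms unfolding local_events_def by blast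
qed

lemma local_events_UN:
  "(\<And>i. i < (n::nat) \<Longrightarrow> A i \<in> local_events) \<Longrightarrow> (\<Union>i<n. A i) \<in> local_events"
proof (induction n)
  case 0
  then show ?case by (simp add: local_events_def)
next
  case (Suc n)
  then show ?case by (simp add: lessThan_Suc local_events_Un)
qed

text \<open>The translation inequality involves an event and both its translates, so one local event
  must be close under \<open>P\<close> and under two push-forwards at once; hence the finite family
  of measures.\<close>

lemma local_approximation:
  fixes M :: "'i \<Rightarrow> conf measure"
  assumes fin: "finite I" and M: "\<And>i. i \<in> I \<Longrightarrow> finite_measure (M i)" "\<And>i. i \<in> I \<Longrightarrow> sets (M i) = sets borel"
    and A: "A \<in> sets borel" and e: "e > 0"
  shows "\<exists>A'\<in>local_events. \<forall>i\<in>I. measure (M i) (sym_diff A A') < e"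
proof -
  have "A \<in> sigma_sets UNIV cell_events" using A by (simp add: borel_conf_eq)
  then show ?thesis using e
  proof (induction A arbitrary: e rule: sigma_sets.induct)
    case (Basic A)
    then show ?case using cell_events_local by (intro bexI[of _ A]) auto
  next
    case Empty
    then show ?case by (intro bexI[of _ "{}"]) (auto simp: local_events_def)
  next
    case (Compl A)
    then obtain A' where A': "A' \<in> local_events" "\<forall>i\<in>I. measure (M i) (sym_diff A A') < e" by blast
    have "sym_diff (UNIV - A) (UNIV - A') = sym_diff A A'" by auto
    then show ?case using A' local_events_Compl by (intro bexI[of _ "UNIV - A'"]) auto
  next
    case (Union A)
    have Ab: "A n \<in> sets borel" for n using Union(1) by (simp add: borel_conf_eq)
    have "\<forall>\<^sub>F n in sequentially. measure (M i) ((\<Union>k. A k) - (\<Union>k<n. A k)) < e / 2" if i: "i \<in> I" for i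
    proof -
      interpret finite_measure "M i" by (rule M(1)[OF i])
      have "(\<lambda>n. measure (M i) ((\<Union>k. A k) - (\<Union>k<n. A k))) \<longlonglongrightarrow> measure (M i) (\<Inter>n. (\<Union>k. A k) - (\<Union>k<n. A k))"
      proof (rule finite_Lim_measure_decseq)
        show "range (\<lambda>n. (\<Union>k. A k) - (\<Union>k<n. A k)) \<subseteq> sets (M i)" using Ab M(2)[OF i] by auto
        show "decseq (\<lambda>n. (\<Union>k. A k) - (\<Union>k<n. A k))" by (fastforce simp: decseq_def)
      qed
      also have "(\<Inter>n. (\<Union>k. A k) - (\<Union>k<n. A k)) = {}" by auto
      finally have "(\<lambda>n. measure (M i) ((\<Union>k. A k) - (\<Union>k<n. A k))) \<longlonglongrightarrow> 0" by simp
      then show ?thesis by (rule order_tendstoD) (use Union(3) in simp)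
    qed
    then have "\<forall>\<^sub>F n in sequentially. \<forall>i\<in>I. measure (M i) ((\<Union>k. A k) - (\<Union>k<n. A k)) < e / 2"
      by (intro eventually_ball_finite fin) auto
    then obtain n where n: "\<And>i. i \<in> I \<Longrightarrow> measure (M i) ((\<Union>k. A k) - (\<Union>k<n. A k)) < e / 2"
      by (auto simp: eventually_sequentially)
    \<comment> \<open>The first \<open>n\<close> sets share an error of e/2; the added 1 covers n =
      0.\<close>
    have "\<exists>A'\<in>local_events. \<forall>i\<in>I. measure (M i) (sym_diff (A k) A') < e / (2 * (real n + 1))" for k
      using Union(3) by (intro Union(2)) auto
    then obtain B where B: "\<And>k. B k \<in> local_events" "\<And>k i. i \<in> I \<Longrightarrow> measure (M i) (sym_diff (A k) (B k)) < e / (2 * (real n + 1))"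
      by metis
    have Bb: "B k \<in> sets borel" for k using B(1) by (auto simp: local_events_def)
    show ?case
    proof (intro bexI[of _ "\<Union>k<n. B k"] ballI local_events_UN B(1))
      fix i assume i: "i \<in> I"
      interpret finite_measure "M i" by (rule M(1)[OF i])
      note [measurable] = Ab Bb and [measurable_cong] = M(2)[OF i]
      have "measure (M i) (sym_diff (\<Union>k. A k) (\<Union>k<n. B k))
        \<le> measure (M i) (((\<Union>k. A k) - (\<Union>k<n. A k)) \<union> (\<Union>k<n. sym_diff (A k) (B k)))"
        by (intro finite_measure_mono) (auto simp: M(2)[OF i] Ab Bb)
      also have "\<dots> \<le> measure (M i) ((\<Union>k. A k) - (\<Union>k<n. A k)) + measure (M i) (\<Union>k<n. sym_diff (A k) (B k))"
        by (intro measure_Un_le) (auto simp: M(2)[OF i] Ab Bb)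
      also have "measure (M i) (\<Union>k<n. sym_diff (A k) (B k)) \<le> (\<Sum>k<n. measure (M i) (sym_diff (A k) (B k)))"
        by (intro measure_UNION_le) (auto simp: M(2)[OF i] Ab Bb)
      also have "\<dots> \<le> (\<Sum>k<n. e / (2 * (real n + 1)))" using B(2)[OF i] by (intro sum_mono less_imp_le)
      also have "\<dots> \<le> e / 2" using Union(3) by (simp add: field_simps)
      finally show "measure (M i) (sym_diff (\<Union>k. A k) (\<Union>k<n. B k)) < e" using n[OF i] by simp
    qed
  qed
qed

lemma measurable_Diff:
  assumes T: "tame_bij T T'" and chi: "dyadic_partition chi Cchi"
  shows "(\<lambda>Y. Diff1 T T' L Y) \<in> borel_measurable borel" "(\<lambda>Y. Diff2 chi T T' L Y Y) \<in> borel_measurable borel"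
proof -
  let ?\<Lambda> = "cball (0::plane) (10 * L)"
  have m: "?\<Lambda> \<in> sets borel" by simp
  show "(\<lambda>Y. Diff1 T T' L Y) \<in> borel_measurable borel"
    unfolding Diff1_def Let_def
    using measurable_energy[of "push T" borel ?\<Lambda>] measurable_energy[of "push T'" borel ?\<Lambda>] measurable_energy[of "\<lambda>X. X" borel ?\<Lambda>]
      measurable_push[OF T] measurable_push[OF tame_bij_sym[OF T]] m by measurable
  show "(\<lambda>Y. Diff2 chi T T' L Y Y) \<in> borel_measurable borel"
    unfolding Diff2_def Let_def
    using measurable_move[of "push T" borel "\<lambda>X. X" ?\<Lambda> chi] measurable_move[of "push T'" borel "\<lambda>X. X" ?\<Lambda> chi]
      measurable_move[of "\<lambda>X. X" borel "\<lambda>X. X" ?\<Lambda> chi] measurable_chi[OF chi]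
      measurable_push[OF T] measurable_push[OF tame_bij_sym[OF T]] m by measurable
qed

lemma localized_translation_tame:
  assumes lt: "localized_translation CT v L Tp Tm"
  shows "tame_bij Tp Tm"
proof -
  have "continuous_on UNIV Tp" "continuous_on UNIV Tm"
    using lt unfolding localized_translation_def numeral_3_eq_3 by (auto intro: differentiable_imp_continuous_on)
  then have "Tp \<in> borel_measurable borel" "Tm \<in> borel_measurable borel"
    by (auto intro: borel_measurable_continuous_onI)
  \<comment> \<open>Bounded displacement is the order-zero derivative bound, read with the empty
    list of directions.\<close>
  moreover have "dist (Tp x) x \<le> CT" for x
  proof -
    have "dnorm 0 (\<lambda>x. Tp x - x) \<le> ereal (CT / L ^ 0)" using lt unfolding localized_translation_def by blast
    from dnormD[OF this, of "[]" x] show ?thesis by (simp add: dist_norm)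
  qed
  ultimately show ?thesis using lt unfolding tame_bij_def localized_translation_def by blast
qed

context
  fixes \<beta> Cchi C \<rho>\<beta> :: real and chi :: "nat \<Rightarrow> plane \<Rightarrow> real" and P :: "conf measure"
  assumes dy: "dyadic_partition chi Cchi"
    and sets_P: "sets P = sets borel" and prob_P: "prob_space P" and dlr: "DLR \<beta> chi P"
    and good: "good_smooth C \<rho>\<beta> P" "good_intensity C P" and C: "C > 0"
begin

interpretation prob_space P by (rule prob_P)

lemma space_P: "space P = UNIV"
  using sets_eq_imp_space_eq[OF sets_P] by simp

abbreviation kern :: "plane set \<Rightarrow> conf \<Rightarrow> conf measure" where
  "kern \<equiv> gibbs_kernel \<beta> chi"

abbreviation inv_event :: "conf set \<Rightarrow> bool" where
  "inv_event \<equiv> resampling_invariant \<beta> chi P"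

text \<open>On \<open>A \<inter> B\<close>, AM-GM gives 2 \<le> t exp(\<beta> D) + exp(-\<beta> D) /
  t for the total second difference D. Exponential moments bound the first term; resampling in the
  disk of radius 10L bounds the second by the translates.\<close>

lemma localized_translation_inequality:
  assumes T: "tame_bij T T'" and leb: "distr lborel lborel T = lborel" "distr lborel lborel T' = lborel"
    and L: "L > 0" and id: "\<And>x. norm x \<ge> 2 * L \<Longrightarrow> T x = x" and lam: "lam > 0" and t: "t > 0"
    and A: "A \<in> sets borel" and B: "inv_event B"
    and E1: "(\<integral>\<^sup>+X. ennreal (exp (2 * \<beta> * Diff1 T T' L X)) \<partial>P) \<le> ennreal E"
    and E2: "(\<integral>\<^sup>+X. ennreal (exp (2 * \<beta> * Diff2 chi T T' L X X)) \<partial>P) \<le> ennreal E" and E: "E > 0"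
  shows "2 * prob (A \<inter> B) \<le> t * E + 1 / t * (lam / 2 * prob (push T' -` A \<inter> B) + 1 / (2 * lam) * prob (push T -` A \<inter> B))"
proof -
  note [measurable_cong] = sets_P
  let ?\<Lambda> = "cball (0::plane) (10 * L)"
  let ?D = "\<lambda>Y. Diff1 T T' L Y + Diff2 chi T T' L Y Y"
  have r: "10 * L > 0" using L by simp
  have Bm[measurable]: "B \<in> sets borel" using B by (simp add: resampling_invariant_def)
  note [measurable] = A measurable_Diff[OF T dy, of L]
  have Dm: "(\<lambda>Y. ennreal (exp (- \<beta> * ?D Y)) * indicator A Y) \<in> borel_measurable borel" by measurable
  have pm: "push T -` A \<in> sets borel" "push T' -` A \<in> sets borel"
    using measurable_sets[OF measurable_push[OF T] A] measurable_sets[OF measurable_push[OF tame_bij_sym[OF T]] A] by simp_all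
  have kB: "(\<integral>\<^sup>+X. indicator B X * emeasure (kern ?\<Lambda> X) A' \<partial>P) = emeasure P (A' \<inter> B)" if "A' \<in> sets borel" for A'
  proof -
    have "(\<integral>\<^sup>+X. indicator B X * emeasure (kern ?\<Lambda> X) A' \<partial>P) = (\<integral>\<^sup>+X. indicator B X * (\<integral>\<^sup>+Y. indicator A' Y \<partial>kern ?\<Lambda> X) \<partial>P)"
      using that by simp
    also have "\<dots> = (\<integral>\<^sup>+X. indicator A' X * indicator B X \<partial>P)"
      using that by (intro dlr_invariant[OF dy sets_P prob_P dlr B r]) auto
    also have "\<dots> = (\<integral>\<^sup>+X. indicator (A' \<inter> B) X \<partial>P)" by (intro nn_integral_cong) (auto simp: indicator_def)
    also have "\<dots> = emeasure P (A' \<inter> B)" using that by (intro nn_integral_indicator) (auto simp: sets_P)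
    finally show ?thesis .
  qed
  have km: "(\<lambda>X. emeasure (kern ?\<Lambda> X) A') \<in> borel_measurable P" if "A' \<in> sets borel" for A'
    by (rule measurable_compose[OF measurable_gibbs_kernel[OF dy sets_P prob_P dlr fat_cball[OF r]] measurable_emeasure_subprob_algebra[OF that]])
  have ks: "AE X in P. (\<integral>\<^sup>+Y. ennreal (exp (- \<beta> * ?D Y)) * indicator A Y \<partial>kern ?\<Lambda> X)
      \<le> ennreal (lam / 2) * emeasure (kern ?\<Lambda> X) (push T' -` A) + ennreal (1 / (2 * lam)) * emeasure (kern ?\<Lambda> X) (push T -` A)"
    by (rule AE_kernel_second_difference[OF dy sets_P prob_P dlr good C T leb L id lam A])
  have I: "(\<integral>\<^sup>+X. ennreal (exp (- \<beta> * ?D X)) * indicator A X * indicator B X \<partial>P)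
    \<le> ennreal (lam / 2) * emeasure P (push T' -` A \<inter> B) + ennreal (1 / (2 * lam)) * emeasure P (push T -` A \<inter> B)"
  proof -
    have "(\<integral>\<^sup>+X. ennreal (exp (- \<beta> * ?D X)) * indicator A X * indicator B X \<partial>P)
      = (\<integral>\<^sup>+X. indicator B X * (\<integral>\<^sup>+Y. ennreal (exp (- \<beta> * ?D Y)) * indicator A Y \<partial>kern ?\<Lambda> X) \<partial>P)"
      by (rule dlr_invariant[OF dy sets_P prob_P dlr B r Dm, symmetric])
    also have "\<dots> \<le> (\<integral>\<^sup>+X. ennreal (lam / 2) * (indicator B X * emeasure (kern ?\<Lambda> X) (push T' -` A))
        + ennreal (1 / (2 * lam)) * (indicator B X * emeasure (kern ?\<Lambda> X) (push T -` A)) \<partial>P)"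
    proof (rule nn_integral_mono_AE)
      show "AE X in P. indicator B X * (\<integral>\<^sup>+Y. ennreal (exp (- \<beta> * ?D Y)) * indicator A Y \<partial>kern ?\<Lambda> X)
        \<le> ennreal (lam / 2) * (indicator B X * emeasure (kern ?\<Lambda> X) (push T' -` A))
        + ennreal (1 / (2 * lam)) * (indicator B X * emeasure (kern ?\<Lambda> X) (push T -` A))"
        using ks by eventually_elim (auto simp: indicator_def)
    qed
    also have "\<dots> = ennreal (lam / 2) * (\<integral>\<^sup>+X. indicator B X * emeasure (kern ?\<Lambda> X) (push T' -` A) \<partial>P)
        + ennreal (1 / (2 * lam)) * (\<integral>\<^sup>+X. indicator B X * emeasure (kern ?\<Lambda> X) (push T -` A) \<partial>P)"
      using km[OF pm(1)] km[OF pm(2)] by (subst nn_integral_add) (auto simp: nn_integral_cmult)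
    finally show ?thesis unfolding kB[OF pm(1)] kB[OF pm(2)] .
  qed
  \<comment> \<open>The exponential of the sum is a product, bounded by half the sum of squares;
    this explains the factor 2 in the assumed moments.\<close>
  have II: "(\<integral>\<^sup>+X. ennreal (exp (\<beta> * ?D X)) \<partial>P) \<le> ennreal E"
  proof -
    have "(\<integral>\<^sup>+X. ennreal (exp (\<beta> * ?D X)) \<partial>P)
      \<le> (\<integral>\<^sup>+X. ennreal (1 / 2) * ennreal (exp (2 * \<beta> * Diff1 T T' L X)) + ennreal (1 / 2) * ennreal (exp (2 * \<beta> * Diff2 chi T T' L X X)) \<partial>P)"
    proof (rule nn_integral_mono)
      fix X
      define a where "a = exp (\<beta> * Diff1 T T' L X)"
      define b where "b = exp (\<beta> * Diff2 chi T T' L X X)"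
      have "a * b \<le> 1 / 2 * a ^ 2 + 1 / 2 * b ^ 2" using zero_le_power2[of "a - b"] by (simp add: power2_diff)
      moreover have "exp (\<beta> * ?D X) = a * b" by (simp add: a_def b_def exp_add[symmetric] distrib_left)
      moreover have "exp (2 * \<beta> * Diff1 T T' L X) = a ^ 2" "exp (2 * \<beta> * Diff2 chi T T' L X X) = b ^ 2"
        by (simp_all add: a_def b_def power2_eq_square exp_add[symmetric])
      ultimately show "ennreal (exp (\<beta> * ?D X)) \<le> ennreal (1 / 2) * ennreal (exp (2 * \<beta> * Diff1 T T' L X)) + ennreal (1 / 2) * ennreal (exp (2 * \<beta> * Diff2 chi T T' L X X))"
      proof -
        assume *: "a * b \<le> 1 / 2 * a ^ 2 + 1 / 2 * b ^ 2" "exp (\<beta> * ?D X) = a * b"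
          "exp (2 * \<beta> * Diff1 T T' L X) = a ^ 2" "exp (2 * \<beta> * Diff2 chi T T' L X X) = b ^ 2"
        have "ennreal (a * b) \<le> ennreal (1 / 2 * a ^ 2 + 1 / 2 * b ^ 2)" using *(1) by (rule ennreal_leI)
        also have "\<dots> = ennreal (1 / 2 * a ^ 2) + ennreal (1 / 2 * b ^ 2)" by (rule ennreal_plus) auto
        also have "\<dots> = ennreal (1 / 2) * ennreal (a ^ 2) + ennreal (1 / 2) * ennreal (b ^ 2)"
          by (intro arg_cong2[where f="(+)"] ennreal_mult) auto
        finally show ?thesis unfolding *(2-4) .
      qed
    qed
    also have "\<dots> = ennreal (1 / 2) * (\<integral>\<^sup>+X. ennreal (exp (2 * \<beta> * Diff1 T T' L X)) \<partial>P) + ennreal (1 / 2) * (\<integral>\<^sup>+X. ennreal (exp (2 * \<beta> * Diff2 chi T T' L X X)) \<partial>P)"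
      by (subst nn_integral_add) (auto simp: nn_integral_cmult)
    also have "\<dots> \<le> ennreal (1 / 2) * ennreal E + ennreal (1 / 2) * ennreal E"
      by (intro add_mono mult_left_mono E1 E2) auto
    also have "\<dots> = ennreal (1 / 2 * E + 1 / 2 * E)"
    proof -
      have "ennreal (1 / 2 * E) = ennreal (1 / 2) * ennreal E" using E by (intro ennreal_mult) auto
      moreover have "ennreal (1 / 2 * E + 1 / 2 * E) = ennreal (1 / 2 * E) + ennreal (1 / 2 * E)"
        using E by (intro ennreal_plus) auto
      ultimately show ?thesis by (simp only:)
    qed
    also have "\<dots> = ennreal E" by simp
    finally show ?thesis .
  qed
  have "ennreal (2 * prob (A \<inter> B)) = 2 * emeasure P (A \<inter> B)"
    by (simp add: emeasure_eq_measure ennreal_mult)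
  also have "\<dots> = (\<integral>\<^sup>+X. 2 * indicator (A \<inter> B) X \<partial>P)"
    by (rule nn_integral_cmult_indicator[symmetric]) (auto simp: sets_P)
  also have "\<dots> \<le> (\<integral>\<^sup>+X. ennreal t * ennreal (exp (\<beta> * ?D X)) + ennreal (1 / t) * (ennreal (exp (- \<beta> * ?D X)) * indicator A X * indicator B X) \<partial>P)"
  proof (rule nn_integral_mono)
    fix X
    show "2 * indicator (A \<inter> B) X \<le> ennreal t * ennreal (exp (\<beta> * ?D X)) + ennreal (1 / t) * (ennreal (exp (- \<beta> * ?D X)) * indicator A X * indicator B X)"
    proof (cases "X \<in> A \<inter> B")
      case True
      define s where "s = exp (\<beta> * ?D X)"
      have s: "s > 0" "exp (- \<beta> * ?D X) = 1 / s" by (simp_all add: s_def exp_minus inverse_eq_divide)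
      have "0 \<le> (t * s - 1) ^ 2 / (t * s)" using s t by simp
      also have "\<dots> = t * s + 1 / t * (1 / s) - 2" using s(1) t by (simp add: field_simps power2_eq_square)
      finally have le: "2 \<le> t * s + 1 / t * (1 / s)" by simp
      have "2 = ennreal 2" by simp
      also have "\<dots> \<le> ennreal (t * s + 1 / t * (1 / s))" using le by (rule ennreal_leI)
      also have "\<dots> = ennreal t * ennreal s + ennreal (1 / t) * ennreal (1 / s)"
        using s(1) t by (simp add: ennreal_plus ennreal_mult[symmetric])
      finally show ?thesis using True unfolding s(2) s_def[symmetric] by simp
    qed simp
  qed
  also have "\<dots> = ennreal t * (\<integral>\<^sup>+X. ennreal (exp (\<beta> * ?D X)) \<partial>P)
      + ennreal (1 / t) * (\<integral>\<^sup>+X. ennreal (exp (- \<beta> * ?D X)) * indicator A X * indicator B X \<partial>P)"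
    by (subst nn_integral_add) (auto simp: nn_integral_cmult)
  also have "\<dots> \<le> ennreal t * ennreal E + ennreal (1 / t) * (ennreal (lam / 2) * emeasure P (push T' -` A \<inter> B) + ennreal (1 / (2 * lam)) * emeasure P (push T -` A \<inter> B))"
    by (intro add_mono mult_left_mono I II) auto
  also have "\<dots> = ennreal (t * E + 1 / t * (lam / 2 * prob (push T' -` A \<inter> B) + 1 / (2 * lam) * prob (push T -` A \<inter> B)))"
    using t E lam by (simp add: emeasure_eq_measure ennreal_mult[symmetric] ennreal_plus[symmetric] del: ennreal_plus)
  finally show ?thesis
    using t E lam by (subst (asm) ennreal_le_iff) (auto intro!: add_nonneg_nonneg mult_nonneg_nonneg)
qed

context
  fixes Tp Tm :: "plane \<Rightarrow> real \<Rightarrow> plane \<Rightarrow> plane" and CT L0 :: real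
  assumes lts: "localized_translations CT Tp Tm" and L0: "L0 \<ge> 2" and gt: "good_translations C L0 \<beta> chi Tp Tm P"
begin

text \<open>L is chosen at least as large as the radius on which \<open>A\<close> depends, which
  turns the localized maps into true translations; the bound \<open>exp C\<close> does not depend on
  L.\<close>

lemma translation_inequality_local:
  assumes v: "norm v \<le> 1" and lam: "lam > 0" and t: "t > 0" and A: "A \<in> local_events" and B: "inv_event B"
  shows "2 * prob (A \<inter> B) \<le> t * exp C
    + 1 / t * (lam / 2 * prob (push (\<lambda>x. x - v) -` A \<inter> B) + 1 / (2 * lam) * prob (push (\<lambda>x. x + v) -` A \<inter> B))"
proof -
  obtain r where r: "\<And>X Y. (\<forall>x\<in>cball 0 r. mult X x = mult Y x) \<Longrightarrow> (X \<in> A \<longleftrightarrow> Y \<in> A)" and Ab: "A \<in> sets borel"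
    using A unfolding local_events_def by blast
  define L where "L = max L0 r"
  have L: "L \<ge> L0" "L \<ge> r" "L > 0" "L \<ge> 2" using L0 by (auto simp: L_def)
  have lt: "localized_translation CT v L (Tp v L) (Tm v L)"
    using lts v L unfolding localized_translations_def by blast
  note T = localized_translation_tame[OF lt]
  have "push (Tp v L) -` A = push (\<lambda>x. x + v) -` A"
  proof (rule set_eqI, unfold vimage_eq, rule r, rule ballI)
    fix X and x :: plane assume "x \<in> cball 0 r"
    then show "mult (push (Tp v L) X) x = mult (push (\<lambda>x. x + v) X) x"
      using lt L unfolding mult_push[OF T] mult_push[OF tame_bij_translation] localized_translation_def by simp
  qed
  moreover have "push (Tm v L) -` A = push (\<lambda>x. x - v) -` A"
  proof (rule set_eqI, unfold vimage_eq, rule r, rule ballI)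
    fix X and x :: plane assume "x \<in> cball 0 r"
    then show "mult (push (Tm v L) X) x = mult (push (\<lambda>x. x - v) X) x"
      using lt L unfolding mult_push[OF tame_bij_sym[OF T]] mult_push[OF tame_bij_sym[OF tame_bij_translation]] localized_translation_def by simp
  qed
  moreover have "2 * prob (A \<inter> B) \<le> t * exp C + 1 / t * (lam / 2 * prob (push (Tm v L) -` A \<inter> B) + 1 / (2 * lam) * prob (push (Tp v L) -` A \<inter> B))"
  proof (rule localized_translation_inequality[OF T _ _ L(3) _ lam t Ab B])
    show "distr lborel lborel (Tp v L) = lborel" "distr lborel lborel (Tm v L) = lborel"
      using lt unfolding localized_translation_def by blast+
    show "Tp v L x = x" if "2 * L \<le> norm x" for x using lt that unfolding localized_translation_def by blast
    show "(\<integral>\<^sup>+X. ennreal (exp (2 * \<beta> * Diff1 (Tp v L) (Tm v L) L X)) \<partial>P) \<le> ennreal (exp C)"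
      "(\<integral>\<^sup>+X. ennreal (exp (2 * \<beta> * Diff2 chi (Tp v L) (Tm v L) L X X)) \<partial>P) \<le> ennreal (exp C)"
      using gt v L(1) unfolding good_translations_def by (auto intro!: log_expect_le)
  qed simp
  ultimately show ?thesis by simp
qed

lemma translation_inequality:
  assumes v: "norm v \<le> 1" and lam: "lam > 0" and t: "t > 0" and A: "A \<in> sets borel" and B: "inv_event B"
  shows "2 * prob (A \<inter> B) \<le> t * exp C
    + 1 / t * (lam / 2 * prob (push (\<lambda>x. x - v) -` A \<inter> B) + 1 / (2 * lam) * prob (push (\<lambda>x. x + v) -` A \<inter> B))"
    (is "_ \<le> ?rhs A")
proof -
  let ?T = "push (\<lambda>x. x + v)" and ?S = "push (\<lambda>x. x - v)"
  note [measurable_cong] = sets_P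
  have Bm[measurable]: "B \<in> sets borel" using B by (simp add: resampling_invariant_def)
  let ?M = "\<lambda>i::nat. if i = 0 then P else if i = 1 then distr P borel (?S) else distr P borel (?T)"
  have pm: "?S \<in> P \<rightarrow>\<^sub>M borel" "?T \<in> P \<rightarrow>\<^sub>M borel"
    using measurable_push[OF tame_bij_translation[of v]] measurable_push[OF tame_bij_sym[OF tame_bij_translation[of v]]] by measurable
  have M: "finite_measure (?M i)" "sets (?M i) = sets borel" for i
    using finite_measure_distr[OF pm(1)] finite_measure_distr[OF pm(2)] finite_measure_axioms sets_P by auto
  \<comment> \<open>The total weight with which an approximation error \<open>d\<close> enters:
    twice on the left, and through the two coefficients on the right.\<close>
  define K where "K = 2 + 1 / t * (lam / 2 + 1 / (2 * lam))"
  have K: "K > 0" using t lam by (auto simp: K_def intro!: add_pos_nonneg)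
  show ?thesis
  proof (rule field_le_epsilon)
    fix e :: real assume e: "e > 0"
    define d where "d = e / K"
    have d: "d > 0" "d * K = e" using e K by (auto simp: d_def)
    obtain A' where A': "A' \<in> local_events" and close: "\<forall>i\<in>{0,1,2}. measure (?M i) (sym_diff A A') < d"
      using local_approximation[of "{0,1,2}" ?M A d] M A d(1) by auto
    have A'm[measurable]: "A' \<in> sets borel" using A' by (auto simp: local_events_def)
    note [measurable] = A
    have sd[measurable]: "sym_diff A A' \<in> sets borel" by measurable
    have near: "prob (f -` U \<inter> B) \<le> prob (f -` U' \<inter> B) + d"
      if f: "f \<in> P \<rightarrow>\<^sub>M borel" and le: "measure (distr P borel f) (sym_diff A A') < d" and U: "(U, U') \<in> {(A, A'), (A', A)}" for f U U'
    proof -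
      have s: "f -` V \<in> sets P" if "V \<in> sets borel" for V using measurable_sets[OF f that] space_P by simp
      have Bs: "B \<in> sets P" by (simp add: sets_P)
      have "prob (f -` U \<inter> B) \<le> prob ((f -` U' \<inter> B) \<union> f -` (sym_diff A A'))"
        using U s Bs A A'm sd by (intro finite_measure_mono) auto
      also have "\<dots> \<le> prob (f -` U' \<inter> B) + prob (f -` (sym_diff A A'))"
        using U s Bs A A'm sd by (intro measure_Un_le) auto
      also have "prob (f -` (sym_diff A A')) = measure (distr P borel f) (sym_diff A A')"
        using f sd by (simp add: measure_distr space_P)
      finally show ?thesis using le by simp
    qed
    have idd: "distr P borel (\<lambda>x. x) = P" by (rule distr_id2) (simp add: sets_P)
    have idm: "(\<lambda>x. x) \<in> P \<rightarrow>\<^sub>M borel" by (rule measurable_ident_sets[OF sets_P])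
    have "measure (distr P borel (\<lambda>x. x)) (sym_diff A A') < d" unfolding idd using bspec[OF close, of 0] by simp
    from near[OF idm this, of A A'] have "prob (A \<inter> B) \<le> prob (A' \<inter> B) + d" by simp
    moreover have "prob (?S -` A' \<inter> B) \<le> prob (?S -` A \<inter> B) + d"
      using near[OF pm(1), of A' A] bspec[OF close, of 1] by simp
    moreover have "prob (?T -` A' \<inter> B) \<le> prob (?T -` A \<inter> B) + d"
      using near[OF pm(2), of A' A] bspec[OF close, of 2] by simp
    moreover note translation_inequality_local[OF v lam t A' B]
    ultimately have "2 * prob (A \<inter> B) \<le> 2 * d + t * exp C
      + 1 / t * (lam / 2 * (prob (?S -` A \<inter> B) + d) + 1 / (2 * lam) * (prob (?T -` A \<inter> B) + d))"
    proof -
      assume 1: "prob (A \<inter> B) \<le> prob (A' \<inter> B) + d"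
        and 2: "prob (?S -` A' \<inter> B) \<le> prob (?S -` A \<inter> B) + d"
        and 3: "prob (?T -` A' \<inter> B) \<le> prob (?T -` A \<inter> B) + d"
        and 4: "2 * prob (A' \<inter> B) \<le> ?rhs A'"
      have "1 / t * (lam / 2 * prob (?S -` A' \<inter> B) + 1 / (2 * lam) * prob (?T -` A' \<inter> B))
        \<le> 1 / t * (lam / 2 * (prob (?S -` A \<inter> B) + d) + 1 / (2 * lam) * (prob (?T -` A \<inter> B) + d))"
        using 2 3 t lam by (intro mult_left_mono add_mono) auto
      then show ?thesis using 1 4 by linarith
    qed
    also have "\<dots> = ?rhs A + d * K" by (simp add: K_def algebra_simps)
    finally show "2 * prob (A \<inter> B) \<le> ?rhs A + e" by (simp add: d(2))
  qed
qed

end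

end

section \<open>Translation invariance\<close>

context
  fixes \<beta> Cchi C \<rho>\<beta> :: real and chi :: "nat \<Rightarrow> plane \<Rightarrow> real" and P :: "conf measure"
    and Tp Tm :: "plane \<Rightarrow> real \<Rightarrow> plane \<Rightarrow> plane" and CT L0 :: real
  assumes dy: "dyadic_partition chi Cchi"
    and sets_P: "sets P = sets borel" and prob_P: "prob_space P" and dlr: "DLR \<beta> chi P"
    and good: "good_smooth C \<rho>\<beta> P" "good_intensity C P" and C: "C > 0"
    and lts: "localized_translations CT Tp Tm" and L0: "L0 \<ge> 2" and gt: "good_translations C L0 \<beta> chi Tp Tm P"
begin

interpretation prob_space P by (rule prob_P)

text \<open>In the inequality the free weights make the term of the non-null translate negligible,
  and then t tends to 0.\<close>

lemma translated_null:
  assumes v: "norm v \<le> 1" and A: "A \<in> sets borel" and B: "resampling_invariant \<beta> chi P B"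
    and 0: "prob (push (\<lambda>x. x + v) -` A \<inter> B) = 0 \<or> prob (push (\<lambda>x. x - v) -` A \<inter> B) = 0"
  shows "prob (A \<inter> B) = 0"
proof -
  note ineq = translation_inequality[OF dy sets_P prob_P dlr good C lts L0 gt v _ _ A B]
  have "2 * prob (A \<inter> B) \<le> t * (exp C + 1 / 4)" if t: "t > 0" for t
  proof -
    have le: "lam / 2 * a + 1 / (2 * lam) * b \<le> t ^ 2 / 4"
      if "lam = (if a = 0 then 2 / t ^ 2 else t ^ 2 / 2)" "0 \<le> a" "a \<le> 1" "0 \<le> b" "b \<le> 1" "a = 0 \<or> b = 0" for lam a b :: real
    proof (cases "a = 0")
      case True
      then show ?thesis using that t mult_left_mono[of b 1 "t ^ 2"] by simp
    next
      case False
      then have "lam / 2 * a + 1 / (2 * lam) * b = t ^ 2 * a / 4" using that by simp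
      also have "\<dots> \<le> t ^ 2 / 4" using that t mult_left_mono[of a 1 "t ^ 2"] by simp
      finally show ?thesis .
    qed
    \<comment> \<open>With this choice the coefficient of the possibly nonzero probability is t^2 /
      4 in either case, so division by \<open>t\<close> leaves a term of order t.\<close>
    define lam where "lam = (if prob (push (\<lambda>x. x - v) -` A \<inter> B) = 0 then 2 / t ^ 2 else t ^ 2 / 2)"
    have "lam > 0" using t by (simp add: lam_def)
    have "2 * prob (A \<inter> B) \<le> t * exp C + 1 / t * (lam / 2 * prob (push (\<lambda>x. x - v) -` A \<inter> B) + 1 / (2 * lam) * prob (push (\<lambda>x. x + v) -` A \<inter> B))"
      using ineq[OF \<open>lam > 0\<close> t] .
    also have "\<dots> \<le> t * exp C + 1 / t * (t ^ 2 / 4)"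
      using t 0 by (intro add_left_mono mult_left_mono le) (auto simp: lam_def)
    also have "\<dots> = t * (exp C + 1 / 4)" using t by (simp add: power2_eq_square field_simps)
    finally show ?thesis .
  qed
  then have "2 * prob (A \<inter> B) \<le> e" if "e > 0" for e
  proof -
    have pos: "exp C + 1 / 4 > 0" by (simp add: add_pos_pos)
    then have "e / (exp C + 1 / 4) > 0" using that by simp
    from \<open>\<And>t. t > 0 \<Longrightarrow> 2 * prob (A \<inter> B) \<le> t * (exp C + 1 / 4)\<close>[OF this] show ?thesis using pos by simp
  qed
  then have "2 * prob (A \<inter> B) \<le> 0" using field_le_epsilon[of "2 * prob (A \<inter> B)" 0] by simp
  then show ?thesis using measure_nonneg[of P "A \<inter> B"] by linarith
qed

lemma AE_kernel_prob:
  assumes "r > 0"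
  shows "AE X in P. prob_space (gibbs_kernel \<beta> chi (cball a r) X)"
  by (rule AE_prob_gibbs_kernel[OF dy sets_P prob_P dlr fat_cball[OF assms]])

text \<open>A density of a second resampling-invariant law has resampling-invariant sublevel sets:
  comparing \<open>\<integral> (1 - h) \<Gamma>(B)\<close> with \<open>\<integral> (1 - h) 1\<^sub>B\<close> forces \<open>\<Gamma>(B) = 1\<^sub>B\<close>.\<close>

lemma sublevel_resampling_invariant:
  fixes h :: "conf \<Rightarrow> real"
  assumes h: "h \<in> borel_measurable borel" "\<And>X. 0 \<le> h X" "integrable P h"
    and inv: "\<And>a r A. r > 0 \<Longrightarrow> A \<in> sets borel \<Longrightarrow>
      (LINT X|P. h X * measure (gibbs_kernel \<beta> chi (cball a r) X) A) = (LINT X|P. h X * indicator A X)"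
  shows "resampling_invariant \<beta> chi P {X. h X < 1}"
  unfolding resampling_invariant_def
proof (intro conjI allI impI)
  let ?B = "{X. h X < 1}" and ?\<Gamma> = "gibbs_kernel \<beta> chi"
  note [measurable] = h(1)
  have "{X \<in> space borel. h X < 1} \<in> sets borel" by measurable
  then show B[measurable]: "?B \<in> sets borel" by simp
  fix a :: plane and r :: real assume r: "r > 0"
  let ?g = "\<lambda>X. measure (?\<Gamma> (cball a r) X) ?B"
  have sub: "subprob_space (?\<Gamma> (cball a r) X)" for X
    by (rule subprob_gibbs_kernel[OF dy]) simp
  have g: "0 \<le> ?g X" "?g X \<le> 1" for X
    using subprob_space.subprob_measure_le_1[OF sub] by auto
  note d = dlr_indicator[OF dy sets_P prob_P dlr fat_cball[OF r, of a] B]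
  have sP: "?B \<in> sets P" using B sets_P by simp
  have iB: "integrable P (indicator ?B :: conf \<Rightarrow> real)"
    using sP by (intro integrable_real_indicator) (auto simp: emeasure_eq_measure)
  have gm: "?g \<in> borel_measurable P" using d(1) by auto
  have ihg: "integrable P (\<lambda>X. h X * ?g X)"
    by (rule Bochner_Integration.integrable_bound[OF h(3)])
       (use gm h(3) in \<open>auto simp: abs_mult h(2) g intro!: mult_left_le\<close>)
  have ihB: "integrable P (\<lambda>X. h X * indicator ?B X)"
    by (rule Bochner_Integration.integrable_bound[OF h(3)])
       (use sP h(3) in \<open>auto simp: indicator_def\<close>)
  have eB: "(LINT X|P. indicator ?B X) = measure P ?B"
    using sP sets_eq_imp_space_eq[OF sets_P] by simp
  \<comment> \<open>This is (1_B - \<Gamma>(B)) (1 - h). Both factors are nonnegative on B and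
    nonpositive off it, while the two invariance identities give it mean 0.\<close>
  let ?\<phi> = "\<lambda>X. (indicator ?B X - ?g X) - (h X * indicator ?B X - h X * ?g X)"
  have "integrable P ?\<phi>" using iB d(1) ihg ihB by auto
  moreover have "(LINT X|P. ?\<phi> X) = 0"
    using iB d ihg ihB inv[OF r B, of a] eB by simp
  moreover have "0 \<le> ?\<phi> X" for X
  proof -
    have eq: "?\<phi> X = (indicator ?B X - ?g X) * (1 - h X)" by (simp add: algebra_simps)
    show ?thesis unfolding eq
    proof (cases "h X < 1")
      case True
      then show "0 \<le> (indicator ?B X - ?g X) * (1 - h X)" using g(2)[of X] by simp
    next
      case False
      then show "0 \<le> (indicator ?B X - ?g X) * (1 - h X)" using g(1)[of X] by (simp add: mult_nonneg_nonpos)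
    qed
  qed
  ultimately have "AE X in P. ?\<phi> X = 0" using integral_nonneg_eq_0_iff_AE[of P ?\<phi>] by simp
  \<comment> \<open>Where h = 1 the product vanishes trivially, so only \<Gamma>(B) = 1 on B is
    obtained. The statement off B follows because \<Gamma>(B) \<ge> 1_B with equal means.\<close>
  then have on: "AE X in P. X \<in> ?B \<longrightarrow> ?g X = 1"
  proof eventually_elim
    case (elim X)
    have "?\<phi> X = (indicator ?B X - ?g X) * (1 - h X)" by (simp add: algebra_simps)
    then show ?case using elim by auto
  qed
  have "AE X in P. 0 \<le> ?g X - indicator ?B X" using on by eventually_elim (use g in \<open>auto simp: indicator_def\<close>)
  moreover have "(LINT X|P. ?g X - indicator ?B X) = 0" using iB d eB by simp
  moreover have "integrable P (\<lambda>X. ?g X - indicator ?B X)" using iB d by simp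
  ultimately have "AE X in P. ?g X - indicator ?B X = 0"
    using integral_nonneg_eq_0_iff_AE[of P "\<lambda>X. ?g X - indicator ?B X"] by simp
  then show "AE X in P. emeasure (?\<Gamma> (cball a r) X) ?B = indicator ?B X"
  proof eventually_elim
    case (elim X)
    have "emeasure (?\<Gamma> (cball a r) X) ?B = ennreal (?g X)"
      by (rule finite_measure.emeasure_eq_measure[OF subprob_space.axioms(1)[OF sub]])
    then show ?case using elim by (auto simp: indicator_def split: if_splits)
  qed
qed

lemma translation_invariant_small:
  assumes v: "norm v \<le> 1"
  shows "distr P borel (push (\<lambda>x. x + v)) = P"
proof -
  let ?T = "push (\<lambda>x. x + v)" and ?T' = "push (\<lambda>x. x - v)" and ?\<Gamma> = "gibbs_kernel \<beta> chi"
  note T = tame_bij_translation[of v]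
  have Tm: "?T \<in> borel \<rightarrow>\<^sub>M borel" "?T' \<in> borel \<rightarrow>\<^sub>M borel"
    using measurable_push[OF T] measurable_push[OF tame_bij_sym[OF T]] by auto
  have TP: "?T \<in> P \<rightarrow>\<^sub>M borel" using Tm(1) by (simp add: measurable_cong_sets[OF sets_P refl])
  have space_P: "space P = UNIV" using sets_eq_imp_space_eq[OF sets_P] by simp
  have vs: "?T -` A \<in> sets borel" "?T' -` A \<in> sets borel" if "A \<in> sets borel" for A
    using measurable_sets[OF Tm(1) that] measurable_sets[OF Tm(2) that] by simp_all
  have TT': "?T -` (?T' -` A) = A" "?T' -` (?T -` A) = A" for A
    using push_inverse[OF T] push_inverse[OF tame_bij_sym[OF T]] by (auto simp: vimage_def)
  define \<nu> where "\<nu> = distr P borel ?T"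
  have sets_\<nu>: "sets \<nu> = sets borel" by (simp add: \<nu>_def)
  have em\<nu>: "emeasure \<nu> A = emeasure P (?T -` A)" if "A \<in> sets borel" for A
    unfolding \<nu>_def using emeasure_distr[OF TP that] space_P by simp
  have invU: "resampling_invariant \<beta> chi P UNIV"
    unfolding resampling_invariant_def
  proof (intro conjI allI impI)
    fix a :: plane and r :: real assume r: "r > 0"
    show "AE X in P. emeasure (?\<Gamma> (cball a r) X) UNIV = indicator UNIV X"
      using AE_kernel_prob[OF r, of a] by eventually_elim (auto dest: prob_space.emeasure_space_1)
  qed simp
  have ac: "absolutely_continuous P \<nu>"
    unfolding absolutely_continuous_def
  proof
    fix A assume "A \<in> null_sets P"
    then have A: "A \<in> sets borel" "emeasure P A = 0" using sets_P by auto
    \<comment> \<open>The inequality is applied to the preimage of \<open>A\<close>: translating it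
      back by -v gives \<open>A\<close> itself, which is null.\<close>
    have "prob (?T -` A \<inter> UNIV) = 0"
      by (rule translated_null[OF v vs(1)[OF A(1)] invU]) (use A TT' in \<open>simp add: measure_def\<close>)
    then show "A \<in> null_sets \<nu>" using A em\<nu>[OF A(1)] sets_\<nu> by (auto simp: null_sets_def emeasure_eq_measure)
  qed
  define H where "H = RN_deriv P \<nu>"
  have H[measurable]: "H \<in> borel_measurable P" unfolding H_def by simp
  have dH: "density P H = \<nu>"
    unfolding H_def by (rule density_RN_deriv[OF ac]) (simp add: sets_\<nu> sets_P)
  have p\<nu>: "prob_space \<nu>" unfolding \<nu>_def by (rule prob_space_distr[OF TP])
  have intH: "(\<integral>\<^sup>+X. H X \<partial>P) = 1"
  proof -
    have "emeasure (density P H) (space P) = (\<integral>\<^sup>+X. H X * indicator (space P) X \<partial>P)" by (rule emeasure_density) auto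
    then show ?thesis unfolding dH using prob_space.emeasure_space_1[OF p\<nu>] sets_eq_imp_space_eq[OF sets_\<nu>] space_P by simp
  qed
  define h where "h X = enn2real (H X)" for X
  have hm: "h \<in> borel_measurable P" unfolding h_def by measurable
  have h0: "0 \<le> h X" for X by (simp add: h_def)
  have "AE X in P. H X \<noteq> \<infinity>" using intH by (intro nn_integral_noteq_infinite) auto
  then have hH: "AE X in P. H X = ennreal (h X)" by eventually_elim (auto simp: h_def less_top)
  have inth: "integrable P h" "(LINT X|P. h X) = 1"
  proof -
    have n1: "(\<integral>\<^sup>+X. ennreal (h X) \<partial>P) = ennreal 1"
      using nn_integral_cong_AE[OF hH] intH by simp
    show "integrable P h" by (rule integrableI_nn_integral_finite[OF hm _ n1]) (simp add: h0)
    show "(LINT X|P. h X) = 1" using integral_eq_nn_integral[OF hm] n1 h0 by simp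
  qed
  have d\<nu>: "\<nu> = density P (\<lambda>X. ennreal (h X))"
    unfolding dH[symmetric] using hH hm by (intro density_cong) auto
  have int\<nu>: "(LINT X|\<nu>. f X) = (LINT X|P. h X * f X)" if "f \<in> borel_measurable P" for f :: "conf \<Rightarrow> real"
    unfolding d\<nu> using that hm h0 by (subst integral_density) auto
  have m\<nu>: "measure \<nu> A = (LINT X|P. h X * indicator A X)" if "A \<in> sets borel" for A
    using int\<nu>[of "indicator A"] that sets_P sets_\<nu> sets_eq_imp_space_eq[OF sets_\<nu>] by simp
  have cov: "AE X in P. ?\<Gamma> (cball (a + v) r) (?T X) = distr (?\<Gamma> (cball a r) X) borel ?T"
    if r: "r > 0" for a r
  proof -
    have "(\<lambda>x. x + v) ` cball a r = cball (a + v) r"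
      using cball_translation[of v a r] by (simp add: add.commute)
    then show ?thesis using AE_gibbs_kernel_translation[OF dy sets_P prob_P dlr good C fat_cball[OF r, of a] v] by simp
  qed
  \<comment> \<open>Covariance turns the kernel at \<open>?T X\<close> into the kernel of the
    shifted disk at \<open>X\<close>, and the DLR equations for that disk show that
    \<open>\<nu>\<close> is preserved as well.\<close>
  have h_inv: "(LINT X|P. h X * measure (?\<Gamma> (cball a r) X) A) = (LINT X|P. h X * indicator A X)"
    if r: "r > 0" and A: "A \<in> sets borel" for a r A
  proof -
    let ?g = "\<lambda>X. measure (?\<Gamma> (cball a r) X) A"
    have gm: "?g \<in> borel_measurable P"
      using dlr_indicator(1)[OF dy sets_P prob_P dlr fat_cball[OF r, of a] A] by auto
    then have gb: "?g \<in> borel_measurable borel" by (simp add: measurable_cong_sets[OF sets_P refl])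
    have "(LINT X|P. h X * ?g X) = (LINT X|\<nu>. ?g X)" by (rule int\<nu>[OF gm, symmetric])
    also have "\<dots> = (LINT X|P. ?g (?T X))" unfolding \<nu>_def by (rule integral_distr[OF TP gb])
    also have "\<dots> = (LINT X|P. measure (?\<Gamma> (cball (a - v) r) X) (?T -` A))"
    proof (rule integral_cong_AE)
      show "(\<lambda>X. ?g (?T X)) \<in> borel_measurable P" using measurable_compose[OF TP gb] .
      show "(\<lambda>X. measure (?\<Gamma> (cball (a - v) r) X) (?T -` A)) \<in> borel_measurable P"
        using dlr_indicator(1)[OF dy sets_P prob_P dlr fat_cball[OF r, of "a - v"] vs(1)[OF A]] by auto
      show "AE X in P. ?g (?T X) = measure (?\<Gamma> (cball (a - v) r) X) (?T -` A)"
        using cov[OF r, of "a - v"] by eventually_elim (use A Tm(1) in \<open>simp add: measure_distr\<close>)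
    qed
    also have "\<dots> = measure P (?T -` A)"
      by (rule dlr_indicator(2)[OF dy sets_P prob_P dlr fat_cball[OF r] vs(1)[OF A]])
    also have "\<dots> = measure \<nu> A" using em\<nu>[OF A] by (simp add: measure_def)
    also have "\<dots> = (LINT X|P. h X * indicator A X)" by (rule m\<nu>[OF A])
    finally show ?thesis .
  qed
  let ?B = "{X. h X < 1}"
  have hb: "h \<in> borel_measurable borel" using hm by (simp add: measurable_cong_sets[OF sets_P refl])
  have invB: "resampling_invariant \<beta> chi P ?B"
    by (rule sublevel_resampling_invariant[OF hb h0 inth(1) h_inv])
  have B[measurable]: "?B \<in> sets borel" using invB by (simp add: resampling_invariant_def)
  let ?D = "?B - ?T -` ?B"
  have D: "?D \<in> sets borel" using B vs(1)[OF B] by auto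
  have invD: "resampling_invariant \<beta> chi P ?D"
    unfolding resampling_invariant_def
  proof (intro conjI allI impI D)
    fix a :: plane and r :: real assume r: "r > 0"
    have "AE Y in \<nu>. emeasure (?\<Gamma> (cball (a + v) r) Y) ?B = indicator ?B Y"
      \<comment> \<open>The invariance of \<open>?B\<close> holds almost surely under
        \<open>P\<close>; absolute continuity moves it to \<open>\<nu>\<close>, so it may be
        evaluated at \<open>?T X\<close>.\<close>
      by (rule absolutely_continuous_AE[OF _ ac]) (use invB r in \<open>simp_all add: resampling_invariant_def sets_\<nu> sets_P\<close>)
    then have 1: "AE X in P. emeasure (?\<Gamma> (cball (a + v) r) (?T X)) ?B = indicator ?B (?T X)"
      unfolding \<nu>_def by (rule AE_distrD[OF TP])
    have 2: "AE X in P. emeasure (?\<Gamma> (cball a r) X) ?B = indicator ?B X"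
      using invB r by (simp add: resampling_invariant_def)
    show "AE X in P. emeasure (?\<Gamma> (cball a r) X) ?D = indicator ?D X"
      using 1 2 cov[OF r, of a] AE_kernel_prob[OF r, of a]
    proof eventually_elim
      case (elim X)
      interpret K: prob_space "?\<Gamma> (cball a r) X" by fact
      have b: "emeasure (?\<Gamma> (cball a r) X) (?T -` ?B) = indicator (?T -` ?B) X"
        using elim(1) B Tm(1) unfolding elim(3) by (simp add: emeasure_distr indicator_def)
      show ?case
      proof (cases "X \<in> ?B")
        case False
        have "emeasure (?\<Gamma> (cball a r) X) ?D \<le> emeasure (?\<Gamma> (cball a r) X) ?B"
          using B by (intro emeasure_mono) auto
        then show ?thesis using elim(2) False by simp
      next
        case XB: True
        show ?thesis
        proof (cases "X \<in> ?T -` ?B")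
          case True
          have "emeasure (?\<Gamma> (cball a r) X) ?D \<le> emeasure (?\<Gamma> (cball a r) X) (- (?T -` ?B))"
            using vs(1)[OF B] by (intro emeasure_mono) auto
          also have "\<dots> = 0"
            using emeasure_compl[of "?T -` ?B" "?\<Gamma> (cball a r) X"] vs(1)[OF B] b True K.emeasure_space_1 by (simp add: Compl_eq_Diff_UNIV)
          finally show ?thesis using True by simp
        next
          case False
          have "emeasure (?\<Gamma> (cball a r) X) ?B
            \<le> emeasure (?\<Gamma> (cball a r) X) ?D + emeasure (?\<Gamma> (cball a r) X) (?T -` ?B)"
            using B D vs(1)[OF B] by (intro order_trans[OF emeasure_mono emeasure_subadditive]) auto
          then have "1 \<le> emeasure (?\<Gamma> (cball a r) X) ?D" using elim(2) b XB False by simp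
          then have "emeasure (?\<Gamma> (cball a r) X) ?D = 1" using K.emeasure_le_1[of ?D] by (intro antisym)
          then show ?thesis using XB False by simp
        qed
      qed
    qed
  qed
  have "prob (?D \<inter> ?D) = 0"
  proof (rule translated_null[OF v D invD])
    \<comment> \<open>\<open>?D\<close> avoids the preimage of \<open>?B\<close>, whereas the
      preimage of \<open>?D\<close> is contained in it.\<close>
    have "?T -` ?D \<inter> ?D = {}" by auto
    then show "prob (?T -` ?D \<inter> ?D) = 0 \<or> prob (?T' -` ?D \<inter> ?D) = 0" by simp
  qed
  then have D0: "prob ?D = 0" by simp
  have "prob ?B \<le> prob (?D \<union> ?T -` ?B)"
    using D vs(1)[OF B] sets_P by (intro finite_measure_mono) auto
  also have "\<dots> \<le> prob ?D + prob (?T -` ?B)"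
    using D vs(1)[OF B] sets_P by (intro measure_Un_le) auto
  also have "\<dots> = (LINT X|P. h X * indicator ?B X)"
    using D0 em\<nu>[OF B] m\<nu>[OF B] by (simp add: measure_def)
  finally have le: "prob ?B \<le> (LINT X|P. h X * indicator ?B X)" .
  have iB: "integrable P (indicator ?B :: conf \<Rightarrow> real)"
    using B sets_P by (intro integrable_real_indicator) (auto simp: emeasure_eq_measure)
  have ihB: "integrable P (\<lambda>X. h X * indicator ?B X)"
    by (rule Bochner_Integration.integrable_bound[OF inth(1)])
       (use B sets_P hm in \<open>auto simp: indicator_def\<close>)
  have eB: "(LINT X|P. indicator ?B X) = prob ?B" using B sets_P space_P by simp
  \<comment> \<open>Equal to 1 - h on B and to 0 elsewhere, hence strictly positive exactly on B; a
    mean of at most 0 makes B null.\<close>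
  let ?\<phi> = "\<lambda>X. indicator ?B X - h X * indicator ?B X"
  have nn: "0 \<le> ?\<phi> X" for X by (simp add: indicator_def)
  have "(LINT X|P. ?\<phi> X) \<le> 0" using iB ihB eB le by simp
  moreover have "0 \<le> (LINT X|P. ?\<phi> X)" using nn by (intro Bochner_Integration.integral_nonneg) auto
  ultimately have "(LINT X|P. ?\<phi> X) = 0" by linarith
  then have "AE X in P. ?\<phi> X = 0" using integral_nonneg_eq_0_iff_AE[of P ?\<phi>] nn iB ihB by simp
  then have ge1: "AE X in P. 0 \<le> h X - 1" by eventually_elim (auto simp: indicator_def split: if_splits)
  have "(LINT X|P. h X - 1) = 0" using inth prob_space by simp
  moreover have "integrable P (\<lambda>X. h X - 1)" using inth by simp
  ultimately have "AE X in P. h X - 1 = 0"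
    using integral_nonneg_eq_0_iff_AE[of P "\<lambda>X. h X - 1"] ge1 by simp
  then have "\<nu> = density P (\<lambda>_. 1)" unfolding d\<nu> using hm by (intro density_cong) auto
  then show ?thesis by (simp add: \<nu>_def density_1)
qed

text \<open>The localized translations cover vectors of norm at most 1, so a general
  \<open>u\<close> is reached by n equal steps.\<close>

lemma translation_invariant: "distr P borel (push (\<lambda>x. x + u)) = P"
proof -
  obtain n :: nat where n: "norm u < real n" using reals_Archimedean2 by blast
  have n0: "n > 0" using n by (metis gr0I norm_not_less_zero of_nat_0)
  define v where "v = u /\<^sub>R real n"
  have v: "norm v \<le> 1" using n n0 by (simp add: v_def divide_simps)
  have "distr P borel (push (\<lambda>x. x + real k *\<^sub>R v)) = P" for k
  proof (induction k)
    case 0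
    have "push (\<lambda>x. x) X = X" for X
      by (rule conf_eqI) (use mult_push[OF tame_bij_translation[of 0]] in simp)
    then show ?case using distr_id2[of borel P] sets_P by (simp add: fun_eq_iff)
  next
    case (Suc k)
    have m: "push (\<lambda>x. x + w) \<in> borel \<rightarrow>\<^sub>M borel" for w by (rule measurable_push[OF tame_bij_translation])
    have "push (\<lambda>x. x + real (Suc k) *\<^sub>R v) = push (\<lambda>x. x + v) \<circ> push (\<lambda>x. x + real k *\<^sub>R v)"
      by (intro ext conf_eqI) (simp add: mult_push[OF tame_bij_translation] algebra_simps)
    then have "distr P borel (push (\<lambda>x. x + real (Suc k) *\<^sub>R v)) = distr (distr P borel (push (\<lambda>x. x + real k *\<^sub>R v))) borel (push (\<lambda>x. x + v))"
      using distr_distr[OF m[of v], of "push (\<lambda>x. x + real k *\<^sub>R v)" P] m by (simp add: measurable_cong_sets[OF sets_P refl])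
    then show ?case using Suc translation_invariant_small[OF v] by simp
  qed
  from this[of n] show ?thesis using n0 by (simp add: v_def)
qed

end

theorem theorem3:
  fixes P :: "conf measure"
    and \<beta> \<rho>\<beta> Cchi CT :: real
    and chi :: "nat \<Rightarrow> plane \<Rightarrow> real"
    and Tp Tm :: "plane \<Rightarrow> real \<Rightarrow> plane \<Rightarrow> plane"
  assumes "\<beta> > 0"
    and "\<rho>\<beta> > 0"
    and "dyadic_partition chi Cchi"
    and "localized_translations CT Tp Tm"
    and "point_process P"
    and "good \<beta> \<rho>\<beta> chi Tp Tm P"
    and "DLR \<beta> chi P"
  shows "\<forall>u. distr P borel (push (\<lambda>x. x + u)) = P"
proof
  fix u
  obtain C L0 where C: "C > 0" "L0 \<ge> 2" "good_intensity C P" "good_smooth C \<rho>\<beta> P" "good_translations C L0 \<beta> chi Tp Tm P"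
    using assms(6) unfolding good_def by auto
  have P: "sets P = sets borel" "prob_space P" using assms(5) by (auto simp: point_process_def)
  show "distr P borel (push (\<lambda>x. x + u)) = P"
    by (rule translation_invariant[OF assms(3) P assms(7) C(4,3,1) assms(4) C(2,5)])
qed

end
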